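(* Let $n\ge2$, let $H$ be an ultra-Morse polynomial of degree $n+1$ on $\mathbb C^2$, and let $(x,y)$ be orthonormal coordinates satisfying the transversality condition stated in the context. Let $a$ be a critical value of $H$, $t\in\mathbb C$ a noncritical value, $S_t=\{H=t\}$. Let $\alpha$ be a critically-regular path from $t$ to $a$ with $m(\alpha)$ edges, and let $\widetilde\delta\subset S_t$ be the canonical representative of the cycle vanishing along $\alpha$. Let $X,Y>0$ be such that the topology of $S_t$ is contained in the bidisc $D_{X,Y}$. Then the length $|\widetilde\delta|$ satisfies $$|\widetilde\delta|<2^{l(n)\,m(\alpha)}R,\qquad R=\max\{X,Y\},\quad l(n)=24n^{12}.$$
   Context: Let $h$ be the highest homogeneous part of $H$. $H$ is ultra-Morse if $h$ has only simple zero lines and all critical values of $H$ are simple (so there are $n^2$ distinct critical values, with Morse critical points). Transversality condition: the $y$-axis is transversal to the zero lines of $h$ and to the tangent lines, at each critical point, of the two local branches of the critical level curve of $H$. $D_{X,Y}=\{|x|<X,|y|<Y\}$. The topology of $S_t$ is contained in $D_{X,Y}$ if $S_t\setminus D_{X,Y}$ consists of $n+1$ pairwise disjoint punctured discs, each projected by $(x,y)\mapsto x$ biholomorphically onto $\{X\le|x|<\infty\}$ (i.e. it is a disjoint union of graphs over $\{|x|\ge X\}$ of $n+1$ functions holomorphic in a neighborhood of $\{|x|\ge X\}$). Vanishing cycles. A path $\alpha:[0,1]\to\mathbb C$ is regular if $\alpha(1)=a$ is a critical value of $H$ and $\alpha[0,1)$ contains no critical values. Near the critical point $A$ with value $a$,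 level curves $S_t$ with $t\ne a$ close to $a$ intersect a small ball around $A$ in an annulus; a generator of its first homology is the local vanishing cycle (defined up to sign). Its continuous extension along $\alpha$ back to $t_0=\alpha(0)$ is the cycle in $H_1(S_{t_0},\mathbb Z)$ vanishing along $\alpha$. Critically-regular paths. Let $\pi_t:S_t\to Ox$ be the projection $(x,y)\mapsto x$, and for noncritical $t$ let $CS_t$ be the set of critical values of $\pi_t$. There is $\mu'\in\mathbb N$ such that $\#CS_t=\mu'$ for all but finitely many $t$ (this is the maximal cardinality). A critically-regular path is a piecewise-linear regular path $\alpha$ with finitely many edges such that $\#CS_t=\mu'$ for all $t\in\alpha[0,1)$; $m(\alpha)$ is its number of edges. The points of $CS_{\alpha(\tau)}$ then form $\mu'$ continuous branches $x_i(\tau)$, $\tau\in[0,1)$, with disjoint graphs. Canonical representative. Exactly two of the branches, say $x_1,x_2$, converge to the $x$-coordinate of $A$ as $\tau\to1$. For $\tau$ close to $1$, over a small disc around $x(A)$ the projection restricted to the part of $S_{\alpha(\tau)}$ near $A$ is a double covering branched at $x_1(\tau),x_2(\tau)$, and the union $\widetilde\delta(\tau)$ of the two liftings (near $A$) of the segment $[x_1(\tau),x_2(\tau)]$, taken with opposite orientations, is a closed curve representing the local vanishing cycle. As $\tau$ decreases, $\widetilde\delta(\tau)$ is extended to a continuous family of closed curves in $S_{\alpha(\tau)}$, $\tau\in[0,1)$: it is a union of pairs of arcs, the two arcs of each pair being liftings of a common segment (edge) $[x_i(\tau),x_k(\tau)]$ whose interior contains no point of $CS_{\alpha(\tau)}$.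 As long as no other branch meets the interior of an edge, the edges move continuously with their endpoints; when at some $\tau_1$ some branches $x_j$ meet the interior of an edge, this edge is split at these points into smaller segments, and for $\tau\leq\tau_1$ close to $\tau_1$ the curve is the union of the corresponding pairs of liftings of the new segments, which again move with their endpoints, and so on (finitely many splittings occur on each edge of $\alpha$; one proceeds successively along the edges of $\alpha$ from the last to the first). The closed curve $\widetilde\delta(0)\subset S_{\alpha(0)}$ is the canonical representative of the cycle vanishing along $\alpha$. *)

theory Defs
  imports "HOL-Complex_Analysis.Complex_Analysis" "HOL-Computational_Algebra.Computational_Algebra"
begin

text \<open>
  The orthonormal coordinates \<open>(x, y)\<close> identify the ambient Hermitian plane with
  \<open>complex \<times> complex\<close>, whose norm is the standard Hermitian one; every polynomial is written in
  these coordinates. An element \<open>H\<close> of \<open>complex poly poly\<close> is a polynomial in \<open>y\<close> with coefficients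
  in \<open>\<complex>[x]\<close>, so \<open>coeff (coeff H j) i\<close> is the coefficient of \<open>x ^ i * y ^ j\<close>.
\<close>

definition eval2 :: "complex poly poly \<Rightarrow> complex \<times> complex \<Rightarrow> complex" where
  "eval2 H p = poly (poly H [:snd p:]) (fst p)"

definition deriv_x :: "complex poly poly \<Rightarrow> complex poly poly" where
  "deriv_x H = map_poly pderiv H"

definition deriv_y :: "complex poly poly \<Rightarrow> complex poly poly" where
  "deriv_y H = pderiv H"

definition total_degree :: "complex poly poly \<Rightarrow> nat" where
  "total_degree H = (if H = 0 then 0 else Max {i + j | i j. coeff (coeff H j) i \<noteq> 0})"

definition highest_part :: "complex poly poly \<Rightarrow> complex poly poly" where
  "highest_part H =
    (let d = total_degree H in \<Sum>j\<le>d. monom (monom (coeff (coeff H j) (d - j)) (d - j)) j)"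


subsection \<open>Ultra-Morse polynomials and the transversality condition\<close>

definition critical_points :: "complex poly poly \<Rightarrow> (complex \<times> complex) set" where
  "critical_points H = {p. eval2 (deriv_x H) p = 0 \<and> eval2 (deriv_y H) p = 0}"

definition critical_values :: "complex poly poly \<Rightarrow> complex set" where
  "critical_values H = eval2 H ` critical_points H"

definition hessian_det :: "complex poly poly \<Rightarrow> complex \<times> complex \<Rightarrow> complex" where
  "hessian_det H p =
     eval2 (deriv_x (deriv_x H)) p * eval2 (deriv_y (deriv_y H)) p
     - eval2 (deriv_x (deriv_y H)) p * eval2 (deriv_y (deriv_x H)) p"

text \<open>The linear form \<open>u * x + v * y\<close>.\<close>

definition linear_form :: "complex \<Rightarrow> complex \<Rightarrow> complex poly poly" where
  "linear_form u v = [: [:0, u:], [:v:] :]"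

definition simple_zero_lines :: "complex poly poly \<Rightarrow> bool" where
  "simple_zero_lines h \<longleftrightarrow> (\<forall>u v. (u, v) \<noteq> (0, 0) \<longrightarrow> \<not> linear_form u v ^ 2 dvd h)"

definition ultra_morse :: "complex poly poly \<Rightarrow> bool" where
  "ultra_morse H \<longleftrightarrow>
     simple_zero_lines (highest_part H) \<and>
     (\<forall>p\<in>critical_points H. hessian_det H p \<noteq> 0) \<and>
     inj_on (eval2 H) (critical_points H)"

text \<open>
  A nonzero tangent vector at \<open>A\<close> of a local branch of the level curve through \<open>A\<close>, the branch being
  given by a holomorphic immersed parametrization. At a Morse critical point there are exactly two
  such branches.
\<close>

definition branch_tangent ::
    "complex poly poly \<Rightarrow> complex \<times> complex \<Rightarrow> complex \<times> complex \<Rightarrow> bool" where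
  "branch_tangent H A v \<longleftrightarrow> v \<noteq> 0 \<and>
     (\<exists>g1 g2 r. 0 < r \<and> g1 holomorphic_on ball 0 r \<and> g2 holomorphic_on ball 0 r \<and>
        (g1 0, g2 0) = A \<and> (deriv g1 0, deriv g2 0) = v \<and>
        (\<forall>z\<in>ball 0 r. eval2 H (g1 z, g2 z) = eval2 H A))"

text \<open>A line through the origin (or its translate) is transversal to the \<open>y\<close>-axis iff its direction
  vectors have nonzero first component.\<close>

definition y_axis_transversal :: "complex poly poly \<Rightarrow> bool" where
  "y_axis_transversal H \<longleftrightarrow>
     (\<forall>v. v \<noteq> 0 \<and> eval2 (highest_part H) v = 0 \<longrightarrow> fst v \<noteq> 0) \<and>
     (\<forall>A\<in>critical_points H. \<forall>v. branch_tangent H A v \<longrightarrow> fst v \<noteq> 0)"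


subsection \<open>Level curves\<close>

definition level_curve :: "complex poly poly \<Rightarrow> complex \<Rightarrow> (complex \<times> complex) set" where
  "level_curve H t = {p. eval2 H p = t}"

definition bidisc :: "real \<Rightarrow> real \<Rightarrow> (complex \<times> complex) set" where
  "bidisc X Y = {(x, y). norm x < X \<and> norm y < Y}"

text \<open>For \<open>H\<close> of degree \<open>n + 1\<close> there are \<open>n + 1\<close> graphs.\<close>

definition topology_contained ::
    "complex poly poly \<Rightarrow> complex \<Rightarrow> real \<Rightarrow> real \<Rightarrow> bool" where
  "topology_contained H t X Y \<longleftrightarrow>
     (\<exists>U f. open U \<and> {x. X \<le> norm x} \<subseteq> U \<and>
        (\<forall>i<total_degree H. f i holomorphic_on U) \<and>
        disjoint_family_on (\<lambda>i. {(x, f i x) | x. X \<le> norm x}) {..<total_degree H} \<and>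
        level_curve H t - bidisc X Y = (\<Union>i<total_degree H. {(x, f i x) | x. X \<le> norm x}))"

text \<open>The set \<open>CS\<^sub>t\<close> of critical values of the projection of the level curve to the \<open>x\<close>-axis: images of
  the points at which \<open>dx\<close> vanishes on the tangent line \<open>ker dH\<close>.\<close>

definition proj_critical_values :: "complex poly poly \<Rightarrow> complex \<Rightarrow> complex set" where
  "proj_critical_values H t =
     fst ` {p \<in> level_curve H t.
       \<forall>u v. eval2 (deriv_x H) p * u + eval2 (deriv_y H) p * v = 0 \<longrightarrow> u = 0}"

definition generic_card :: "complex poly poly \<Rightarrow> nat" where
  "generic_card H =
     (THE m. finite {t. t \<notin> critical_values H \<and> card (proj_critical_values H t) \<noteq> m})"


subsection \<open>Critically-regular paths\<close>

definition regular_path :: "complex poly poly \<Rightarrow> (real \<Rightarrow> complex) \<Rightarrow> bool" where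
  "regular_path H \<alpha> \<longleftrightarrow>
     path \<alpha> \<and> \<alpha> 1 \<in> critical_values H \<and> (\<forall>\<tau>\<in>{0..<1}. \<alpha> \<tau> \<notin> critical_values H)"

text \<open>Edges are nondegenerate segments.\<close>

definition polygonal_with_edges :: "(real \<Rightarrow> complex) \<Rightarrow> nat \<Rightarrow> bool" where
  "polygonal_with_edges \<alpha> m \<longleftrightarrow>
     (\<exists>s. s 0 = (0::real) \<and> s m = 1 \<and>
        (\<forall>k<m. s k < s (Suc k) \<and> \<alpha> (s k) \<noteq> \<alpha> (s (Suc k)) \<and>
           (\<forall>u\<in>{0..1}. subpath (s k) (s (Suc k)) \<alpha> u = linepath (\<alpha> (s k)) (\<alpha> (s (Suc k))) u)))"

definition num_edges :: "(real \<Rightarrow> complex) \<Rightarrow> nat" where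
  "num_edges \<alpha> = (LEAST m. polygonal_with_edges \<alpha> m)"

definition critically_regular :: "complex poly poly \<Rightarrow> (real \<Rightarrow> complex) \<Rightarrow> bool" where
  "critically_regular H \<alpha> \<longleftrightarrow>
     regular_path H \<alpha> \<and> (\<exists>m. polygonal_with_edges \<alpha> m) \<and>
     (\<forall>\<tau>\<in>{0..<1}. finite (proj_critical_values H (\<alpha> \<tau>)) \<and>
                   card (proj_critical_values H (\<alpha> \<tau>)) = generic_card H)"

text \<open>The continuous branches \<open>x 0, \<dots>, x (\<mu>' - 1)\<close>, with disjoint graphs, of the critical values of
  the projections along \<open>\<alpha>\<close>.\<close>

definition critical_branches ::
    "complex poly poly \<Rightarrow> (real \<Rightarrow> complex) \<Rightarrow> (nat \<Rightarrow> real \<Rightarrow> complex) \<Rightarrow> bool" where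
  "critical_branches H \<alpha> x \<longleftrightarrow>
     (\<forall>i<generic_card H. continuous_on {0..<1} (x i)) \<and>
     (\<forall>\<tau>\<in>{0..<1}. bij_betw (\<lambda>i. x i \<tau>) {..<generic_card H} (proj_critical_values H (\<alpha> \<tau>)))"


subsection \<open>The canonical representative\<close>

text \<open>
  A pair of arcs \<open>(i, k, g, g')\<close> consists of two liftings \<open>g\<close>, \<open>g'\<close> of the edge from branch \<open>i\<close> to
  branch \<open>k\<close>, both parametrized from \<open>i\<close> to \<open>k\<close>. The closed curve at a given time is kept as the list
  of its pairs, ordered so that the edges form a polygonal chain; the curve runs along the first
  liftings and returns along the second ones. In a moving pair, \<open>g\<close> and \<open>g'\<close> depend on the time.
\<close>

type_synonym arc2 = "real \<Rightarrow> complex \<times> complex"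
type_synonym arc_pair = "nat \<times> nat \<times> arc2 \<times> arc2"
type_synonym moving_pair = "nat \<times> nat \<times> (real \<Rightarrow> arc2) \<times> (real \<Rightarrow> arc2)"

fun join_arcs :: "arc2 list \<Rightarrow> arc2" where
  "join_arcs [] = (\<lambda>_. undefined)"
| "join_arcs [g] = g"
| "join_arcs (g # h # gs) = g +++ join_arcs (h # gs)"

definition loop_of :: "arc_pair list \<Rightarrow> arc2" where
  "loop_of es = join_arcs (map (\<lambda>(i, k, g, g'). g) es)
                +++ reversepath (join_arcs (map (\<lambda>(i, k, g, g'). g') es))"

definition closed_curve :: "arc2 \<Rightarrow> bool" where
  "closed_curve \<delta> \<longleftrightarrow> path \<delta> \<and> pathfinish \<delta> = pathstart \<delta>"

definition at_time :: "real \<Rightarrow> moving_pair list \<Rightarrow> arc_pair list" where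
  "at_time \<tau> M = map (\<lambda>(i, k, F, F'). (i, k, F \<tau>, F' \<tau>)) M"

text \<open>A continuous family, over times in \<open>T\<close>, of liftings of the segments \<open>[p \<tau>, q \<tau>]\<close>.\<close>

definition lifting_family ::
    "complex poly poly \<Rightarrow> (real \<Rightarrow> complex) \<Rightarrow> (real \<Rightarrow> complex) \<Rightarrow> (real \<Rightarrow> complex)
      \<Rightarrow> real set \<Rightarrow> (real \<Rightarrow> arc2) \<Rightarrow> bool" where
  "lifting_family H \<alpha> p q T F \<longleftrightarrow>
     continuous_on (T \<times> {0..1}) (\<lambda>(\<tau>, s). F \<tau> s) \<and>
     (\<forall>\<tau>\<in>T. \<forall>s\<in>{0..1}.
        F \<tau> s \<in> level_curve H (\<alpha> \<tau>) \<and> fst (F \<tau> s) = linepath (p \<tau>) (q \<tau>) s)"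

definition closed_curve_family ::
    "complex poly poly \<Rightarrow> (real \<Rightarrow> complex) \<Rightarrow> (nat \<Rightarrow> real \<Rightarrow> complex)
      \<Rightarrow> real set \<Rightarrow> moving_pair list \<Rightarrow> bool" where
  "closed_curve_family H \<alpha> x T M \<longleftrightarrow>
     (\<forall>(i, k, F, F')\<in>set M.
        lifting_family H \<alpha> (x i) (x k) T F \<and> lifting_family H \<alpha> (x i) (x k) T F') \<and>
     (\<forall>\<tau>\<in>T. closed_curve (loop_of (at_time \<tau> M)))"

definition edges_unobstructed ::
    "complex poly poly \<Rightarrow> (real \<Rightarrow> complex) \<Rightarrow> (nat \<Rightarrow> real \<Rightarrow> complex)
      \<Rightarrow> real set \<Rightarrow> moving_pair list \<Rightarrow> bool" where
  "edges_unobstructed H \<alpha> x T M \<longleftrightarrow>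
     (\<forall>(i, k, F, F')\<in>set M. \<forall>\<tau>\<in>T.
        open_segment (x i \<tau>) (x k \<tau>) \<inter> proj_critical_values H (\<alpha> \<tau>) = {})"

text \<open>
  \<open>continued_curve H \<alpha> x A \<tau> es\<close>: the closed curve at time \<open>\<tau>\<close> is the union of the pairs in \<open>es\<close>.
  Time runs from \<open>1\<close> down to \<open>0\<close>. In \<open>start\<close>, uniform convergence to \<open>A\<close> singles out the two sheets
  near \<open>A\<close>. The edges must be unobstructed on an interval that is open at its lower end, where a
  branch may reach the interior of an edge; \<open>move\<close> then cannot be applied again until \<open>split\<close> has
  subdivided the edge at every branch in its interior.
\<close>

inductive continued_curve ::
    "complex poly poly \<Rightarrow> (real \<Rightarrow> complex) \<Rightarrow> (nat \<Rightarrow> real \<Rightarrow> complex) \<Rightarrow> complex \<times> complex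
      \<Rightarrow> real \<Rightarrow> arc_pair list \<Rightarrow> bool"
  for H \<alpha> x A where
  start:
    "continued_curve H \<alpha> x A \<tau> (at_time \<tau> M)"
    if "0 \<le> \<tau>" "\<tau> < 1" "M = [(i, k, F, F')]"
       "i < generic_card H" "k < generic_card H" "i \<noteq> k"
       "(x i \<longlongrightarrow> fst A) (at_left 1)" "(x k \<longlongrightarrow> fst A) (at_left 1)"
       "closed_curve_family H \<alpha> x {\<tau>..<1} M"
       "edges_unobstructed H \<alpha> x {\<tau><..<1} M"
       "\<forall>\<sigma>\<in>{\<tau><..<1}. \<forall>s\<in>{0<..<1}. F \<sigma> s \<noteq> F' \<sigma> s"
       "uniform_limit {0..1} F (\<lambda>_. A) (at_left 1)"
       "uniform_limit {0..1} F' (\<lambda>_. A) (at_left 1)"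
| move:
    "continued_curve H \<alpha> x A \<tau> (at_time \<tau> M)"
    if "continued_curve H \<alpha> x A \<tau>' (at_time \<tau>' M)" "0 \<le> \<tau>" "\<tau> < \<tau>'"
       "closed_curve_family H \<alpha> x {\<tau>..\<tau>'} M"
       "edges_unobstructed H \<alpha> x {\<tau><..\<tau>'} M"
| split:
    "continued_curve H \<alpha> x A \<tau>
       (es @ [(i, j, subpath 0 u g, subpath 0 u g'), (j, k, subpath u 1 g, subpath u 1 g')] @ es')"
    if "continued_curve H \<alpha> x A \<tau> (es @ [(i, k, g, g')] @ es')"
       "j < generic_card H" "0 < u" "u < 1" "x j \<tau> = linepath (x i \<tau>) (x k \<tau>) u"

definition canonical_representative ::
    "complex poly poly \<Rightarrow> (real \<Rightarrow> complex) \<Rightarrow> arc2 \<Rightarrow> bool" where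
  "canonical_representative H \<alpha> \<delta> \<longleftrightarrow>
     (\<exists>A x es. A \<in> critical_points H \<and> eval2 H A = \<alpha> 1 \<and> critical_branches H \<alpha> x \<and>
        continued_curve H \<alpha> x A 0 es \<and> \<delta> = loop_of es)"


subsection \<open>Length\<close>

text \<open>The length of a parametrized curve, as the supremum of the lengths of inscribed polygons
  (infinite for nonrectifiable curves).\<close>

definition curve_length :: "(real \<Rightarrow> 'a::metric_space) \<Rightarrow> ereal" where
  "curve_length g =
     (SUP ts \<in> {ts. sorted ts \<and> set ts \<subseteq> {0..1}}.
        ereal (\<Sum>k<length ts - 1. dist (g (ts ! k)) (g (ts ! Suc k))))"

end

theory Submission
  imports Defs
begin

text \<open>
At time \<open>0\<close> the canonical representative consists of pairs of liftings of segments joining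
critical values of the projection to the \<open>x\<close>-axis, so its length is controlled by the length of
one lifting and by the number of pairs. Both bounds come from one elimination principle: a
polynomial expression in roots of polynomials whose coefficients depend polynomially on a real
parameter \<open>\<tau>\<close> vanishes at few values of \<open>\<tau>\<close> only, unless it vanishes identically.

Elimination. Let the expression be evaluated on all tuples of roots, independently in every
coordinate. The sum of a monomial over all tuples is a product of power sums of roots, hence a
polynomial in \<open>\<tau>\<close>; by Newton's identities (\<open>newton_identity\<close>) the elementary symmetric functions of
the values of the expression are then polynomials in \<open>\<tau>\<close> as well (\<open>polyfun_tuple_esymm\<close>). Their
degrees are read off from the growth of the roots (\<open>esymm_degree_le\<close>). Complex conjugates of roots
are roots of the conjugate polynomial when \<open>\<tau>\<close> is real, so expressions may contain conjugates, at
the price of treating a root and its conjugate as independent variables.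

Critical values of the projection. Eliminating \<open>y\<close> from \<open>H = t\<close> and \<open>dH/dy = 0\<close> gives the product
of \<open>t - H (x, b)\<close> over the roots \<open>b\<close> of \<open>dH/dy (x, _)\<close>. It has degree \<open>n (n + 1)\<close> in \<open>x\<close> with a
leading coefficient independent of \<open>t\<close>, because \<open>H\<close> grows like \<open>x ^ (n + 1)\<close> along its polar curve
(\<open>polar_growth\<close>); this is where the simplicity of the zero lines and the transversality of the
\<open>y\<close>-axis are used. The same growth shows that the critical values are \<open>O (t ^ (1 / (n + 1)))\<close>.

Number of pairs. An edge \<open>[x_i, x_k]\<close> is subdivided only when some \<open>x_j\<close> enters it, and then the
alignment of \<open>x_i, x_j, x_k\<close> changes. Alignment is the vanishing of an expression in three roots and
their three conjugates. Along one edge of the path, consider the last elementary symmetric function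
of its values on all \<open>(n (n + 1)) ^ 6\<close> sextuples that is not identically zero. Off its zeros the
number of vanishing values is the minimal one, so that by continuity no triple can lose its
alignment; and the degree bound leaves at most \<open>2 n ^ 6 (n + 1) ^ 5\<close> zeros
(\<open>special_times_on_edge\<close>). Crossing such a time multiplies the number of pairs by at most the
number of critical values (\<open>continued_curve_pieces\<close>).

Length of a lifting. By Crofton's principle it suffices to count the points of the lifting at which
\<open>Re y\<close>, or \<open>Im y\<close>, takes a given value \<open>c\<close>. At such a point the sum of a root and the conjugate of a
root equals \<open>2 c\<close>, so elimination bounds their number by \<open>(n + 1) ^ 2\<close> for all but finitely many
\<open>c\<close> (\<open>level_arc_crossings\<close>), and the total variation follows by integrating over \<open>c\<close>.
\<close>

section \<open>Polynomial functions of a parameter\<close>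

text \<open>
The parameter is complex or real; \<open>\<iota>\<close> is the identity or the inclusion of the reals.
\<close>

definition polyfun :: "('a \<Rightarrow> complex) \<Rightarrow> ('a \<Rightarrow> complex) \<Rightarrow> bool" where
  "polyfun \<iota> f \<longleftrightarrow> (\<exists>p. \<forall>\<tau>. f \<tau> = poly p (\<iota> \<tau>))"

lemma polyfun_const [intro]: "polyfun \<iota> (\<lambda>_. c)"
  unfolding polyfun_def by (rule exI [of _ "[:c:]"]) simp

lemma polyfun_param [intro]: "polyfun \<iota> \<iota>"
  unfolding polyfun_def by (rule exI [of _ "[:0, 1:]"]) simp

lemma polyfun_poly [intro]: "polyfun \<iota> (\<lambda>\<tau>. poly p (\<iota> \<tau>))"
  unfolding polyfun_def by blast

lemma polyfun_add [intro]: "polyfun \<iota> f \<Longrightarrow> polyfun \<iota> g \<Longrightarrow> polyfun \<iota> (\<lambda>\<tau>. f \<tau> + g \<tau>)"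
  unfolding polyfun_def by (metis poly_add)

lemma polyfun_mult [intro]: "polyfun \<iota> f \<Longrightarrow> polyfun \<iota> g \<Longrightarrow> polyfun \<iota> (\<lambda>\<tau>. f \<tau> * g \<tau>)"
  unfolding polyfun_def by (metis poly_mult)

lemma polyfun_diff [intro]: "polyfun \<iota> f \<Longrightarrow> polyfun \<iota> g \<Longrightarrow> polyfun \<iota> (\<lambda>\<tau>. f \<tau> - g \<tau>)"
  unfolding polyfun_def by (metis poly_diff)

lemma polyfun_uminus [intro]: "polyfun \<iota> f \<Longrightarrow> polyfun \<iota> (\<lambda>\<tau>. - f \<tau>)"
  unfolding polyfun_def by (metis poly_minus)

lemma polyfun_power [intro]: "polyfun \<iota> f \<Longrightarrow> polyfun \<iota> (\<lambda>\<tau>. f \<tau> ^ k)"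
  unfolding polyfun_def by (metis poly_power)

lemma polyfun_sum [intro]:
  "(\<And>i. i \<in> A \<Longrightarrow> polyfun \<iota> (f i)) \<Longrightarrow> polyfun \<iota> (\<lambda>\<tau>. \<Sum>i\<in>A. f i \<tau>)"
  by (induction A rule: infinite_finite_induct) auto

lemma polyfun_prod [intro]:
  "(\<And>i. i \<in> A \<Longrightarrow> polyfun \<iota> (f i)) \<Longrightarrow> polyfun \<iota> (\<lambda>\<tau>. \<Prod>i\<in>A. f i \<tau>)"
  by (induction A rule: infinite_finite_induct) auto

lemma polyfun_compose:
  assumes "polyfun id f" "polyfun \<iota> g"
  shows "polyfun \<iota> (\<lambda>\<tau>. f (g \<tau>))"
proof -
  obtain p q where "\<And>t. f t = poly p t" "\<And>\<tau>. g \<tau> = poly q (\<iota> \<tau>)"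
    using assms unfolding polyfun_def by auto
  then have "\<forall>\<tau>. f (g \<tau>) = poly (pcompose p q) (\<iota> \<tau>)" by (simp add: poly_pcompose)
  then show ?thesis unfolding polyfun_def by blast
qed

text \<open>
For a real parameter, conjugating the coefficients conjugates the values. This is what allows
conjugates of roots to be treated as algebraic functions.
\<close>

lemma polyfun_cnj:
  assumes "polyfun (of_real :: real \<Rightarrow> complex) f"
  shows "polyfun of_real (\<lambda>\<tau>. cnj (f \<tau>))"
proof -
  obtain p where p: "\<And>\<tau>. f \<tau> = poly p (of_real \<tau>)"
    using assms unfolding polyfun_def by auto
  have "cnj (f \<tau>) = poly (map_poly cnj p) (of_real \<tau>)" for \<tau>
    unfolding p poly_cnj complex_cnj_complex_of_real ..
  then show ?thesis unfolding polyfun_def by blast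
qed

text \<open>
  A polynomial of degree above \<open>r / q\<close> would outgrow \<open>(1 + \<tau>) powr (r / q)\<close> along the real axis;
  fractional exponents are avoided by taking a power of the polynomial.
\<close>

lemma degree_le_of_growth:
  fixes p :: "complex poly"
  assumes growth: "\<And>\<tau>::real. \<tau> \<ge> 0 \<Longrightarrow> norm (poly p (of_real \<tau>)) ^ q \<le> C * (1 + \<tau>) ^ r"
  shows "degree p * q \<le> r"
proof (rule ccontr)
  assume "\<not> degree p * q \<le> r"
  then have deg: "r < degree p * q" by simp
  then have "p \<noteq> 0" by auto
  define P where "P = p ^ q"
  have degP: "degree P = degree p * q" and "P \<noteq> 0"
    unfolding P_def using \<open>p \<noteq> 0\<close> by (simp_all add: degree_power_eq mult.commute)
  have at: "filterlim (of_real :: real \<Rightarrow> complex) at_infinity at_top"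
    by (simp add: filterlim_at_infinity_conv_norm_at_top filterlim_abs_real)
  have "((\<lambda>\<tau>::real. poly P (of_real \<tau>) / of_real \<tau> ^ degree P) \<longlongrightarrow> lead_coeff P) at_top"
    using filterlim_compose [OF poly_divide_tendsto_aux at] .
  then have lim: "((\<lambda>\<tau>::real. norm (poly P (of_real \<tau>) / of_real \<tau> ^ degree P))
      \<longlongrightarrow> norm (lead_coeff P)) at_top"
    by (rule tendsto_norm)
  have bound: "((\<lambda>\<tau>::real. \<bar>C\<bar> * 2 ^ r / \<tau>) \<longlongrightarrow> 0) at_top"
    by (intro tendsto_divide_0 [OF tendsto_const] filterlim_at_top_imp_at_infinity filterlim_ident)
  have "\<forall>\<^sub>F \<tau> in at_top. norm (poly P (of_real \<tau>) / of_real \<tau> ^ degree P) \<le> \<bar>C\<bar> * 2 ^ r / \<tau>"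
    using eventually_ge_at_top [of 1]
  proof eventually_elim
    case (elim \<tau>)
    obtain e where e: "degree P = Suc (r + e)"
      using deg degP by (metis less_iff_Suc_add)
    have "norm (poly P (of_real \<tau>)) \<le> \<bar>C\<bar> * (1 + \<tau>) ^ r"
      using growth [of \<tau>] elim unfolding P_def
      by (simp add: norm_power) (smt (verit) mult_right_mono zero_le_power)
    also have "\<dots> \<le> \<bar>C\<bar> * (2 * \<tau>) ^ r"
      using elim by (intro mult_left_mono power_mono) auto
    also have "\<dots> = \<bar>C\<bar> * 2 ^ r * \<tau> ^ r * 1" by (simp add: power_mult_distrib)
    also have "\<dots> \<le> \<bar>C\<bar> * 2 ^ r * \<tau> ^ r * \<tau> ^ e"
      using elim by (intro mult_left_mono) auto
    finally have "norm (poly P (of_real \<tau>)) * \<tau> \<le> \<bar>C\<bar> * 2 ^ r * \<tau> ^ degree P"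
      using elim by (simp add: e power_add mult_ac)
    then show ?case
      using elim by (simp add: norm_divide norm_power field_simps)
  qed
  from tendsto_le [OF _ bound lim this] have "norm (lead_coeff P) \<le> 0" by simp
  then show False using \<open>P \<noteq> 0\<close> by simp
qed

text \<open>
The converse bound: a polynomial of degree below \<open>m\<close> is eventually dominated by \<open>c * \<tau> ^ m\<close>.
\<close>

lemma degree_ge_of_growth:
  fixes p :: "complex poly"
  assumes "c > 0" and low: "\<And>\<tau>::real. \<tau> \<ge> R \<Longrightarrow> c * \<tau> ^ m \<le> norm (poly p (of_real \<tau>))"
  shows "m \<le> degree p"
proof (rule ccontr)
  assume "\<not> m \<le> degree p"
  then obtain l where l: "m = Suc (degree p + l)" by (metis less_iff_Suc_add not_le)
  define K where "K = (\<Sum>i\<le>degree p. norm (coeff p i))"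
  define \<tau> where "\<tau> = max R (max 1 (K / c + 1))"
  have \<tau>: "\<tau> \<ge> R" "\<tau> \<ge> 1" "\<tau> \<ge> K / c + 1" unfolding \<tau>_def by auto
  have "norm (poly p (of_real \<tau>)) \<le> (\<Sum>i\<le>degree p. norm (coeff p i) * \<tau> ^ degree p)"
    unfolding poly_altdef
  proof (rule sum_norm_le)
    fix i assume "i \<in> {..degree p}"
    then have "\<tau> ^ i \<le> \<tau> ^ degree p" using \<tau>(2) by (intro power_increasing) auto
    then show "norm (coeff p i * of_real \<tau> ^ i) \<le> norm (coeff p i) * \<tau> ^ degree p"
      using \<tau>(2) by (simp add: norm_mult norm_power mult_left_mono)
  qed
  then have up: "norm (poly p (of_real \<tau>)) \<le> K * \<tau> ^ degree p"
    by (simp add: K_def sum_distrib_right)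
  have "c * \<tau> * \<tau> ^ degree p = c * \<tau> * \<tau> ^ degree p * 1" by simp
  also have "\<dots> \<le> c * \<tau> * \<tau> ^ degree p * \<tau> ^ l"
    using \<tau>(2) \<open>c > 0\<close> by (intro mult_left_mono one_le_power) auto
  also have "\<dots> = c * \<tau> ^ m" by (simp add: l power_add)
  also have "\<dots> \<le> K * \<tau> ^ degree p" using low [OF \<tau>(1)] up by linarith
  finally have "c * \<tau> * \<tau> ^ degree p \<le> K * \<tau> ^ degree p" .
  moreover have "\<tau> ^ degree p > 0" using \<tau>(2) by (intro zero_less_power) linarith
  ultimately have "c * \<tau> \<le> K" using mult_le_cancel_right_pos by blast
  then have "\<tau> \<le> K / c" using \<open>c > 0\<close> by (simp add: field_simps)
  then show False using \<tau>(3) by linarith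
qed

section \<open>Newton's identities and symmetric functions of the roots\<close>

text \<open>
The logarithmic derivative of \<open>1 - a * X\<close> is minus the geometric series \<open>a + a\<^sup>2 * X + \<dots>\<close>, and
logarithmic derivatives of products add up.
\<close>

lemma fps_deriv_prod_linear:
  fixes f :: "'u \<Rightarrow> 'a::field_char_0"
  assumes "finite U"
  shows "fps_deriv (\<Prod>u\<in>U. 1 - fps_const (f u) * fps_X) =
    - (\<Prod>u\<in>U. 1 - fps_const (f u) * fps_X) * Abs_fps (\<lambda>l. \<Sum>u\<in>U. f u ^ Suc l)"
  using assms
proof (induction U rule: finite_induct)
  case empty
  then show ?case by (simp add: fps_eq_iff)
next
  case (insert v U)
  let ?P = "\<Prod>u\<in>U. 1 - fps_const (f u) * fps_X"
  let ?G = "Abs_fps (\<lambda>l. \<Sum>u\<in>U. f u ^ Suc l)"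
  let ?E = "Abs_fps (\<lambda>l. f v ^ Suc l)"
  have split: "Abs_fps (\<lambda>l. \<Sum>u\<in>insert v U. f u ^ Suc l) = ?E + ?G"
    using insert by (simp add: fps_eq_iff)
  have geo: "(1 - fps_const (f v) * fps_X) * ?E = fps_const (f v)"
  proof (rule fps_ext)
    fix k show "fps_nth ((1 - fps_const (f v) * fps_X) * ?E) k = fps_nth (fps_const (f v)) k"
      by (cases k) (simp_all add: algebra_simps mult.assoc)
  qed
  have d: "fps_deriv (1 - fps_const (f v) * fps_X) = - fps_const (f v)"
    by simp
  have "fps_deriv ((1 - fps_const (f v) * fps_X) * ?P) =
      (1 - fps_const (f v) * fps_X) * (- ?P * ?G) + (- fps_const (f v)) * ?P"
    by (simp only: fps_deriv_mult d insert.IH)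
  also have "\<dots> = - ((1 - fps_const (f v) * fps_X) * ?P) * (?E + ?G)"
  proof -
    have alg: "L * (- P * G) + (- c) * P = - (L * P) * (E + G)" if "L * E = c"
      for L P G E c :: "'a fps"
      using that by (simp add: algebra_simps flip: that)
    show ?thesis by (rule alg [OF geo])
  qed
  finally show ?case
    using insert split by simp
qed

text \<open>
The polynomial \<open>\<Prod>u. 1 - f u * X\<close> is used as the generating function of the elementary symmetric
functions, up to sign. Comparing coefficients in its logarithmic derivative relates them to the
power sums.
\<close>

lemma newton_identity:
  fixes f :: "'u \<Rightarrow> 'a::field_char_0"
  assumes "finite U"
  defines "b \<equiv> coeff (\<Prod>u\<in>U. [:1, - f u:])"
  shows "of_nat (Suc k) * b (Suc k) = - (\<Sum>j\<le>k. b j * (\<Sum>u\<in>U. f u ^ Suc (k - j)))"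
proof -
  have lin: "fps_of_poly [:1, - f u:] = 1 - fps_const (f u) * fps_X" for u
  proof (rule fps_ext)
    fix k show "fps_nth (fps_of_poly [:1, - f u:]) k = fps_nth (1 - fps_const (f u) * fps_X) k"
      by (cases k) (auto simp: coeff_pCons split: nat.splits)
  qed
  let ?P = "\<Prod>u\<in>U. 1 - fps_const (f u) * fps_X"
  have "b j = fps_nth ?P j" for j
    unfolding b_def by (simp add: lin [symmetric] fps_of_poly_prod [symmetric])
  moreover have "fps_nth (fps_deriv ?P) k =
      fps_nth (- ?P * Abs_fps (\<lambda>l. \<Sum>u\<in>U. f u ^ Suc l)) k"
    by (simp only: fps_deriv_prod_linear [OF assms(1)])
  ultimately show ?thesis
    by (simp add: fps_mult_nth atLeast0AtMost)
qed

text \<open>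
Newton's identities express each elementary symmetric function through earlier ones and the power
sums; dividing by \<open>k\<close> is possible in characteristic zero.
\<close>

lemma polyfun_esymm_of_power_sums:
  assumes "finite U" and S: "\<And>l. polyfun \<iota> (\<lambda>\<tau>. \<Sum>u\<in>U. f u \<tau> ^ l)"
  shows "polyfun \<iota> (\<lambda>\<tau>. coeff (\<Prod>u\<in>U. [:1, - f u \<tau>:]) k)"
proof (induction k rule: less_induct)
  case (less k)
  show ?case
  proof (cases k)
    case 0
    have "coeff (\<Prod>u\<in>U. [:1, - f u \<tau>:]) 0 = 1" for \<tau>
      by (simp add: poly_0_coeff_0 [symmetric] poly_prod)
    then show ?thesis using 0 by auto
  next
    case (Suc k')
    have eq: "coeff (\<Prod>u\<in>U. [:1, - f u \<tau>:]) k =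
        - (1 / of_nat k) * (\<Sum>j\<le>k'. coeff (\<Prod>u\<in>U. [:1, - f u \<tau>:]) j * (\<Sum>u\<in>U. f u \<tau> ^ Suc (k' - j)))"
      for \<tau>
      using newton_identity [OF assms(1), of k' "\<lambda>u. f u \<tau>"] unfolding Suc
      by (simp add: field_simps del: of_nat_Suc)
    show ?thesis
      unfolding eq by (intro polyfun_mult polyfun_const polyfun_sum less S) (simp add: Suc)
  qed
qed

text \<open>
Newton's identities read in the opposite direction.
\<close>

lemma polyfun_power_sums_of_esymm:
  assumes "finite U" and b: "\<And>k. polyfun \<iota> (\<lambda>\<tau>. coeff (\<Prod>u\<in>U. [:1, - f u \<tau>:]) k)"
  shows "polyfun \<iota> (\<lambda>\<tau>. \<Sum>u\<in>U. f u \<tau> ^ l)"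
proof (induction l rule: less_induct)
  case (less l)
  show ?case
  proof (cases l)
    case 0
    then show ?thesis by auto
  next
    case (Suc l')
    let ?b = "\<lambda>\<tau>. coeff (\<Prod>u\<in>U. [:1, - f u \<tau>:])"
    have b0: "?b \<tau> 0 = 1" for \<tau>
      by (simp add: poly_0_coeff_0 [symmetric] poly_prod)
    have eq: "(\<Sum>u\<in>U. f u \<tau> ^ l) = - (of_nat l * ?b \<tau> l) -
        (\<Sum>j<l'. ?b \<tau> (Suc j) * (\<Sum>u\<in>U. f u \<tau> ^ (l' - j)))" for \<tau>
    proof -
      have "of_nat l * ?b \<tau> l = - (\<Sum>j\<le>l'. ?b \<tau> j * (\<Sum>u\<in>U. f u \<tau> ^ Suc (l' - j)))"
        using newton_identity [OF assms(1), of l' "\<lambda>u. f u \<tau>"] unfolding Suc .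
      also have "(\<Sum>j\<le>l'. ?b \<tau> j * (\<Sum>u\<in>U. f u \<tau> ^ Suc (l' - j))) =
          (\<Sum>u\<in>U. f u \<tau> ^ l) + (\<Sum>j<l'. ?b \<tau> (Suc j) * (\<Sum>u\<in>U. f u \<tau> ^ Suc (l' - Suc j)))"
        by (subst sum.atMost_shift) (simp add: b0 Suc)
      also have "(\<Sum>j<l'. ?b \<tau> (Suc j) * (\<Sum>u\<in>U. f u \<tau> ^ Suc (l' - Suc j))) =
          (\<Sum>j<l'. ?b \<tau> (Suc j) * (\<Sum>u\<in>U. f u \<tau> ^ (l' - j)))"
        by (intro sum.cong refl) (simp add: Suc_diff_Suc)
      finally have "of_nat l * ?b \<tau> l = - ((\<Sum>u\<in>U. f u \<tau> ^ l) +
          (\<Sum>j<l'. ?b \<tau> (Suc j) * (\<Sum>u\<in>U. f u \<tau> ^ (l' - j))))" .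
      then show ?thesis by (simp add: eq_neg_iff_add_eq_0 add_ac)
    qed
    show ?thesis
      unfolding eq
      by (intro polyfun_diff polyfun_uminus polyfun_mult polyfun_const polyfun_sum less b) (simp add: Suc)
  qed
qed

text \<open>
The roots are enumerated with multiplicity separately for every parameter; their symmetric functions
do not depend on the choice. The reversed polynomial of a
product of factors \<open>X - y\<close> is the product of the factors \<open>1 - y * X\<close>.
\<close>

lemma roots_enumeration:
  fixes P :: "'a \<Rightarrow> complex poly"
  assumes deg: "\<And>\<tau>. degree (P \<tau>) = d" and lead: "\<And>\<tau>. coeff (P \<tau>) d = c" and "c \<noteq> 0"
    and coeffs: "\<And>k. polyfun \<iota> (\<lambda>\<tau>. coeff (P \<tau>) k)"
  obtains y where "\<And>\<tau>. P \<tau> = smult c (\<Prod>i<d. [:- y i \<tau>, 1:])"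
    and "\<And>l. polyfun \<iota> (\<lambda>\<tau>. \<Sum>i<d. y i \<tau> ^ l)"
proof -
  have "\<exists>y. P \<tau> = smult c (\<Prod>i<d. [:- y i, 1:])" for \<tau>
  proof -
    obtain xs where xs: "mset xs = proots (P \<tau>)" using ex_mset by blast
    have "P \<tau> = smult (lead_coeff (P \<tau>)) (\<Prod>x\<in>#proots (P \<tau>). [:- x, 1:])"
      by (simp add: complex_poly_decompose_multiset)
    also have "(\<Prod>x\<in>#proots (P \<tau>). [:- x, 1:]) = (\<Prod>x\<leftarrow>xs. [:- x, 1:])"
      by (simp add: xs [symmetric] prod_mset_prod_list [symmetric])
    also have "\<dots> = (\<Prod>i<length xs. [:- (xs ! i), 1:])"
      by (simp add: prod.list_conv_set_nth atLeast0LessThan)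
    finally have eq: "P \<tau> = smult c (\<Prod>i<length xs. [:- (xs ! i), 1:])"
      by (simp add: deg lead)
    have "degree (\<Prod>i<length xs. [:- (xs ! i), 1:]) = length xs"
      by (subst degree_prod_eq_sum_degree) auto
    then have "length xs = d"
      using deg [of \<tau>] \<open>c \<noteq> 0\<close> by (simp add: eq)
    then show ?thesis using eq by blast
  qed
  then obtain y' where "\<forall>\<tau>. P \<tau> = smult c (\<Prod>i<d. [:- y' \<tau> i, 1:])" by metis
  then obtain y where y: "\<And>\<tau>. P \<tau> = smult c (\<Prod>i<d. [:- y i \<tau>, 1:])"
    by (auto intro: that [of "\<lambda>i \<tau>. y' \<tau> i"])
  have refl1: "reflect_poly [:- z, 1:] = [:1, - z:]" for z :: complex
    by (simp add: reflect_poly_def)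
  have rev: "coeff (\<Prod>i<d. [:1, - y i \<tau>:]) k = (if k > d then 0 else coeff (P \<tau>) (d - k) / c)" for k \<tau>
  proof -
    have "(\<Prod>i<d. [:1, - y i \<tau>:]) = reflect_poly (\<Prod>i<d. [:- y i \<tau>, 1:])"
      by (simp only: reflect_poly_prod refl1)
    moreover have "degree (\<Prod>i<d. [:- y i \<tau>, 1:]) = d"
      using deg [of \<tau>] \<open>c \<noteq> 0\<close> by (simp add: y)
    ultimately show ?thesis
      using \<open>c \<noteq> 0\<close> by (simp add: coeff_reflect_poly y)
  qed
  have "polyfun \<iota> (\<lambda>\<tau>. coeff (\<Prod>i<d. [:1, - y i \<tau>:]) k)" for k
    using polyfun_mult [OF coeffs [of "d - k"] polyfun_const [of \<iota> "1 / c"]]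
    by (cases "k > d") (auto simp: rev)
  then have "polyfun \<iota> (\<lambda>\<tau>. \<Sum>i<d. y i \<tau> ^ l)" for l
    by (intro polyfun_power_sums_of_esymm) auto
  with y show ?thesis using that by blast
qed

text \<open>
Each coefficient is a sum of at most \<open>2 ^ card U\<close> products of \<open>k\<close> of the numbers.
\<close>

lemma norm_esymm_le:
  fixes f :: "'u \<Rightarrow> complex"
  assumes "finite U" "B \<ge> 0" "\<And>u. u \<in> U \<Longrightarrow> norm (f u) \<le> B"
  shows "norm (coeff (\<Prod>u\<in>U. [:1, - f u:]) k) \<le> 2 ^ card U * B ^ k"
  using assms(1,3)
proof (induction U arbitrary: k rule: finite_induct)
  case empty
  then show ?case using assms(2) by (cases k) (auto simp: coeff_pCons)
next
  case (insert v U)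
  let ?P = "\<Prod>u\<in>U. [:1, - f u:]"
  have IH: "norm (coeff ?P k) \<le> 2 ^ card U * B ^ k" for k using insert by auto
  have "norm (coeff ([:1, - f v:] * ?P) k) \<le> 2 * (2 ^ card U * B ^ k)"
  proof (cases k)
    case 0
    have "coeff ([:1, - f v:] * ?P) 0 = coeff ?P 0" by simp
    moreover have "(2::real) ^ card U \<le> 2 * 2 ^ card U" by simp
    ultimately have "2 ^ card U * B ^ 0 \<le> 2 * (2 ^ card U * B ^ 0)" by simp
    with IH [of 0] have "norm (coeff ?P 0) \<le> 2 * (2 ^ card U * B ^ 0)" by linarith
    then show ?thesis by (simp add: 0)
  next
    case (Suc j)
    have "coeff ([:1, - f v:] * ?P) k = coeff ?P k - f v * coeff ?P j"
      by (simp add: Suc)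
    also have "norm \<dots> \<le> norm (coeff ?P k) + norm (f v) * norm (coeff ?P j)"
      using norm_triangle_ineq4 [of "coeff ?P k" "f v * coeff ?P j"] by (simp only: norm_mult)
    also have "\<dots> \<le> 2 ^ card U * B ^ k + B * (2 ^ card U * B ^ j)"
      by (intro add_mono mult_mono IH) (use insert assms(2) in auto)
    also have "\<dots> = 2 * (2 ^ card U * B ^ k)" by (simp add: Suc)
    finally show ?thesis .
  qed
  then show ?case using insert by simp
qed

section \<open>Elimination by symmetric functions of independent tuples of roots\<close>

text \<open>
A tuple selects one root in each of the coordinates \<open>v < r\<close>; \<open>d v\<close> is the number of roots available
there.
\<close>

definition tuples :: "nat \<Rightarrow> (nat \<Rightarrow> nat) \<Rightarrow> (nat \<Rightarrow> nat) set" where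
  "tuples r d = PiE {..<r} (\<lambda>v. {..<d v})"

text \<open>
The sums over all tuples of \<open>h\<close> times an arbitrary monomial in the selected roots \<open>a v (u v)\<close>.
\<close>

definition moments_polyfun ::
    "('a \<Rightarrow> complex) \<Rightarrow> nat \<Rightarrow> (nat \<Rightarrow> nat) \<Rightarrow> (nat \<Rightarrow> nat \<Rightarrow> 'a \<Rightarrow> complex)
      \<Rightarrow> ('a \<Rightarrow> (nat \<Rightarrow> nat) \<Rightarrow> complex) \<Rightarrow> bool" where
  "moments_polyfun \<iota> r d a h \<longleftrightarrow>
     (\<forall>e. polyfun \<iota> (\<lambda>\<tau>. \<Sum>u\<in>tuples r d. h \<tau> u * (\<Prod>v<r. a v (u v) \<tau> ^ e v)))"

text \<open>
An expression qualifies if multiplication by it preserves the functions with polynomial moments.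
Unlike a normal form as a sum of monomials, this is closed under products for trivial reasons, and it
contains every polynomial in the coordinates and the parameter.
\<close>

definition tuple_poly ::
    "('a \<Rightarrow> complex) \<Rightarrow> nat \<Rightarrow> (nat \<Rightarrow> nat) \<Rightarrow> (nat \<Rightarrow> nat \<Rightarrow> 'a \<Rightarrow> complex)
      \<Rightarrow> ('a \<Rightarrow> (nat \<Rightarrow> nat) \<Rightarrow> complex) \<Rightarrow> bool" where
  "tuple_poly \<iota> r d a g \<longleftrightarrow>
     (\<forall>h. moments_polyfun \<iota> r d a h \<longrightarrow> moments_polyfun \<iota> r d a (\<lambda>\<tau> u. g \<tau> u * h \<tau> u))"

lemma finite_tuples [simp]: "finite (tuples r d)"
  unfolding tuples_def by (intro finite_PiE) auto

lemma card_tuples: "card (tuples r d) = (\<Prod>v<r. d v)"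
  unfolding tuples_def by (simp add: card_PiE)

lemma tuples_less: "u \<in> tuples r d \<Longrightarrow> v < r \<Longrightarrow> u v < d v"
  unfolding tuples_def by (auto simp: PiE_def Pi_def)

lemma tuple_poly_param: "polyfun \<iota> c \<Longrightarrow> tuple_poly \<iota> r d a (\<lambda>\<tau> _. c \<tau>)"
  unfolding tuple_poly_def moments_polyfun_def
  by (auto simp: mult.assoc sum_distrib_left [symmetric] intro!: polyfun_mult)

lemma tuple_poly_const: "tuple_poly \<iota> r d a (\<lambda>_ _. c)"
  by (intro tuple_poly_param polyfun_const)

lemma tuple_poly_add:
  "tuple_poly \<iota> r d a g \<Longrightarrow> tuple_poly \<iota> r d a g' \<Longrightarrow> tuple_poly \<iota> r d a (\<lambda>\<tau> u. g \<tau> u + g' \<tau> u)"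
  unfolding tuple_poly_def moments_polyfun_def
  by (simp add: distrib_right sum.distrib polyfun_add)

lemma tuple_poly_mult:
  "tuple_poly \<iota> r d a g \<Longrightarrow> tuple_poly \<iota> r d a g' \<Longrightarrow> tuple_poly \<iota> r d a (\<lambda>\<tau> u. g \<tau> u * g' \<tau> u)"
  unfolding tuple_poly_def by (simp add: mult.assoc)

lemma tuple_poly_diff:
  assumes "tuple_poly \<iota> r d a g" "tuple_poly \<iota> r d a g'"
  shows "tuple_poly \<iota> r d a (\<lambda>\<tau> u. g \<tau> u - g' \<tau> u)"
  using tuple_poly_add [OF assms(1) tuple_poly_mult [OF tuple_poly_const [of _ _ _ _ "-1"] assms(2)]]
  by simp

lemma tuple_poly_power: "tuple_poly \<iota> r d a g \<Longrightarrow> tuple_poly \<iota> r d a (\<lambda>\<tau> u. g \<tau> u ^ k)"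
  by (induction k) (simp_all add: tuple_poly_const tuple_poly_mult)

lemma tuple_poly_sum:
  "(\<And>i. i \<in> A \<Longrightarrow> tuple_poly \<iota> r d a (g i)) \<Longrightarrow> tuple_poly \<iota> r d a (\<lambda>\<tau> u. \<Sum>i\<in>A. g i \<tau> u)"
  by (induction A rule: infinite_finite_induct) (simp_all add: tuple_poly_const tuple_poly_add)

text \<open>
Multiplying by a coordinate raises one exponent of the monomial.
\<close>

lemma tuple_poly_coord:
  assumes "w < r"
  shows "tuple_poly \<iota> r d a (\<lambda>\<tau> u. a w (u w) \<tau>)"
  unfolding tuple_poly_def
proof (intro allI impI)
  fix h assume h: "moments_polyfun \<iota> r d a h"
  have "a w (u w) \<tau> * h \<tau> u * (\<Prod>v<r. a v (u v) \<tau> ^ e v) =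
      h \<tau> u * (\<Prod>v<r. a v (u v) \<tau> ^ (e(w := Suc (e w))) v)" for \<tau> u e
  proof -
    have "(\<Prod>v<r. a v (u v) \<tau> ^ (e(w := Suc (e w))) v) =
        a w (u w) \<tau> ^ Suc (e w) * (\<Prod>v\<in>{..<r} - {w}. a v (u v) \<tau> ^ (e(w := Suc (e w))) v)"
      using assms by (subst prod.remove [of _ w]) auto
    also have "\<dots> = a w (u w) \<tau> * (a w (u w) \<tau> ^ e w * (\<Prod>v\<in>{..<r} - {w}. a v (u v) \<tau> ^ e v))"
      by (simp add: mult.assoc)
    also have "\<dots> = a w (u w) \<tau> * (\<Prod>v<r. a v (u v) \<tau> ^ e v)"
      using assms by (subst (2) prod.remove [of _ w]) auto
    finally show ?thesis by simp
  qed
  then show "moments_polyfun \<iota> r d a (\<lambda>\<tau> u. a w (u w) \<tau> * h \<tau> u)"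
    using h unfolding moments_polyfun_def by (simp only:) blast
qed

text \<open>
The constant function \<open>1\<close> has polynomial moments, because the sum of a monomial over all tuples is
the product of the power sums of the coordinates.
\<close>

lemma polyfun_tuple_sum:
  assumes S: "\<And>v l. v < r \<Longrightarrow> polyfun \<iota> (\<lambda>\<tau>. \<Sum>i<d v. a v i \<tau> ^ l)"
    and g: "tuple_poly \<iota> r d a g"
  shows "polyfun \<iota> (\<lambda>\<tau>. \<Sum>u\<in>tuples r d. g \<tau> u)"
proof -
  have "moments_polyfun \<iota> r d a (\<lambda>_ _. 1)"
    unfolding moments_polyfun_def
  proof
    fix e
    have "(\<Sum>u\<in>tuples r d. 1 * (\<Prod>v<r. a v (u v) \<tau> ^ e v)) = (\<Prod>v<r. \<Sum>i<d v. a v i \<tau> ^ e v)" for \<tau>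
      unfolding tuples_def by (simp add: prod_sum_PiE)
    then show "polyfun \<iota> (\<lambda>\<tau>. \<Sum>u\<in>tuples r d. 1 * (\<Prod>v<r. a v (u v) \<tau> ^ e v))"
      by (auto intro!: S)
  qed
  with g have "moments_polyfun \<iota> r d a (\<lambda>\<tau> u. g \<tau> u * 1)"
    unfolding tuple_poly_def by blast
  then show ?thesis
    unfolding moments_polyfun_def by (drule_tac spec [of _ "\<lambda>_. 0"]) simp
qed

lemma polyfun_tuple_esymm:
  assumes "\<And>v l. v < r \<Longrightarrow> polyfun \<iota> (\<lambda>\<tau>. \<Sum>i<d v. a v i \<tau> ^ l)" and "tuple_poly \<iota> r d a g"
  shows "polyfun \<iota> (\<lambda>\<tau>. coeff (\<Prod>u\<in>tuples r d. [:1, - g \<tau> u:]) k)"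
proof (rule polyfun_esymm_of_power_sums [where f = "\<lambda>u \<tau>. g \<tau> u"])
  show "polyfun \<iota> (\<lambda>\<tau>. \<Sum>u\<in>tuples r d. g \<tau> u ^ l)" for l
    by (rule polyfun_tuple_sum [OF _ tuple_poly_power [OF assms(2)]]) (rule assms(1))
qed simp

text \<open>
If the values are \<open>O (\<tau> powr (s / q))\<close>, their \<open>k\<close>-th elementary symmetric function is
\<open>O (\<tau> powr (s * k / q))\<close>.
\<close>

lemma esymm_degree_le:
  fixes g :: "real \<Rightarrow> 'u \<Rightarrow> complex"
  assumes U: "finite U"
    and p: "\<And>\<tau>::real. coeff (\<Prod>u\<in>U. [:1, - g \<tau> u:]) k = poly p (of_real \<tau>)"
    and growth: "\<And>\<tau>. \<tau> \<ge> 0 \<Longrightarrow> \<exists>B\<ge>0. B ^ q \<le> C * (1 + \<tau>) ^ s \<and> (\<forall>u\<in>U. norm (g \<tau> u) \<le> B)"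
  shows "degree p * q \<le> s * k"
proof (rule degree_le_of_growth)
  fix \<tau> :: real assume "\<tau> \<ge> 0"
  then obtain B where B: "B \<ge> 0" "B ^ q \<le> C * (1 + \<tau>) ^ s" "\<And>u. u \<in> U \<Longrightarrow> norm (g \<tau> u) \<le> B"
    using growth by blast
  have "norm (poly p (of_real \<tau>)) \<le> 2 ^ card U * B ^ k"
    using norm_esymm_le [OF U B(1), of "g \<tau>" k] B(3) p by simp
  then have "norm (poly p (of_real \<tau>)) ^ q \<le> (2 ^ card U * B ^ k) ^ q"
    by (intro power_mono) auto
  also have "\<dots> = 2 ^ (card U * q) * (B ^ q) ^ k"
    by (simp add: power_mult_distrib power_mult [symmetric] mult.commute)
  also have "\<dots> \<le> 2 ^ (card U * q) * (C * (1 + \<tau>) ^ s) ^ k"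
    using B by (intro mult_left_mono power_mono) auto
  also have "\<dots> = 2 ^ (card U * q) * C ^ k * (1 + \<tau>) ^ (s * k)"
    by (simp add: power_mult_distrib power_mult [symmetric])
  finally show "norm (poly p (of_real \<tau>)) ^ q \<le> 2 ^ (card U * q) * C ^ k * (1 + \<tau>) ^ (s * k)" .
qed

text \<open>
The degree of the generating function counts the nonzero values; this is how vanishing of
individual values is seen by the elementary symmetric functions.
\<close>

lemma degree_prod_reciprocal_linear:
  fixes f :: "'u \<Rightarrow> complex"
  assumes "finite U"
  shows "degree (\<Prod>u\<in>U. [:1, - f u:]) = card {u \<in> U. f u \<noteq> 0}"
  using assms
proof (induction U rule: finite_induct)
  case empty
  then show ?case by simp
next
  case (insert v U)
  have nz: "(\<Prod>u\<in>U. [:1, - f u:]) \<noteq> 0" using insert by (subst prod_zero_iff) auto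
  have "degree (\<Prod>u\<in>insert v U. [:1, - f u:]) = degree ([:1, - f v:] * (\<Prod>u\<in>U. [:1, - f u:]))"
    using insert by simp
  also have "\<dots> = degree [:1, - f v:] + degree (\<Prod>u\<in>U. [:1, - f u:])"
    by (rule degree_mult_eq [OF _ nz]) simp
  finally have 1: "degree (\<Prod>u\<in>insert v U. [:1, - f u:]) = degree [:1, - f v:] + card {u \<in> U. f u \<noteq> 0}"
    unfolding insert.IH .
  have 2: "{u \<in> insert v U. f u \<noteq> 0} =
      (if f v = 0 then {u \<in> U. f u \<noteq> 0} else insert v {u \<in> U. f u \<noteq> 0})"
    by auto
  show ?case unfolding 1 2 using insert by auto
qed

lemma card_real_roots_le:
  fixes p :: "complex poly"
  assumes "p \<noteq> 0"
  shows "finite {\<tau>::real. poly p (of_real \<tau>) = 0}"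
    and "card {\<tau>::real. poly p (of_real \<tau>) = 0} \<le> degree p"
proof -
  have inj: "inj_on (of_real :: real \<Rightarrow> complex) A" for A by (simp add: inj_on_def)
  have sub: "of_real ` {\<tau>::real. poly p (of_real \<tau>) = 0} \<subseteq> {z. poly p z = 0}" by auto
  have fin: "finite {z. poly p z = 0}" using assms by (rule poly_roots_finite)
  show "finite {\<tau>::real. poly p (of_real \<tau>) = 0}"
    using finite_subset [OF sub fin] finite_imageD [OF _ inj] by blast
  have "card {\<tau>::real. poly p (of_real \<tau>) = 0} \<le> card {z. poly p z = 0}"
    using card_mono [OF fin sub] card_image [OF inj] by metis
  then show "card {\<tau>::real. poly p (of_real \<tau>) = 0} \<le> degree p"
    using card_poly_roots_bound [OF assms] by linarith
qed

text \<open>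
Let \<open>k\<close> be the largest number of nonzero values attained on \<open>T\<close>. The \<open>k\<close>-th elementary symmetric
function is then a nonzero polynomial, and wherever it does not vanish at least \<open>k\<close> values are
nonzero. Values that vanish identically do no harm, since \<open>k\<close> adapts to them.
\<close>

lemma fewest_zeros_off_few_times:
  fixes f :: "real \<Rightarrow> 'u \<Rightarrow> complex" and T :: "real set"
  assumes U: "finite U" and "T \<noteq> {}"
    and p: "\<And>k \<tau>. coeff (\<Prod>u\<in>U. [:1, - f \<tau> u:]) k = poly (p k) (of_real \<tau>)"
    and D: "\<And>k. k \<le> card U \<Longrightarrow> degree (p k) \<le> D"
  obtains E where "E \<subseteq> T" "finite E" "card E \<le> D"
    "\<And>\<tau> \<sigma>. \<tau> \<in> T - E \<Longrightarrow> \<sigma> \<in> T \<Longrightarrow> card {u \<in> U. f \<tau> u = 0} \<le> card {u \<in> U. f \<sigma> u = 0}"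
proof -
  let ?N = "\<lambda>\<tau>. card {u \<in> U. f \<tau> u \<noteq> 0}"
  have le: "?N \<tau> \<le> card U" for \<tau> using U by (intro card_mono) auto
  obtain \<sigma>0 where \<sigma>0: "\<sigma>0 \<in> T" "\<And>\<sigma>. \<sigma> \<in> T \<Longrightarrow> ?N \<sigma> \<le> ?N \<sigma>0"
  proof -
    obtain \<sigma>1 where "\<sigma>1 \<in> T" using \<open>T \<noteq> {}\<close> by blast
    moreover have "\<forall>\<sigma>. \<sigma> \<in> T \<longrightarrow> ?N \<sigma> < Suc (card U)" using le by (simp add: less_Suc_eq_le)
    ultimately have "\<exists>\<sigma>0. \<sigma>0 \<in> T \<and> (\<forall>\<sigma>. \<sigma> \<in> T \<longrightarrow> ?N \<sigma> \<le> ?N \<sigma>0)"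
      by (rule ex_has_greatest_nat)
    then show ?thesis using that by blast
  qed
  define k where "k = ?N \<sigma>0"
  have nz: "(\<Prod>u\<in>U. [:1, - f \<tau> u:]) \<noteq> 0" for \<tau> using U by (subst prod_zero_iff) auto
  have "poly (p k) (of_real \<sigma>0) = lead_coeff (\<Prod>u\<in>U. [:1, - f \<sigma>0 u:])"
    unfolding p [symmetric] degree_prod_reciprocal_linear [OF U] k_def ..
  then have "poly (p k) (of_real \<sigma>0) \<noteq> 0" using nz [of \<sigma>0] by simp
  then have pk: "p k \<noteq> 0" by auto
  define E where "E = T \<inter> {\<tau>. poly (p k) (of_real \<tau>) = 0}"
  have "card E \<le> card {\<tau>::real. poly (p k) (of_real \<tau>) = 0}"
    unfolding E_def by (intro card_mono card_real_roots_le pk) auto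
  then have "card E \<le> D"
    using card_real_roots_le(2) [OF pk] D [of k] le unfolding k_def by fastforce
  moreover have "card {u \<in> U. f \<tau> u = 0} \<le> card {u \<in> U. f \<sigma> u = 0}"
    if "\<tau> \<in> T - E" "\<sigma> \<in> T" for \<tau> \<sigma>
  proof -
    have comp: "card {u \<in> U. f \<tau> u = 0} = card U - ?N \<tau>" for \<tau>
    proof -
      have "{u \<in> U. f \<tau> u = 0} = U - {u \<in> U. f \<tau> u \<noteq> 0}" by auto
      then show ?thesis using U by (simp add: card_Diff_subset)
    qed
    have "coeff (\<Prod>u\<in>U. [:1, - f \<tau> u:]) k \<noteq> 0"
      using that unfolding p E_def by simp
    then have "k \<le> ?N \<tau>"
      unfolding degree_prod_reciprocal_linear [OF U, symmetric] by (rule le_degree)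
    then have "?N \<sigma> \<le> ?N \<tau>" using \<sigma>0(2) [OF that(2)] k_def by linarith
    then show ?thesis unfolding comp by simp
  qed
  moreover have "finite E" unfolding E_def by (intro finite_Int disjI2 card_real_roots_le pk)
  moreover have "E \<subseteq> T" unfolding E_def by blast
  ultimately show ?thesis using that by blast
qed

section \<open>Growth on the polar curve\<close>

definition slice :: "complex poly poly \<Rightarrow> complex \<Rightarrow> complex poly" where
  "slice H x = map_poly (\<lambda>p. poly p x) H"

lemma coeff_slice [simp]: "coeff (slice H x) j = poly (coeff H j) x"
  by (simp add: slice_def coeff_map_poly)

lemma eval2_slice: "eval2 H (x, y) = poly (slice H x) y"
  unfolding eval2_def
proof (induction H)
  case 0
  then show ?case by (simp add: slice_def)
next
  case (pCons a H)
  have "slice (pCons a H) x = pCons (poly a x) (slice H x)"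
    by (intro poly_eqI) (simp add: coeff_pCons split: nat.splits)
  then show ?case using pCons by (simp add: mult.commute)
qed

lemma slice_deriv_y: "slice (deriv_y H) x = pderiv (slice H x)"
  by (intro poly_eqI) (simp add: deriv_y_def coeff_pderiv)

lemma coeff_eq_0_of_total_degree:
  assumes "total_degree H < i + j"
  shows "coeff (coeff H j) i = 0"
proof (rule ccontr)
  assume nz: "coeff (coeff H j) i \<noteq> 0"
  let ?S = "{i + j | i j. coeff (coeff H j) i \<noteq> 0}"
  have "?S \<subseteq> (\<lambda>(j, i). i + j) ` (SIGMA j:{..degree H}. {..degree (coeff H j)})"
  proof
    fix m assume "m \<in> ?S"
    then obtain i j where ij: "m = i + j" "coeff (coeff H j) i \<noteq> 0" by blast
    then have "i \<le> degree (coeff H j)" "j \<le> degree H" by (auto intro!: le_degree)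
    then show "m \<in> (\<lambda>(j, i). i + j) ` (SIGMA j:{..degree H}. {..degree (coeff H j)})"
      using ij by force
  qed
  then have "finite ?S" by (rule finite_subset) auto
  then have "i + j \<le> Max ?S" using nz by (intro Max_ge) auto
  moreover have "H \<noteq> 0" using nz by auto
  ultimately show False using assms by (simp add: total_degree_def)
qed

text \<open>
  Cauchy's bound, in the form that respects weights: if the coefficient of \<open>y ^ k\<close> has size
  \<open>M ^ (e - k)\<close>, then the roots have size \<open>M\<close>.
\<close>

lemma root_bound:
  fixes p :: "complex poly" and K M :: real
  assumes coeffs: "\<And>k. k < degree p \<Longrightarrow> norm (coeff p k) \<le> K * M ^ (degree p - k)"
    and "K \<ge> 0" "M > 0" "p \<noteq> 0" "poly p y = 0"
  shows "norm y \<le> (1 + degree p * K / norm (lead_coeff p)) * M"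
proof (rule ccontr)
  let ?e = "degree p" and ?c = "norm (lead_coeff p)"
  assume "\<not> ?thesis"
  then have big: "norm y > M + ?e * K / ?c * M" by (simp add: algebra_simps)
  have c: "?c > 0" using \<open>p \<noteq> 0\<close> by simp
  have "?e * K / ?c * M \<ge> 0" using assms c by simp
  then have yM: "norm y \<ge> M" using big by linarith
  have e: "?e > 0" using assms(4,5) by (metis degree_eq_zeroE gr0I poly_const_conv poly_0 pCons_0_0 )
  have "(\<Sum>k<?e. coeff p k * y ^ k) + lead_coeff p * y ^ ?e = 0"
    using \<open>poly p y = 0\<close> unfolding poly_altdef by (simp add: lessThan_Suc_atMost [symmetric])
  then have "lead_coeff p * y ^ ?e = - (\<Sum>k<?e. coeff p k * y ^ k)"
    by (simp add: eq_neg_iff_add_eq_0 add.commute)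
  then have "norm (lead_coeff p * y ^ ?e) = norm (\<Sum>k<?e. coeff p k * y ^ k)"
    by (simp only: norm_minus_cancel)
  then have "?c * norm y ^ ?e = norm (\<Sum>k<?e. coeff p k * y ^ k)"
    by (simp add: norm_mult norm_power)
  also have "\<dots> \<le> (\<Sum>k<?e. K * M * norm y ^ (?e - 1))"
  proof (rule sum_norm_le)
    fix k assume "k \<in> {..<?e}"
    then have k: "k < ?e" by simp
    then obtain l where l: "?e = Suc (k + l)" by (metis less_iff_Suc_add)
    have "norm (coeff p k * y ^ k) \<le> K * M ^ (?e - k) * norm y ^ k"
      unfolding norm_mult norm_power by (intro mult_right_mono coeffs k) auto
    also have "\<dots> = K * M * norm y ^ k * M ^ l" by (simp add: l)
    also have "\<dots> \<le> K * M * norm y ^ k * norm y ^ l"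
      using assms yM by (intro mult_left_mono power_mono) auto
    finally show "norm (coeff p k * y ^ k) \<le> K * M * norm y ^ (?e - 1)"
      by (simp add: l power_add mult.assoc)
  qed
  also have "\<dots> = ?e * K * M * norm y ^ (?e - 1)" by simp
  finally have "?c * norm y * norm y ^ (?e - 1) \<le> ?e * K * M * norm y ^ (?e - 1)"
    using e by (cases ?e) (auto simp: mult_ac)
  moreover have "norm y ^ (?e - 1) > 0"
    using less_le_trans [OF \<open>M > 0\<close> yM] by (rule zero_less_power)
  ultimately have "?c * norm y \<le> ?e * K * M" using mult_le_cancel_right_pos by blast
  then have "norm y \<le> ?e * K / ?c * M" using c by (simp add: field_simps)
  then show False using big \<open>M > 0\<close> by linarith
qed

subsection \<open>Simple zero lines\<close>

text \<open>\<open>homogenize d p\<close> is the form \<open>x ^ d * p (y / x)\<close>.\<close>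

definition homogenize :: "nat \<Rightarrow> complex poly \<Rightarrow> complex poly poly" where
  "homogenize d p = (\<Sum>j\<le>d. monom (monom (coeff p j) (d - j)) j)"

lemma coeff_homogenize:
  "coeff (homogenize d p) j = (if j \<le> d then monom (coeff p j) (d - j) else 0)"
proof -
  have "coeff (homogenize d p) j = (\<Sum>i\<le>d. if j = i then monom (coeff p i) (d - i) else 0)"
    unfolding homogenize_def coeff_sum by (intro sum.cong) auto
  then show ?thesis by (simp add: sum.delta')
qed

text \<open>
A root of the dehomogenized form splits off a linear factor of the form itself; applied twice, a
double root gives a multiple zero line.
\<close>

lemma homogenize_linear_factor:
  assumes "degree p \<le> d"
  shows "homogenize (Suc d) ([:- w, 1:] * p) = linear_form (- w) 1 * homogenize d p"
proof (intro poly_eqI)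
  have shift: "[:0, u:] * monom b k = monom (u * b) (Suc k)" for u b :: complex and k
    by (intro poly_eqI) (auto simp: coeff_pCons coeff_monom split: nat.splits)
  fix j k
  have rhs: "coeff (linear_form (- w) 1 * homogenize d p) j =
      [:0, - w:] * coeff (homogenize d p) j + (if j = 0 then 0 else coeff (homogenize d p) (j - 1))"
    unfolding linear_form_def by (cases j) (simp_all add: coeff_pCons)
  show "coeff (coeff (homogenize (Suc d) ([:- w, 1:] * p)) j) k =
      coeff (coeff (linear_form (- w) 1 * homogenize d p) j) k"
  proof (cases j)
    case 0
    then show ?thesis
      unfolding rhs unfolding 0
      by (auto simp: coeff_homogenize shift coeff_mult simp del: mult_pCons_left)
  next
    case (Suc i)
    have "coeff p (Suc d) = 0" using assms by (intro coeff_eq_0) auto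
    then show ?thesis unfolding rhs unfolding Suc
      by (cases "i < d"; cases "i = d")
        (auto simp: coeff_homogenize shift Suc_diff_le add_monom diff_monom algebra_simps simp del: mult_pCons_left)
  qed
qed

lemma eval2_homogenize:
  "eval2 (homogenize d p) (x, y) = (\<Sum>j\<le>d. coeff p j * x ^ (d - j) * y ^ j)"
  unfolding eval2_def homogenize_def
  by (simp add: poly_sum poly_monom monom_altdef [of "_ :: complex" for p] mult_ac)

lemma poly_eq_sum_le:
  fixes p :: "complex poly"
  assumes "degree p \<le> d"
  shows "poly p y = (\<Sum>j\<le>d. coeff p j * y ^ j)"
  using poly_as_sum_of_monoms' [OF assms] by (metis (no_types, lifting) poly_sum poly_monom sum.cong)

lemma poly_pderiv_eq_sum_le:
  fixes p :: "complex poly"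
  assumes "degree p \<le> d"
  shows "poly (pderiv p) y = (\<Sum>j\<le>d. of_nat j * coeff p j * y ^ (j - 1))"
proof -
  have "pderiv p = pderiv (\<Sum>j\<le>d. monom (coeff p j) j)"
    using poly_as_sum_of_monoms' [OF assms] by simp
  also have "\<dots> = (\<Sum>j\<le>d. pderiv (monom (coeff p j) j))"
    using higher_pderiv_sum [of 1] by simp
  finally show ?thesis by (simp add: pderiv_monom poly_sum poly_monom)
qed

text \<open>
What is used of an ultra-Morse polynomial satisfying the transversality condition: its highest part
has simple zero lines, none of which is the \<open>y\<close>-axis.
\<close>

locale transversal_simple_top =
  fixes H :: "complex poly poly" and n :: nat
  assumes n: "n \<ge> 1"
    and deg: "total_degree H = Suc n"
    and simple: "simple_zero_lines (highest_part H)"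
    and transv: "\<And>v. v \<noteq> 0 \<Longrightarrow> eval2 (highest_part H) v = 0 \<Longrightarrow> fst v \<noteq> 0"
begin

text \<open>
The highest part of \<open>H\<close> at \<open>(1, y)\<close>, as a polynomial in \<open>y\<close>.
\<close>

definition top_dehom :: "complex poly" where
  "top_dehom = (\<Sum>j\<le>Suc n. monom (coeff (coeff H j) (Suc n - j)) j)"

lemma coeff_top_dehom: "coeff top_dehom j = (if j \<le> Suc n then coeff (coeff H j) (Suc n - j) else 0)"
proof -
  have "coeff top_dehom j = (\<Sum>i\<le>Suc n. if j = i then coeff (coeff H i) (Suc n - i) else 0)"
    unfolding top_dehom_def coeff_sum by (intro sum.cong) auto
  then show ?thesis by (simp add: sum.delta')
qed

lemma degree_top_dehom_le: "degree top_dehom \<le> Suc n"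
  by (rule degree_le) (simp add: coeff_top_dehom)

lemma highest_part_eq: "highest_part H = homogenize (Suc n) top_dehom"
  unfolding highest_part_def homogenize_def Let_def deg
  by (intro sum.cong) (auto simp: coeff_top_dehom)

definition lead :: complex where "lead = coeff (coeff H (Suc n)) 0"

text \<open>
Otherwise the highest part would vanish on the \<open>y\<close>-axis.
\<close>

lemma lead_nonzero: "lead \<noteq> 0"
proof
  assume "lead = 0"
  have "eval2 (highest_part H) (0, 1) = (\<Sum>j\<le>Suc n. coeff top_dehom j * 0 ^ (Suc n - j))"
    unfolding highest_part_eq eval2_homogenize by simp
  also have "\<dots> = lead + (\<Sum>j\<le>n. coeff top_dehom j * 0 ^ (Suc n - j))"
    by (simp add: coeff_top_dehom lead_def)
  also have "(\<Sum>j\<le>n. coeff top_dehom j * 0 ^ (Suc n - j)) = 0"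
    by (intro sum.neutral) auto
  finally show False
    using transv [of "(0, 1)"] \<open>lead = 0\<close> by (simp add: zero_prod_def)
qed

lemma coeff_coeff_eq_0: "Suc n < i + j \<Longrightarrow> coeff (coeff H j) i = 0"
  by (rule coeff_eq_0_of_total_degree) (simp add: deg)

lemma degree_coeff_le: "degree (coeff H j) \<le> Suc n - j"
  by (rule degree_le) (auto intro: coeff_coeff_eq_0)

lemma coeff_lead: "coeff H (Suc n) = [:lead:]"
  using degree_coeff_le [of "Suc n"] by (auto simp: lead_def elim: degree_eq_zeroE)

lemma degree_slice: "degree (slice H x) = Suc n"
proof (rule antisym)
  show "degree (slice H x) \<le> Suc n"
  proof (rule degree_le, intro allI impI)
    fix j assume "Suc n < j"
    then have "coeff H j = 0" by (intro poly_eqI) (simp add: coeff_coeff_eq_0)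
    then show "coeff (slice H x) j = 0" by simp
  qed
  show "Suc n \<le> degree (slice H x)"
    by (rule le_degree) (simp add: coeff_lead lead_nonzero)
qed

lemma degree_slice_deriv_y: "degree (slice (deriv_y H) x) = n"
  by (simp add: slice_deriv_y degree_pderiv degree_slice)

lemma coeff_slice_deriv_y: "coeff (slice (deriv_y H) x) n = of_nat (Suc n) * lead"
  by (simp add: slice_deriv_y coeff_pderiv coeff_lead)

lemma eval2_eq_sum: "eval2 H (x, y) = (\<Sum>j\<le>Suc n. poly (coeff H j) x * y ^ j)"
  unfolding eval2_slice by (subst poly_eq_sum_le [of _ "Suc n"]) (simp_all add: degree_slice)

lemma eval2_deriv_y_eq_sum:
  "eval2 (deriv_y H) (x, y) = (\<Sum>j\<le>Suc n. of_nat j * poly (coeff H j) x * y ^ (j - 1))"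
  unfolding eval2_slice slice_deriv_y
  by (subst poly_pderiv_eq_sum_le [of _ "Suc n"]) (simp_all add: degree_slice)

definition coeff_norm_sum :: real where
  "coeff_norm_sum = (\<Sum>j\<le>Suc n. \<Sum>i\<le>Suc n - j. norm (coeff (coeff H j) i))"

lemma coeff_norm_sum_nonneg: "coeff_norm_sum \<ge> 0"
  unfolding coeff_norm_sum_def by (intro sum_nonneg) auto

lemma partial_coeff_norm_sum_le: "j \<le> Suc n \<Longrightarrow> (\<Sum>i\<le>Suc n - j. norm (coeff (coeff H j) i)) \<le> coeff_norm_sum"
  unfolding coeff_norm_sum_def
  by (rule member_le_sum [of j _ "\<lambda>j. \<Sum>i\<le>Suc n - j. norm (coeff (coeff H j) i)"])
     (auto intro: sum_nonneg)

lemma norm_coeff_le: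
  assumes "j \<le> Suc n"
  shows "norm (poly (coeff H j) x) \<le> coeff_norm_sum * (1 + norm x) ^ (Suc n - j)"
proof -
  have "poly (coeff H j) x = (\<Sum>i\<le>Suc n - j. coeff (coeff H j) i * x ^ i)"
    by (rule poly_eq_sum_le [OF degree_coeff_le])
  also have "norm \<dots> \<le> (\<Sum>i\<le>Suc n - j. norm (coeff (coeff H j) i) * (1 + norm x) ^ (Suc n - j))"
  proof (rule sum_norm_le)
    fix i assume i: "i \<in> {..Suc n - j}"
    have "norm x ^ i \<le> (1 + norm x) ^ i" by (intro power_mono) auto
    also have "\<dots> \<le> (1 + norm x) ^ (Suc n - j)" using i by (intro power_increasing) auto
    finally show "norm (coeff (coeff H j) i * x ^ i) \<le> norm (coeff (coeff H j) i) * (1 + norm x) ^ (Suc n - j)"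
      by (simp add: norm_mult norm_power mult_left_mono)
  qed
  also have "\<dots> = (\<Sum>i\<le>Suc n - j. norm (coeff (coeff H j) i)) * (1 + norm x) ^ (Suc n - j)"
    by (simp add: sum_distrib_right)
  also have "\<dots> \<le> coeff_norm_sum * (1 + norm x) ^ (Suc n - j)"
    by (intro mult_right_mono partial_coeff_norm_sum_le assms) auto
  finally show ?thesis .
qed

text \<open>
The weights of the coefficients match those of \<open>root_bound\<close> with \<open>M = 1 + norm x\<close>, because the total
degree of \<open>H\<close> is its degree in \<open>y\<close>.
\<close>

lemma norm_level_root_le:
  assumes "eval2 H (x, y) = t"
  shows "norm y \<le> (1 + Suc n * (coeff_norm_sum + norm t) / norm lead) * (1 + norm x)"
proof -
  let ?p = "slice H x - [:t:]"
  have deg_p: "degree ?p = Suc n"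
    by (subst diff_conv_add_uminus, subst degree_add_eq_left) (simp_all add: degree_slice)
  have lead_p: "coeff ?p (Suc n) = lead" by (simp add: coeff_lead coeff_pCons)
  have "norm y \<le> (1 + degree ?p * (coeff_norm_sum + norm t) / norm (lead_coeff ?p)) * (1 + norm x)"
  proof (rule root_bound)
    fix k assume "k < degree ?p"
    then have k: "k \<le> n" using deg_p by simp
    have "norm (coeff ?p k) \<le> norm (poly (coeff H k) x) + norm (coeff [:t:] k)"
      by (metis coeff_diff coeff_slice norm_triangle_ineq4)
    also have "\<dots> \<le> coeff_norm_sum * (1 + norm x) ^ (Suc n - k) + norm t * (1 + norm x) ^ (Suc n - k)"
    proof (intro add_mono norm_coeff_le)
      have "norm (coeff [:t:] k) \<le> norm t * 1" by (cases k) simp_all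
      also have "\<dots> \<le> norm t * (1 + norm x) ^ (Suc n - k)"
        by (intro mult_left_mono one_le_power) auto
      finally show "norm (coeff [:t:] k) \<le> norm t * (1 + norm x) ^ (Suc n - k)" .
    qed (use k in auto)
    finally show "norm (coeff ?p k) \<le> (coeff_norm_sum + norm t) * (1 + norm x) ^ (degree ?p - k)"
      by (simp only: deg_p distrib_right)
  next
    show "1 + norm x > 0" by (smt (verit) norm_ge_zero)
    show "?p \<noteq> 0" using deg_p by auto
    show "poly ?p y = 0" using assms by (simp add: eval2_slice)
  qed (simp add: coeff_norm_sum_nonneg)
  then show ?thesis unfolding deg_p lead_p .
qed

lemma norm_polar_root_le:
  assumes "eval2 (deriv_y H) (x, y) = 0"
  shows "norm y \<le> (1 + n * (Suc n * coeff_norm_sum) / norm (of_nat (Suc n) * lead)) * (1 + norm x)"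
proof -
  let ?p = "slice (deriv_y H) x"
  have "norm y \<le> (1 + degree ?p * (Suc n * coeff_norm_sum) / norm (lead_coeff ?p)) * (1 + norm x)"
  proof (rule root_bound)
    fix k assume "k < degree ?p"
    then have k: "Suc k \<le> Suc n" "k < n" by (auto simp: degree_slice_deriv_y)
    have "norm (coeff ?p k) = real (Suc k) * norm (poly (coeff H (Suc k)) x)"
      by (simp add: slice_deriv_y coeff_pderiv norm_mult del: of_nat_Suc)
    also have "\<dots> \<le> real (Suc n) * (coeff_norm_sum * (1 + norm x) ^ (Suc n - Suc k))"
      using k by (intro mult_mono norm_coeff_le) auto
    finally show "norm (coeff ?p k) \<le> Suc n * coeff_norm_sum * (1 + norm x) ^ (degree ?p - k)"
      unfolding degree_slice_deriv_y by (simp only: diff_Suc_Suc mult.assoc)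
  next
    show "1 + norm x > 0" by (smt (verit) norm_ge_zero)
    show "?p \<noteq> 0" using degree_slice_deriv_y [of x] n by auto
    show "poly ?p y = 0" using assms by (simp add: eval2_slice)
  qed (simp add: coeff_norm_sum_nonneg)
  then show ?thesis unfolding degree_slice_deriv_y coeff_slice_deriv_y .
qed

lemma norm_eval2_le:
  assumes "norm y \<le> C * (1 + norm x)" "C \<ge> 1"
  shows "norm (eval2 H (x, y)) \<le> (Suc (Suc n) * coeff_norm_sum * C ^ Suc n) * (1 + norm x) ^ Suc n"
proof -
  have "norm (eval2 H (x, y)) \<le> (\<Sum>j\<le>Suc n. coeff_norm_sum * C ^ Suc n * (1 + norm x) ^ Suc n)"
    unfolding eval2_eq_sum
  proof (rule sum_norm_le)
    fix j assume "j \<in> {..Suc n}"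
    then have j: "j \<le> Suc n" by simp
    have "norm (poly (coeff H j) x * y ^ j) \<le>
        (coeff_norm_sum * (1 + norm x) ^ (Suc n - j)) * (C * (1 + norm x)) ^ j"
      unfolding norm_mult norm_power
      by (intro mult_mono norm_coeff_le power_mono j assms) (auto simp: coeff_norm_sum_nonneg)
    also have "\<dots> = coeff_norm_sum * C ^ j * (1 + norm x) ^ Suc n"
      using j by (simp add: power_mult_distrib mult_ac flip: power_add)
    also have "\<dots> \<le> coeff_norm_sum * C ^ Suc n * (1 + norm x) ^ Suc n"
      using j assms by (intro mult_mono power_increasing mult_nonneg_nonneg coeff_norm_sum_nonneg) auto
    finally show "norm (poly (coeff H j) x * y ^ j) \<le> coeff_norm_sum * C ^ Suc n * (1 + norm x) ^ Suc n" .
  qed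
  then show ?thesis by (simp add: mult_ac)
qed

text \<open>
A common zero of the highest part and of its \<open>y\<close>-derivative does not lie on the \<open>y\<close>-axis, so it is
a double root of the dehomogenized form and yields a multiple zero line.
\<close>

lemma simple_top:
  assumes "(x, y) \<noteq> (0, 0)" and h: "(\<Sum>j\<le>Suc n. coeff top_dehom j * x ^ (Suc n - j) * y ^ j) = 0"
    and hy: "(\<Sum>j\<le>Suc n. of_nat j * coeff top_dehom j * x ^ (Suc n - j) * y ^ (j - 1)) = 0"
  shows False
proof -
  have x: "x \<noteq> 0"
    using transv [of "(x, y)"] assms by (auto simp: highest_part_eq eval2_homogenize zero_prod_def)
  define w where "w = y / x"
  have "poly top_dehom w * x ^ Suc n = (\<Sum>j\<le>Suc n. coeff top_dehom j * x ^ (Suc n - j) * y ^ j)"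
    unfolding poly_eq_sum_le [OF degree_top_dehom_le] sum_distrib_right
  proof (intro sum.cong refl)
    fix j assume "j \<in> {..Suc n}"
    then have "x ^ Suc n = x ^ (Suc n - j) * x ^ j" by (simp flip: power_add)
    then show "coeff top_dehom j * w ^ j * x ^ Suc n = coeff top_dehom j * x ^ (Suc n - j) * y ^ j"
      using x by (simp add: w_def power_divide)
  qed
  then have root: "poly top_dehom w = 0" using h x by simp
  have "poly (pderiv top_dehom) w * x ^ n = (\<Sum>j\<le>Suc n. of_nat j * coeff top_dehom j * x ^ (Suc n - j) * y ^ (j - 1))"
    unfolding poly_pderiv_eq_sum_le [OF degree_top_dehom_le] sum_distrib_right
  proof (intro sum.cong refl)
    fix j assume j: "j \<in> {..Suc n}"
    show "of_nat j * coeff top_dehom j * w ^ (j - 1) * x ^ n =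
        of_nat j * coeff top_dehom j * x ^ (Suc n - j) * y ^ (j - 1)"
    proof (cases j)
      case (Suc i)
      then have "x ^ n = x ^ (Suc n - j) * x ^ i" using j by (simp flip: power_add)
      then show ?thesis using x Suc by (simp add: w_def power_divide)
    qed simp
  qed
  then have root': "poly (pderiv top_dehom) w = 0" using hy x by simp
  obtain p where p: "top_dehom = [:- w, 1:] * p" using root by (metis dvdE poly_eq_0_iff_dvd)
  have "poly (pderiv top_dehom) w = poly p w" unfolding p pderiv_mult by (simp add: pderiv_pCons del: mult_pCons_left)
  then obtain q where q: "p = [:- w, 1:] * q" using root' by (metis dvdE poly_eq_0_iff_dvd)
  have "top_dehom \<noteq> 0" using lead_nonzero coeff_top_dehom [of "Suc n"] by (auto simp: lead_def)
  then have "p \<noteq> 0" "q \<noteq> 0" using p q by auto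
  then have degs: "degree top_dehom = Suc (degree p)" "degree p = Suc (degree q)"
    unfolding p q by (simp_all add: degree_mult_eq del: mult_pCons_left)
  then obtain m where m: "Suc n = Suc (Suc m)" "degree q \<le> m" "degree p \<le> Suc m"
    using degree_top_dehom_le by (metis Suc_le_D Suc_le_mono)
  have "highest_part H = homogenize (Suc (Suc m)) ([:- w, 1:] * p)"
    unfolding highest_part_eq m(1) p [symmetric] ..
  also have "\<dots> = linear_form (- w) 1 * homogenize (Suc m) ([:- w, 1:] * q)"
    unfolding homogenize_linear_factor [OF m(3)] q [symmetric] ..
  also have "\<dots> = linear_form (- w) 1 ^ 2 * homogenize m q"
    unfolding homogenize_linear_factor [OF m(2)] by (simp only: power2_eq_square mult.assoc)
  finally have "highest_part H = linear_form (- w) 1 ^ 2 * homogenize m q" .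
  then have "linear_form (- w) 1 ^ 2 dvd highest_part H"
    by (rule dvdI)
  then show False
    using simple [unfolded simple_zero_lines_def, rule_format, of "- w" 1] by simp
qed

definition top_value :: "complex \<times> complex \<Rightarrow> complex" where
  "top_value v = (\<Sum>j\<le>Suc n. coeff top_dehom j * fst v ^ (Suc n - j) * snd v ^ j)"

definition top_value_y :: "complex \<times> complex \<Rightarrow> complex" where
  "top_value_y v = (\<Sum>j\<le>Suc n. of_nat j * coeff top_dehom j * fst v ^ (Suc n - j) * snd v ^ (j - 1))"

lemma top_values_scale:
  "top_value (r * x, r * y) = r ^ Suc n * top_value (x, y)"
  "top_value_y (r * x, r * y) = r ^ n * top_value_y (x, y)"
proof -
  show "top_value (r * x, r * y) = r ^ Suc n * top_value (x, y)"
    unfolding top_value_def sum_distrib_left fst_conv snd_conv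
  proof (intro sum.cong refl)
    fix j assume "j \<in> {..Suc n}"
    then have "r ^ Suc n = r ^ (Suc n - j) * r ^ j" by (simp flip: power_add)
    then show "coeff top_dehom j * (r * x) ^ (Suc n - j) * (r * y) ^ j =
        r ^ Suc n * (coeff top_dehom j * x ^ (Suc n - j) * y ^ j)"
      by (simp add: power_mult_distrib mult_ac)
  qed
  show "top_value_y (r * x, r * y) = r ^ n * top_value_y (x, y)"
    unfolding top_value_y_def sum_distrib_left fst_conv snd_conv
  proof (intro sum.cong refl)
    fix j assume j: "j \<in> {..Suc n}"
    show "of_nat j * coeff top_dehom j * (r * x) ^ (Suc n - j) * (r * y) ^ (j - 1) =
        r ^ n * (of_nat j * coeff top_dehom j * x ^ (Suc n - j) * y ^ (j - 1))"
    proof (cases j)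
      case (Suc i)
      then have "r ^ n = r ^ (Suc n - j) * r ^ i" using j by (simp flip: power_add)
      then show ?thesis using Suc by (simp add: power_mult_distrib mult_ac)
    qed simp
  qed
qed

text \<open>
Compactness of the unit sphere and homogeneity; the factor \<open>norm v\<close> makes both terms homogeneous of
degree \<open>n + 1\<close>.
\<close>

lemma top_values_lower_bound:
  obtains c where "c > 0"
    "\<And>v. c * norm v ^ Suc n \<le> norm (top_value v) + norm v * norm (top_value_y v)"
proof -
  let ?f = "\<lambda>v. norm (top_value v) + norm (top_value_y v)"
  have cont: "continuous_on (sphere 0 1) ?f"
    unfolding top_value_def top_value_y_def by (intro continuous_intros)
  have "sphere (0 :: complex \<times> complex) 1 \<noteq> {}" by simp
  then obtain v0 where v0: "v0 \<in> sphere 0 1" "\<And>v. v \<in> sphere 0 1 \<Longrightarrow> ?f v0 \<le> ?f v"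
    using continuous_attains_inf [OF compact_sphere _ cont] by blast
  have pos: "?f v0 > 0"
  proof (rule ccontr)
    assume "\<not> ?f v0 > 0"
    moreover have "norm (top_value v0) \<ge> 0" "norm (top_value_y v0) \<ge> 0" by simp_all
    ultimately have "norm (top_value v0) = 0" "norm (top_value_y v0) = 0" by linarith+
    then have "top_value v0 = 0" "top_value_y v0 = 0" by simp_all
    moreover obtain x y where xy: "v0 = (x, y)" by (cases v0)
    moreover have "(x, y) \<noteq> (0, 0)" using v0(1) xy by (auto simp flip: zero_prod_def)
    ultimately show False
      using simple_top [of x y] by (simp add: top_value_def top_value_y_def)
  qed
  have "?f v0 * norm v ^ Suc n \<le> norm (top_value v) + norm v * norm (top_value_y v)" for v
  proof (cases "v = 0")
    case False
    obtain x y where xy: "v = (x, y)" by (cases v)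
    let ?r = "norm v"
    have r: "?r > 0" using False by simp
    define u where "u = (x / of_real ?r, y / of_real ?r)"
    have "u = (1 / ?r) *\<^sub>R v" by (simp add: u_def xy scaleR_conv_of_real divide_inverse mult.commute)
    then have "norm u = 1" using r by simp
    then have "?f v0 \<le> ?f u" by (intro v0(2)) simp
    then have "?f v0 * ?r ^ Suc n \<le> ?f u * ?r ^ Suc n" by (intro mult_right_mono) auto
    also have "\<dots> = norm (of_real ?r ^ Suc n * top_value u) + ?r * norm (of_real ?r ^ n * top_value_y u)"
      using r by (simp add: norm_mult norm_power algebra_simps)
    also have "\<dots> = norm (top_value v) + ?r * norm (top_value_y v)"
      using r top_values_scale [of "of_real ?r" "x / of_real ?r" "y / of_real ?r"]
      by (simp add: u_def xy)
    finally show ?thesis .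
  qed simp
  then show ?thesis using that pos by blast
qed

lemma power_mult_le_norm:
  fixes x y :: complex
  assumes "norm (x, y) \<ge> 1" "i + j \<le> m"
  shows "norm x ^ i * norm y ^ j \<le> norm (x, y) ^ m"
proof -
  have "norm x \<le> norm (x, y)" "norm y \<le> norm (x, y)"
    using norm_fst_le [of x y] norm_snd_le [of y x] by simp_all
  then have "norm x ^ i * norm y ^ j \<le> norm (x, y) ^ i * norm (x, y) ^ j"
    by (intro mult_mono power_mono) auto
  also have "\<dots> \<le> norm (x, y) ^ m"
    using assms by (simp flip: power_add add: power_increasing)
  finally show ?thesis .
qed

lemma split_top_coeff:
  assumes "j \<le> Suc n"
  shows "poly (coeff H j) x = coeff top_dehom j * x ^ (Suc n - j) + (\<Sum>i<Suc n - j. coeff (coeff H j) i * x ^ i)"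
  unfolding poly_eq_sum_le [OF degree_coeff_le] using assms
  by (simp add: coeff_top_dehom lessThan_Suc_atMost [symmetric])

lemma norm_eval2_minus_top_le:
  assumes "norm (x, y) \<ge> 1"
  shows "norm (eval2 H (x, y) - top_value (x, y)) \<le> Suc (Suc n) * coeff_norm_sum * norm (x, y) ^ n"
proof -
  have "eval2 H (x, y) - top_value (x, y) =
      (\<Sum>j\<le>Suc n. (\<Sum>i<Suc n - j. coeff (coeff H j) i * x ^ i) * y ^ j)"
    unfolding eval2_eq_sum top_value_def sum_subtractf [symmetric]
    by (intro sum.cong refl) (simp add: split_top_coeff algebra_simps)
  also have "norm \<dots> \<le> (\<Sum>j\<le>Suc n. coeff_norm_sum * norm (x, y) ^ n)"
  proof (rule sum_norm_le)
    fix j assume "j \<in> {..Suc n}"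
    then have j: "j \<le> Suc n" by simp
    have "norm ((\<Sum>i<Suc n - j. coeff (coeff H j) i * x ^ i) * y ^ j) =
        norm (\<Sum>i<Suc n - j. coeff (coeff H j) i * x ^ i * y ^ j)"
      by (simp only: sum_distrib_right)
    also have "\<dots> \<le> (\<Sum>i<Suc n - j. norm (coeff (coeff H j) i) * norm (x, y) ^ n)"
    proof (rule sum_norm_le)
      fix i assume "i \<in> {..<Suc n - j}"
      then have "norm x ^ i * norm y ^ j \<le> norm (x, y) ^ n"
        by (intro power_mult_le_norm assms) auto
      then show "norm (coeff (coeff H j) i * x ^ i * y ^ j) \<le> norm (coeff (coeff H j) i) * norm (x, y) ^ n"
        by (simp add: norm_mult norm_power mult.assoc mult_left_mono)
    qed
    also have "\<dots> \<le> (\<Sum>i\<le>Suc n - j. norm (coeff (coeff H j) i) * norm (x, y) ^ n)"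
      by (rule sum_mono2) auto
    also have "\<dots> \<le> coeff_norm_sum * norm (x, y) ^ n"
      unfolding sum_distrib_right [symmetric] by (intro mult_right_mono partial_coeff_norm_sum_le j) auto
    finally show "norm ((\<Sum>i<Suc n - j. coeff (coeff H j) i * x ^ i) * y ^ j) \<le> coeff_norm_sum * norm (x, y) ^ n" .
  qed
  finally show ?thesis by simp
qed

lemma norm_polar_minus_top_le:
  assumes "norm (x, y) \<ge> 1"
  shows "norm (x, y) * norm (eval2 (deriv_y H) (x, y) - top_value_y (x, y))
    \<le> Suc (Suc n) * (Suc n * coeff_norm_sum) * norm (x, y) ^ n"
proof -
  have "eval2 (deriv_y H) (x, y) - top_value_y (x, y) =
      (\<Sum>j\<le>Suc n. (\<Sum>i<Suc n - j. of_nat j * coeff (coeff H j) i * x ^ i * y ^ (j - 1)))"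
    unfolding eval2_deriv_y_eq_sum top_value_y_def sum_subtractf [symmetric]
    by (intro sum.cong refl)
       (simp add: split_top_coeff distrib_left distrib_right sum_distrib_left sum_distrib_right mult.assoc)
  then have "norm (x, y) * norm (eval2 (deriv_y H) (x, y) - top_value_y (x, y)) =
      norm (\<Sum>j\<le>Suc n. of_real (norm (x, y)) * (\<Sum>i<Suc n - j. of_nat j * coeff (coeff H j) i * x ^ i * y ^ (j - 1)))"
    by (simp add: norm_mult flip: sum_distrib_left)
  also have "\<dots> \<le> (\<Sum>j\<le>Suc n. Suc n * coeff_norm_sum * norm (x, y) ^ n)"
  proof (rule sum_norm_le)
    fix j assume "j \<in> {..Suc n}"
    then have j: "j \<le> Suc n" by simp
    have "norm (of_real (norm (x, y)) * (\<Sum>i<Suc n - j. of_nat j * coeff (coeff H j) i * x ^ i * y ^ (j - 1))) =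
        norm (\<Sum>i<Suc n - j. of_real (norm (x, y)) * (of_nat j * coeff (coeff H j) i * x ^ i * y ^ (j - 1)))"
      by (simp only: sum_distrib_left)
    also have "\<dots> \<le> (\<Sum>i<Suc n - j. Suc n * norm (coeff (coeff H j) i) * norm (x, y) ^ n)"
    proof (rule sum_norm_le)
      fix i assume i: "i \<in> {..<Suc n - j}"
      show "norm (of_real (norm (x, y)) * (of_nat j * coeff (coeff H j) i * x ^ i * y ^ (j - 1))) \<le>
          Suc n * norm (coeff (coeff H j) i) * norm (x, y) ^ n"
      proof (cases j)
        case (Suc l)
        have "norm x ^ i * norm y ^ l \<le> norm (x, y) ^ (n - 1)"
          using i Suc by (intro power_mult_le_norm assms) auto
        then have "norm (x, y) * (norm x ^ i * norm y ^ l) \<le> norm (x, y) * norm (x, y) ^ (n - 1)"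
          by (intro mult_left_mono) auto
        also have "\<dots> = norm (x, y) ^ n" using n by (cases n) auto
        finally have "j * norm (coeff (coeff H j) i) * (norm (x, y) * (norm x ^ i * norm y ^ l)) \<le>
            Suc n * norm (coeff (coeff H j) i) * norm (x, y) ^ n"
          using j by (intro mult_mono) auto
        then show ?thesis using Suc by (simp add: norm_mult norm_power mult_ac del: of_nat_Suc)
      qed simp
    qed
    also have "\<dots> \<le> (\<Sum>i\<le>Suc n - j. Suc n * norm (coeff (coeff H j) i) * norm (x, y) ^ n)"
      by (rule sum_mono2) auto
    also have "\<dots> = Suc n * (\<Sum>i\<le>Suc n - j. norm (coeff (coeff H j) i)) * norm (x, y) ^ n"
      by (simp only: sum_distrib_left sum_distrib_right mult.assoc)
    also have "\<dots> \<le> Suc n * coeff_norm_sum * norm (x, y) ^ n"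
      by (intro mult_right_mono mult_left_mono partial_coeff_norm_sum_le j) auto
    finally show "norm (of_real (norm (x, y)) * (\<Sum>i<Suc n - j. of_nat j * coeff (coeff H j) i * x ^ i * y ^ (j - 1)))
        \<le> Suc n * coeff_norm_sum * norm (x, y) ^ n" .
  qed
  finally show ?thesis by simp
qed

text \<open>
On the polar curve the \<open>y\<close>-derivative of the highest part is of lower order, so the highest part
itself must be large, and it dominates the remaining terms of \<open>H\<close>.
\<close>

lemma polar_growth:
  obtains c R where "c > 0" "R \<ge> 1"
    "\<And>x y. eval2 (deriv_y H) (x, y) = 0 \<Longrightarrow> norm x \<ge> R \<Longrightarrow>
      c * norm x ^ Suc n \<le> norm (eval2 H (x, y))"
proof -
  obtain c where c: "c > 0"
    "\<And>v. c * norm v ^ Suc n \<le> norm (top_value v) + norm v * norm (top_value_y v)"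
    using top_values_lower_bound by blast
  define K where "K = Suc (Suc n) * coeff_norm_sum + Suc (Suc n) * (Suc n * coeff_norm_sum)"
  define R where "R = max 1 (2 * K / c)"
  have "c / 2 * norm x ^ Suc n \<le> norm (eval2 H (x, y))"
    if pol: "eval2 (deriv_y H) (x, y) = 0" and x: "norm x \<ge> R" for x y
  proof -
    let ?r = "norm (x, y)"
    have rx: "norm x \<le> ?r" using norm_fst_le [of x y] by simp
    then have r: "?r \<ge> 1" "?r \<ge> 2 * K / c" using x unfolding R_def by linarith+
    have "c * ?r ^ Suc n \<le> norm (top_value (x, y)) + ?r * norm (top_value_y (x, y))"
      by (rule c)
    also have "norm (top_value (x, y)) \<le> norm (eval2 H (x, y)) + Suc (Suc n) * coeff_norm_sum * ?r ^ n"
      using norm_eval2_minus_top_le [OF r(1)] norm_triangle_ineq2 [of "top_value (x, y)" "eval2 H (x, y)"]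
      by (simp add: norm_minus_commute)
    also have "?r * norm (top_value_y (x, y)) \<le> Suc (Suc n) * (Suc n * coeff_norm_sum) * ?r ^ n"
      using norm_polar_minus_top_le [OF r(1)] pol by simp
    finally have "c * ?r ^ Suc n \<le> norm (eval2 H (x, y)) + K * ?r ^ n"
      by (simp add: K_def distrib_right)
    moreover have "K * ?r ^ n \<le> c / 2 * ?r ^ Suc n"
    proof -
      have "K \<le> c / 2 * ?r" using r(2) c(1) by (simp add: field_simps)
      then have "K * ?r ^ n \<le> c / 2 * ?r * ?r ^ n" by (intro mult_right_mono) auto
      then show ?thesis by (simp add: mult.assoc)
    qed
    ultimately have "c / 2 * ?r ^ Suc n \<le> norm (eval2 H (x, y))" by simp
    moreover have "c / 2 * norm x ^ Suc n \<le> c / 2 * ?r ^ Suc n"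
      using c(1) rx by (intro mult_left_mono power_mono) auto
    ultimately show ?thesis by linarith
  qed
  moreover have "c / 2 > 0" "R \<ge> 1" using c(1) unfolding R_def by auto
  ultimately show ?thesis using that by blast
qed

end

section \<open>The critical values of the projection as algebraic functions of the level\<close>

text \<open>
The homogeneous form of the generating function of the elementary symmetric functions.
\<close>

lemma prod_diff_eq_esymm_sum:
  fixes f :: "'u \<Rightarrow> complex"
  assumes "finite U"
  shows "(\<Prod>u\<in>U. t - f u) = (\<Sum>k\<le>card U. t ^ (card U - k) * coeff (\<Prod>u\<in>U. [:1, - f u:]) k)"
proof -
  let ?P = "\<Prod>u\<in>U. [:- f u, 1:]"
  have deg: "degree ?P = card U"
    using assms by (subst degree_prod_eq_sum_degree) auto
  have "reflect_poly [:- z, 1:] = [:1, - z:]" for z :: complex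
    by (simp add: reflect_poly_def)
  then have refl: "(\<Prod>u\<in>U. [:1, - f u:]) = reflect_poly ?P"
    by (simp only: reflect_poly_prod)
  have "(\<Prod>u\<in>U. t - f u) = poly ?P t" by (simp add: poly_prod)
  also have "\<dots> = (\<Sum>j\<le>card U. coeff ?P j * t ^ j)"
    by (rule poly_eq_sum_le) (simp add: deg)
  also have "\<dots> = (\<Sum>k\<le>card U. coeff ?P (card U - k) * t ^ (card U - k))"
    using sum.nat_diff_reindex [of "\<lambda>j. coeff ?P j * t ^ j" "Suc (card U)"]
    by (simp add: lessThan_Suc_atMost)
  also have "\<dots> = (\<Sum>k\<le>card U. t ^ (card U - k) * coeff (\<Prod>u\<in>U. [:1, - f u:]) k)"
    unfolding refl by (intro sum.cong) (auto simp: coeff_reflect_poly deg)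
  finally show ?thesis .
qed

text \<open>
The projection of the intersection of a level curve with the polar curve \<open>dH/dy = 0\<close>. At
noncritical levels this is the set of critical values of the projection.
\<close>

definition polar_projection :: "complex poly poly \<Rightarrow> complex \<Rightarrow> complex set" where
  "polar_projection H t = {x. \<exists>y. eval2 H (x, y) = t \<and> eval2 (deriv_y H) (x, y) = 0}"

context transversal_simple_top
begin

text \<open>
Large points of the polar curve lie on levels of size at least \<open>c * norm x ^ (n + 1)\<close>.
\<close>

lemma polar_projection_growth:
  obtains C where "C \<ge> 0" "\<And>t x. x \<in> polar_projection H t \<Longrightarrow> norm x ^ Suc n \<le> C * (1 + norm t)"
proof -
  obtain c R where c: "c > 0" "R \<ge> 1"
    "\<And>x y. eval2 (deriv_y H) (x, y) = 0 \<Longrightarrow> norm x \<ge> R \<Longrightarrow> c * norm x ^ Suc n \<le> norm (eval2 H (x, y))"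
    using polar_growth by blast
  have "norm x ^ Suc n \<le> (R ^ Suc n + 1 / c) * (1 + norm t)" if x: "x \<in> polar_projection H t" for t x
  proof -
    have R0: "R ^ Suc n \<ge> 0" using c by (intro zero_le_power) linarith
    then have exp: "(R ^ Suc n + 1 / c) * (1 + norm t) \<ge> R ^ Suc n" "(R ^ Suc n + 1 / c) * (1 + norm t) \<ge> norm t / c"
      using c by (simp_all add: algebra_simps add_nonneg_nonneg)
    show ?thesis
    proof (cases "norm x \<ge> R")
      case True
      then have "c * norm x ^ Suc n \<le> norm t"
        using c(3) x unfolding polar_projection_def by blast
      then have "norm x ^ Suc n \<le> norm t / c" using c(1) by (simp add: field_simps)
      then show ?thesis using exp by linarith
    next
      case False
      then have "norm x ^ Suc n \<le> R ^ Suc n" by (intro power_mono) auto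
      then show ?thesis using exp by linarith
    qed
  qed
  moreover have "R ^ Suc n + 1 / c \<ge> 0" using c by (intro add_nonneg_nonneg zero_le_power) auto
  ultimately show ?thesis using that by blast
qed

lemma polar_roots:
  obtains \<beta> where
    "\<And>x. (\<lambda>i. \<beta> i x) ` {..<n} = {y. eval2 (deriv_y H) (x, y) = 0}"
    "\<And>l. polyfun id (\<lambda>x. \<Sum>i<n. \<beta> i x ^ l)"
proof -
  have coeffs: "polyfun id (\<lambda>x. coeff (slice (deriv_y H) x) k)" for k
    using polyfun_poly [of id "coeff (deriv_y H) k"] by simp
  have "of_nat (Suc n) * lead \<noteq> 0" using lead_nonzero by (simp del: of_nat_Suc)
  then obtain \<beta> where \<beta>:
    "\<And>x. slice (deriv_y H) x = smult (of_nat (Suc n) * lead) (\<Prod>i<n. [:- \<beta> i x, 1:])"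
    "\<And>l. polyfun id (\<lambda>x. \<Sum>i<n. \<beta> i x ^ l)"
    using roots_enumeration [OF degree_slice_deriv_y coeff_slice_deriv_y _ coeffs] by blast
  have "(\<lambda>i. \<beta> i x) ` {..<n} = {y. eval2 (deriv_y H) (x, y) = 0}" for x
    using lead_nonzero unfolding eval2_slice \<beta>(1)
    by (auto simp: poly_prod prod_zero_iff simp del: of_nat_Suc)
  then show ?thesis using \<beta>(2) that by blast
qed

text \<open>
The product \<open>\<Delta>\<close> of \<open>t - H (x, b)\<close> over the \<open>y\<close>-roots \<open>b\<close> of \<open>dH/dy (x, _)\<close> is symmetric in the
roots, hence a polynomial in \<open>x\<close> and \<open>t\<close>. The coefficient \<open>q k\<close> of \<open>t ^ (n - k)\<close> has degree at most
\<open>k (n + 1)\<close> in \<open>x\<close>, with equality for \<open>k = n\<close> by the growth of \<open>H\<close> on the polar curve. Therefore \<open>\<Delta>\<close>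
has degree \<open>n (n + 1)\<close> in \<open>x\<close> with constant leading coefficient, and the power sums of its roots are
polynomials in \<open>t\<close>.
\<close>

lemma polar_projection_roots:
  obtains \<xi> where
    "\<And>t. (\<lambda>i. \<xi> i t) ` {..<n * Suc n} = polar_projection H t"
    "\<And>l. polyfun id (\<lambda>t. \<Sum>i<n * Suc n. \<xi> i t ^ l)"
proof -
  obtain \<beta> where \<beta>: "\<And>x. (\<lambda>i. \<beta> i x) ` {..<n} = {y. eval2 (deriv_y H) (x, y) = 0}"
    and \<beta>_sums: "\<And>l. polyfun id (\<lambda>x. \<Sum>i<n. \<beta> i x ^ l)"
    using polar_roots by blast
  define U where "U = tuples 1 (\<lambda>_. n)"
  define f where "f x u = eval2 H (x, \<beta> (u 0) x)" for x and u :: "nat \<Rightarrow> nat"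
  have U: "finite U" "card U = n" unfolding U_def by (simp_all add: card_tuples)
  have polar: "eval2 (deriv_y H) (x, \<beta> (u 0) x) = 0" if "u \<in> U" for x u
    using \<beta> [of x] tuples_less [of u 1 "\<lambda>_. n" 0] that unfolding U_def by auto
  have onto: "\<exists>u\<in>U. y = \<beta> (u 0) x" if "eval2 (deriv_y H) (x, y) = 0" for x y
  proof -
    have "y \<in> (\<lambda>i. \<beta> i x) ` {..<n}" using \<beta> [of x] that by simp
    then obtain i where "i < n" "y = \<beta> i x" by auto
    moreover have "restrict (\<lambda>_. i) {..<1} \<in> U"
      unfolding U_def tuples_def using \<open>i < n\<close> by auto
    ultimately show ?thesis
      by (intro bexI [of _ "restrict (\<lambda>_. i) {..<1}"]) auto
  qed
  have "tuple_poly id 1 (\<lambda>_. n) (\<lambda>_. \<beta>) f"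
    unfolding f_def eval2_eq_sum
    by (intro tuple_poly_sum tuple_poly_mult tuple_poly_power tuple_poly_coord [of 0] tuple_poly_param)
       (auto simp: polyfun_def)
  then have "polyfun id (\<lambda>x. coeff (\<Prod>u\<in>U. [:1, - f x u:]) k)" for k
    unfolding U_def by (rule polyfun_tuple_esymm [rotated]) (rule \<beta>_sums)
  then obtain q where q: "\<And>k x. coeff (\<Prod>u\<in>U. [:1, - f x u:]) k = poly (q k) x"
    unfolding polyfun_def id_def by metis
  define C where "C = 1 + n * (Suc n * coeff_norm_sum) / norm (of_nat (Suc n) * lead)"
  have "C \<ge> 1" unfolding C_def using coeff_norm_sum_nonneg by simp
  have deg_q: "degree (q k) \<le> Suc n * k" for k
  proof -
    have "degree (q k) * 1 \<le> Suc n * k"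
    proof (rule esymm_degree_le [OF U(1)])
      show "coeff (\<Prod>u\<in>U. [:1, - f (of_real \<tau>) u:]) k = poly (q k) (of_real \<tau>)" for \<tau> :: real
        by (rule q)
      fix \<tau> :: real assume "\<tau> \<ge> 0"
      let ?K = "Suc (Suc n) * coeff_norm_sum * C ^ Suc n"
      have "?K \<ge> 0" using coeff_norm_sum_nonneg \<open>C \<ge> 1\<close> by (intro mult_nonneg_nonneg) auto
      moreover have "norm (f (of_real \<tau>) u) \<le> ?K * (1 + \<tau>) ^ Suc n" if "u \<in> U" for u
      proof -
        have "norm (\<beta> (u 0) (of_real \<tau>)) \<le> C * (1 + norm (of_real \<tau> :: complex))"
          unfolding C_def by (rule norm_polar_root_le [OF polar [OF that]])
        from norm_eval2_le [OF this \<open>C \<ge> 1\<close>] show ?thesis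
          using \<open>\<tau> \<ge> 0\<close> unfolding f_def by simp
      qed
      ultimately show "\<exists>B\<ge>0. B ^ 1 \<le> ?K * (1 + \<tau>) ^ Suc n \<and> (\<forall>u\<in>U. norm (f (of_real \<tau>) u) \<le> B)"
        using \<open>\<tau> \<ge> 0\<close> by (intro exI [of _ "?K * (1 + \<tau>) ^ Suc n"]) auto
    qed
    then show ?thesis by simp
  qed
  have prod_eq: "(\<Prod>u\<in>U. t - f x u) = (\<Sum>k\<le>n. t ^ (n - k) * poly (q k) x)" for t x
    using prod_diff_eq_esymm_sum [OF U(1), of t "f x"] unfolding U(2) q .
  have "n * Suc n \<le> degree (q n)"
  proof -
    obtain c R where c: "c > 0" "R \<ge> 1"
      "\<And>x y. eval2 (deriv_y H) (x, y) = 0 \<Longrightarrow> norm x \<ge> R \<Longrightarrow> c * norm x ^ Suc n \<le> norm (eval2 H (x, y))"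
      using polar_growth by blast
    show ?thesis
    proof (rule degree_ge_of_growth)
      show "c ^ n > 0" using c by simp
      fix \<tau> :: real assume \<tau>: "\<tau> \<ge> R"
      then have pos: "\<tau> \<ge> 0" using c by linarith
      have "c ^ n * \<tau> ^ (n * Suc n) = (\<Prod>u\<in>U. c * \<tau> ^ Suc n)"
        by (simp only: prod_constant U(2) power_mult_distrib power_mult [symmetric] mult.commute)
      also have "\<dots> \<le> (\<Prod>u\<in>U. norm (f (of_real \<tau>) u))"
      proof (rule prod_mono)
        fix u assume "u \<in> U"
        then show "0 \<le> c * \<tau> ^ Suc n \<and> c * \<tau> ^ Suc n \<le> norm (f (of_real \<tau>) u)"
          using c(3) [OF polar [of u "of_real \<tau>"]] c(1) \<tau> pos unfolding f_def by simp
      qed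
      also have "\<dots> = norm (\<Prod>u\<in>U. 0 - f (of_real \<tau>) u)"
        by (simp add: prod_norm [symmetric])
      also have "\<dots> = norm (poly (q n) (of_real \<tau>))"
      proof -
        have "(\<Sum>k\<le>n. 0 ^ (n - k) * poly (q k) (of_real \<tau>)) = poly (q n) (of_real \<tau>)"
          by (subst sum.remove [of _ n]) (auto intro!: sum.neutral)
        then show ?thesis unfolding prod_eq by simp
      qed
      finally show "c ^ n * \<tau> ^ (n * Suc n) \<le> norm (poly (q n) (of_real \<tau>))" .
    qed
  qed
  then have deg_qn: "degree (q n) = n * Suc n" using deg_q [of n] by (simp add: mult.commute)
  define \<Delta> where "\<Delta> t = (\<Sum>k\<le>n. smult (t ^ (n - k)) (q k))" for t
  have poly_\<Delta>: "poly (\<Delta> t) x = (\<Prod>u\<in>U. t - f x u)" for t x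
    unfolding \<Delta>_def prod_eq by (simp add: poly_sum)
  have coeff_\<Delta>: "coeff (\<Delta> t) (n * Suc n) = lead_coeff (q n)" for t
  proof -
    have "coeff (q k) (n * Suc n) = 0" if "k < n" for k
    proof (rule coeff_eq_0)
      have "degree (q k) \<le> k * Suc n" using deg_q [of k] by (simp only: mult.commute)
      also have "\<dots> < n * Suc n" using that by (intro mult_strict_right_mono) auto
      finally show "degree (q k) < n * Suc n" .
    qed
    then have "coeff (\<Delta> t) (n * Suc n) = (\<Sum>k\<le>n. if k = n then coeff (q n) (n * Suc n) else 0)"
      unfolding \<Delta>_def coeff_sum by (intro sum.cong) (auto simp del: mult_Suc_right)
    then show ?thesis using deg_qn by simp
  qed
  have "q n \<noteq> 0" using deg_qn n by auto
  then have lc: "lead_coeff (q n) \<noteq> 0" by (simp only: leading_coeff_0_iff not_False_eq_True)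
  have deg_\<Delta>: "degree (\<Delta> t) = n * Suc n" for t
  proof (rule antisym)
    show "degree (\<Delta> t) \<le> n * Suc n"
      unfolding \<Delta>_def
    proof (intro degree_sum_le)
      fix k assume "k \<in> {..n}"
      then have "Suc n * k \<le> n * Suc n" by (simp only: mult.commute [of n] mult_le_mono2 atMost_iff)
      with deg_q [of k] have "degree (q k) \<le> n * Suc n" by (rule order_trans)
      then show "degree (smult (t ^ (n - k)) (q k)) \<le> n * Suc n"
        using degree_smult_le order_trans by blast
    qed simp
    show "n * Suc n \<le> degree (\<Delta> t)" by (rule le_degree) (simp only: coeff_\<Delta> lc not_False_eq_True)
  qed
  have "polyfun id (\<lambda>t. coeff (\<Delta> t) k)" for k
    unfolding \<Delta>_def coeff_sum coeff_smult
    by (intro polyfun_sum polyfun_mult polyfun_const polyfun_power) (auto simp: polyfun_def intro: exI [of _ "[:0, 1:]"])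
  then obtain \<xi> where \<xi>: "\<And>t. \<Delta> t = smult (lead_coeff (q n)) (\<Prod>i<n * Suc n. [:- \<xi> i t, 1:])"
    and sums: "\<And>l. polyfun id (\<lambda>t. \<Sum>i<n * Suc n. \<xi> i t ^ l)"
    using roots_enumeration [of \<Delta> "n * Suc n" "lead_coeff (q n)" id, OF deg_\<Delta> coeff_\<Delta> lc] by blast
  have "(\<lambda>i. \<xi> i t) ` {..<n * Suc n} = polar_projection H t" for t
  proof -
    have "(\<lambda>i. \<xi> i t) ` {..<n * Suc n} = {x. poly (\<Delta> t) x = 0}"
      unfolding \<xi> using lc by (auto simp: poly_prod prod_zero_iff simp del: mult_Suc_right)
    also have "\<dots> = polar_projection H t"
      unfolding poly_\<Delta> polar_projection_def
      using polar onto U(1) by (force simp: prod_zero_iff f_def)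
    finally show ?thesis .
  qed
  then show ?thesis using sums that by blast
qed

end

section \<open>Constancy of multiplicities along a path\<close>

lemma sum_by_values:
  fixes \<phi> :: "complex \<Rightarrow> complex"
  assumes "(\<lambda>i. f i) ` {..<N} \<subseteq> x ` {..<\<mu>}" "inj_on x {..<\<mu>::nat}"
  shows "(\<Sum>i<N::nat. \<phi> (f i)) = (\<Sum>j<\<mu>. of_nat (card {i\<in>{..<N}. f i = x j}) * \<phi> (x j))"
proof -
  have "(\<Sum>i<N. \<phi> (f i)) = (\<Sum>z\<in>x ` {..<\<mu>}. \<Sum>i\<in>{i\<in>{..<N}. f i = z}. \<phi> (f i))"
    using assms(1) by (intro sum.group [symmetric]) auto
  also have "\<dots> = (\<Sum>j<\<mu>. \<Sum>i\<in>{i\<in>{..<N}. f i = x j}. \<phi> (f i))"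
    using assms(2) by (simp add: sum.reindex)
  also have "\<dots> = (\<Sum>j<\<mu>. of_nat (card {i\<in>{..<N}. f i = x j}) * \<phi> (x j))"
    by (intro sum.cong refl) simp
  finally show ?thesis .
qed

text \<open>
The branches \<open>x j\<close> are continuous with disjoint graphs, but the roots \<open>\<xi>\<close> they come from carry
multiplicities. Take a polynomial \<open>g\<close> that vanishes at \<open>\<tau>0\<close> on all branches except \<open>x j\<close>. The sum \<open>G\<close>
of \<open>g\<close> over the roots is continuous, being a combination of power sums, and near \<open>\<tau>0\<close> it is
dominated by the multiplicity of \<open>x j\<close> times \<open>g (x j)\<close>; hence this multiplicity is continuous.
\<close>

lemma multiplicities_constant:
  fixes \<xi> :: "nat \<Rightarrow> complex \<Rightarrow> complex" and x :: "nat \<Rightarrow> real \<Rightarrow> complex"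
  assumes sums: "\<And>l. polyfun id (\<lambda>t. \<Sum>i<N. \<xi> i t ^ l)"
    and T: "connected T" and \<alpha>: "continuous_on T \<alpha>"
    and x: "\<And>j. j < \<mu> \<Longrightarrow> continuous_on T (x j)"
    and inj: "\<And>\<tau>. \<tau> \<in> T \<Longrightarrow> inj_on (\<lambda>j. x j \<tau>) {..<\<mu>}"
    and img: "\<And>\<tau>. \<tau> \<in> T \<Longrightarrow> (\<lambda>i. \<xi> i (\<alpha> \<tau>)) ` {..<N} \<subseteq> (\<lambda>j. x j \<tau>) ` {..<\<mu>}"
    and "\<tau> \<in> T" "\<sigma> \<in> T" and j: "j < \<mu>"
  shows "card {i\<in>{..<N}. \<xi> i (\<alpha> \<tau>) = x j \<tau>} = card {i\<in>{..<N}. \<xi> i (\<alpha> \<sigma>) = x j \<sigma>}"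
proof -
  define m where "m k \<tau> = card {i\<in>{..<N}. \<xi> i (\<alpha> \<tau>) = x k \<tau>}" for k \<tau>
  have m_le: "m k \<tau> \<le> N" for k \<tau>
    using card_mono [of "{..<N}" "{i\<in>{..<N}. \<xi> i (\<alpha> \<tau>) = x k \<tau>}"] by (auto simp: m_def)
  have "\<forall>\<^sub>F \<tau> in at \<tau>0 within T. m j \<tau>0 = m j \<tau>" if \<tau>0: "\<tau>0 \<in> T" for \<tau>0
  proof -
    define g where "g = (\<Prod>k\<in>{..<\<mu>} - {j}. [:- x k \<tau>0, 1:])"
    define G where "G \<tau> = (\<Sum>i<N. poly g (\<xi> i (\<alpha> \<tau>)))" for \<tau>
    let ?F = "at \<tau>0 within T"
    have g0: "poly g (x k \<tau>0) = 0" if "k \<in> {..<\<mu>} - {j}" for k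
      using that unfolding g_def poly_prod by (intro prod_zero) auto
    have gj: "poly g (x j \<tau>0) \<noteq> 0"
      using inj [OF \<tau>0] j unfolding g_def poly_prod inj_on_def by (auto simp: prod_zero_iff)
    have x_lim: "(x k \<longlongrightarrow> x k \<tau>0) ?F" if "k < \<mu>" for k
      using x [OF that] \<tau>0 by (simp add: continuous_on_def)
    have "continuous_on T G"
    proof -
      have "G \<tau> = (\<Sum>l\<le>degree g. coeff g l * (\<Sum>i<N. \<xi> i (\<alpha> \<tau>) ^ l))" for \<tau>
        unfolding G_def poly_altdef by (subst sum.swap) (simp add: sum_distrib_left)
      moreover have "continuous_on T (\<lambda>\<tau>. \<Sum>i<N. \<xi> i (\<alpha> \<tau>) ^ l)" for l
      proof -
        obtain p where p: "\<And>t. (\<Sum>i<N. \<xi> i t ^ l) = poly p t"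
          using sums [of l] unfolding polyfun_def by auto
        show ?thesis unfolding p by (intro continuous_on_poly \<alpha>)
      qed
      ultimately show ?thesis by (simp add: continuous_on_sum continuous_on_mult)
    qed
    then have G_lim: "(G \<longlongrightarrow> G \<tau>0) ?F" using \<tau>0 by (simp add: continuous_on_def)
    have G_eq: "G \<tau> = (\<Sum>k<\<mu>. of_nat (m k \<tau>) * poly g (x k \<tau>))" if "\<tau> \<in> T" for \<tau>
      unfolding G_def m_def by (rule sum_by_values) (use img inj that in auto)
    have other: "((\<lambda>\<tau>. \<Sum>k\<in>{..<\<mu>} - {j}. of_nat (m k \<tau>) * poly g (x k \<tau>)) \<longlongrightarrow> 0) ?F"
    proof (rule tendsto_null_sum)
      fix k assume k: "k \<in> {..<\<mu>} - {j}"
      have "((\<lambda>\<tau>. poly g (x k \<tau>)) \<longlongrightarrow> 0) ?F"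
        using tendsto_poly [OF x_lim, of k g] g0 [OF k] k by simp
      then have "((\<lambda>\<tau>. of_nat N * norm (poly g (x k \<tau>))) \<longlongrightarrow> 0) ?F"
        by (intro tendsto_mult_right_zero tendsto_norm_zero)
      then show "((\<lambda>\<tau>. of_nat (m k \<tau>) * poly g (x k \<tau>)) \<longlongrightarrow> 0) ?F"
        by (rule Lim_null_comparison [rotated])
           (simp add: norm_mult m_le mult_right_mono)
    qed
    have "((\<lambda>\<tau>. (G \<tau> - (\<Sum>k\<in>{..<\<mu>} - {j}. of_nat (m k \<tau>) * poly g (x k \<tau>))) / poly g (x j \<tau>))
        \<longlongrightarrow> (G \<tau>0 - 0) / poly g (x j \<tau>0)) ?F"
      by (intro tendsto_intros G_lim other x_lim j gj)
    moreover have "(G \<tau>0 - 0) / poly g (x j \<tau>0) = of_nat (m j \<tau>0)"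
      using gj g0 j unfolding G_eq [OF \<tau>0]
      by (subst sum.remove [of _ j]) auto
    moreover have "\<forall>\<^sub>F \<tau> in ?F. (G \<tau> - (\<Sum>k\<in>{..<\<mu>} - {j}. of_nat (m k \<tau>) * poly g (x k \<tau>))) / poly g (x j \<tau>)
        = of_nat (m j \<tau>)"
    proof -
      have "\<forall>\<^sub>F \<tau> in ?F. poly g (x j \<tau>) \<noteq> 0"
        using tendsto_poly [OF x_lim [OF j], of g] gj by (rule tendsto_imp_eventually_ne)
      moreover have "\<forall>\<^sub>F \<tau> in ?F. \<tau> \<in> T" by (simp add: eventually_at_filter)
      ultimately show ?thesis
      proof eventually_elim
        case (elim \<tau>)
        then show ?case
          using j unfolding G_eq [OF elim(2)] by (subst sum.remove [of _ j]) auto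
      qed
    qed
    ultimately have "((\<lambda>\<tau>. of_nat (m j \<tau>)) \<longlongrightarrow> (of_nat (m j \<tau>0) :: complex)) ?F"
      by (simp add: tendsto_cong)
    then have "\<forall>\<^sub>F \<tau> in ?F. dist (of_nat (m j \<tau>)) (of_nat (m j \<tau>0) :: complex) < 1"
      by (rule tendstoD) simp
    then show ?thesis
    proof eventually_elim
      case (elim \<tau>)
      have "dist (of_nat (m j \<tau>)) (of_nat (m j \<tau>0) :: complex) = \<bar>real (m j \<tau>) - real (m j \<tau>0)\<bar>"
        unfolding dist_norm by (metis norm_of_real of_real_diff of_real_of_nat_eq)
      with elim show ?case by linarith
    qed
  qed
  then have "m j \<tau> = m j \<sigma>"
    using connected_local_const [OF T \<open>\<tau> \<in> T\<close> \<open>\<sigma> \<in> T\<close>, of "m j"] by blast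
  then show ?thesis unfolding m_def .
qed

text \<open>
Since multiplicities do not change, a repetition pattern \<open>\<rho>\<close> of the branches found at one time
enumerates the roots with multiplicity at all times. Elimination sees an enumeration only through
its power sums.
\<close>

lemma continuous_enumeration:
  fixes \<xi> :: "nat \<Rightarrow> complex \<Rightarrow> complex" and x :: "nat \<Rightarrow> real \<Rightarrow> complex"
  assumes sums: "\<And>l. polyfun id (\<lambda>t. \<Sum>i<N. \<xi> i t ^ l)"
    and T: "connected T" "T \<noteq> {}" and \<alpha>: "continuous_on T \<alpha>"
    and x: "\<And>j. j < \<mu> \<Longrightarrow> continuous_on T (x j)"
    and inj: "\<And>\<tau>. \<tau> \<in> T \<Longrightarrow> inj_on (\<lambda>j. x j \<tau>) {..<\<mu>}"
    and img: "\<And>\<tau>. \<tau> \<in> T \<Longrightarrow> (\<lambda>i. \<xi> i (\<alpha> \<tau>)) ` {..<N} = (\<lambda>j. x j \<tau>) ` {..<\<mu>}"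
  obtains \<rho> where "\<rho> ` {..<N} = {..<\<mu>}"
    "\<And>\<tau> l. \<tau> \<in> T \<Longrightarrow> (\<Sum>i<N. x (\<rho> i) \<tau> ^ l) = (\<Sum>i<N. \<xi> i (\<alpha> \<tau>) ^ l)"
proof -
  obtain \<tau>0 where \<tau>0: "\<tau>0 \<in> T" using T by blast
  have "\<forall>i\<in>{..<N}. \<exists>j<\<mu>. \<xi> i (\<alpha> \<tau>0) = x j \<tau>0" using img [OF \<tau>0] by blast
  then obtain \<rho> where \<rho>: "\<And>i. i < N \<Longrightarrow> \<rho> i < \<mu> \<and> \<xi> i (\<alpha> \<tau>0) = x (\<rho> i) \<tau>0"
    by (metis lessThan_iff)
  have fibre: "{i\<in>{..<N}. \<rho> i = j} = {i\<in>{..<N}. \<xi> i (\<alpha> \<tau>0) = x j \<tau>0}" if "j < \<mu>" for j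
    using \<rho> inj [OF \<tau>0] that unfolding inj_on_def by auto
  have "\<rho> ` {..<N} = {..<\<mu>}"
  proof
    show "{..<\<mu>} \<subseteq> \<rho> ` {..<N}"
    proof
      fix j assume j: "j \<in> {..<\<mu>}"
      then have "x j \<tau>0 \<in> (\<lambda>i. \<xi> i (\<alpha> \<tau>0)) ` {..<N}" using img [OF \<tau>0] by blast
      then have "{i\<in>{..<N}. \<rho> i = j} \<noteq> {}" using fibre j by force
      then show "j \<in> \<rho> ` {..<N}" by blast
    qed
  qed (use \<rho> in auto)
  moreover have "(\<Sum>i<N. x (\<rho> i) \<tau> ^ l) = (\<Sum>i<N. \<xi> i (\<alpha> \<tau>) ^ l)" if \<tau>: "\<tau> \<in> T" for \<tau> l
  proof -
    have "(\<Sum>i<N. x (\<rho> i) \<tau> ^ l) =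
        (\<Sum>j<\<mu>. of_nat (card {i\<in>{..<N}. x (\<rho> i) \<tau> = x j \<tau>}) * x j \<tau> ^ l)"
      by (rule sum_by_values [of "\<lambda>i. x (\<rho> i) \<tau>"]) (use \<rho> inj [OF \<tau>] in auto)
    also have "\<dots> = (\<Sum>j<\<mu>. of_nat (card {i\<in>{..<N}. \<xi> i (\<alpha> \<tau>) = x j \<tau>}) * x j \<tau> ^ l)"
    proof (intro sum.cong refl)
      fix j assume "j \<in> {..<\<mu>}"
      then have j: "j < \<mu>" by simp
      have "{i\<in>{..<N}. x (\<rho> i) \<tau> = x j \<tau>} = {i\<in>{..<N}. \<rho> i = j}"
        using \<rho> inj [OF \<tau>] j unfolding inj_on_def by auto
      also have "card \<dots> = card {i\<in>{..<N}. \<xi> i (\<alpha> \<tau>) = x j \<tau>}"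
        unfolding fibre [OF j]
        by (rule multiplicities_constant [where T = T and \<mu> = \<mu>])
           (use sums T \<alpha> x inj img \<tau>0 \<tau> j in auto)
      finally show "of_nat (card {i\<in>{..<N}. x (\<rho> i) \<tau> = x j \<tau>}) * x j \<tau> ^ l =
          of_nat (card {i\<in>{..<N}. \<xi> i (\<alpha> \<tau>) = x j \<tau>}) * x j \<tau> ^ l" by simp
    qed
    also have "\<dots> = (\<Sum>i<N. \<xi> i (\<alpha> \<tau>) ^ l)"
      by (rule sum_by_values [symmetric]) (use img inj \<tau> in auto)
    finally show ?thesis .
  qed
  ultimately show ?thesis using that by blast
qed

text \<open>
With \<open>a' = cnj a\<close>, \<open>b' = cnj b\<close>, \<open>c' = cnj c\<close> this is \<open>2 * \<i>\<close> times the imaginary part of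
\<open>(b - a) * cnj (c - a)\<close>, which vanishes iff the three points are collinear.
\<close>

definition alignment :: "complex \<Rightarrow> complex \<Rightarrow> complex \<Rightarrow> complex \<Rightarrow> complex \<Rightarrow> complex \<Rightarrow> complex" where
  "alignment a b c a' b' c' = (b - a) * (c' - a') - (b' - a') * (c - a)"

lemma alignment_open_segment:
  assumes "b \<in> open_segment a c"
  shows "alignment a b c (cnj a) (cnj b) (cnj c) = 0"
    and "0 < Re ((b - a) / (c - a))" "Re ((b - a) / (c - a)) < 1"
proof -
  obtain u where u: "a \<noteq> c" "0 < u" "u < 1" "b = (1 - u) *\<^sub>R a + u *\<^sub>R c"
    using assms unfolding in_segment by blast
  have b: "b - a = of_real u * (c - a)" by (simp add: u scaleR_conv_of_real algebra_simps)
  then have "cnj b - cnj a = of_real u * (cnj c - cnj a)"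
    by (metis complex_cnj_complex_of_real complex_cnj_diff complex_cnj_mult)
  with b show "alignment a b c (cnj a) (cnj b) (cnj c) = 0"
    unfolding alignment_def by simp
  have "(b - a) / (c - a) = of_real u" using u(1) by (simp add: b)
  then show "0 < Re ((b - a) / (c - a))" "Re ((b - a) / (c - a)) < 1" using u by simp_all
qed

lemma open_segment_of_alignment:
  assumes "a \<noteq> c" and al: "alignment a b c (cnj a) (cnj b) (cnj c) = 0"
    and r: "0 < Re ((b - a) / (c - a))" "Re ((b - a) / (c - a)) < 1"
  shows "b \<in> open_segment a c"
proof -
  let ?r = "(b - a) / (c - a)"
  have "cnj ?r = ?r"
    using al assms(1) unfolding alignment_def
    by (simp add: field_simps)
  then have re: "?r = of_real (Re ?r)" by (metis Reals_cnj_iff of_real_Re)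
  have "b - a = of_real (Re ?r) * (c - a)" using assms(1) re by (metis nonzero_eq_divide_eq right_minus_eq)
  then have "b = (1 - Re ?r) *\<^sub>R a + Re ?r *\<^sub>R c"
    by (simp add: scaleR_conv_of_real algebra_simps)
  then show ?thesis using assms(1) r unfolding in_segment by blast
qed

section \<open>Times at which the alignment of the branch points changes\<close>

lemma card_tuples_const: "card (tuples r (\<lambda>_. N)) = N ^ r"
  by (simp add: card_tuples)

context transversal_simple_top
begin

text \<open>
Elimination for the alignment of six independent roots, three of the critical polynomial and three
of its conjugate. The roots are continued by the branches \<open>x\<close> for times in \<open>J\<close>, where continuity is
needed, and enumerated arbitrarily at other real times, which only serve to bound degrees. Outside
the exceptional set the set of vanishing sextuples at nearby times is contained in the one at \<open>\<tau>\<close> by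
continuity, and it is not smaller, so the two agree.
\<close>

lemma special_times_on_edge:
  fixes p q :: complex and x :: "nat \<Rightarrow> real \<Rightarrow> complex" and s s' :: real
  defines "J \<equiv> {s..<s'}"
  assumes "s < s'"
    and line: "\<And>\<tau>. \<tau> \<in> J \<Longrightarrow> \<alpha> \<tau> = p + of_real \<tau> * q"
    and x: "\<And>j. j < \<mu> \<Longrightarrow> continuous_on J (x j)"
    and bij: "\<And>\<tau>. \<tau> \<in> J \<Longrightarrow> bij_betw (\<lambda>j. x j \<tau>) {..<\<mu>} (polar_projection H (\<alpha> \<tau>))"
  obtains E where "E \<subseteq> J" "finite E" "card E \<le> 2 * n ^ 6 * Suc n ^ 5"
    "\<And>\<tau> \<sigma> i j k. \<tau> \<in> J - E \<Longrightarrow> i < \<mu> \<Longrightarrow> j < \<mu> \<Longrightarrow> k < \<mu> \<Longrightarrow>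
       x j \<tau> \<in> open_segment (x i \<tau>) (x k \<tau>) \<Longrightarrow> \<tau> < \<sigma> \<Longrightarrow>
       \<exists>\<sigma>'. \<tau> < \<sigma>' \<and> \<sigma>' < \<sigma> \<and> \<sigma>' < s' \<and> x j \<sigma>' \<in> open_segment (x i \<sigma>') (x k \<sigma>')"
proof -
  define N where "N = n * Suc n"
  obtain \<xi> where \<xi>_img: "\<And>t. (\<lambda>i. \<xi> i t) ` {..<N} = polar_projection H t"
    and \<xi>_sums: "\<And>l. polyfun id (\<lambda>t. \<Sum>i<N. \<xi> i t ^ l)"
    unfolding N_def using polar_projection_roots by blast
  have J: "connected J" "J \<noteq> {}" using \<open>s < s'\<close> unfolding J_def by auto
  have inj: "inj_on (\<lambda>j. x j \<tau>) {..<\<mu>}" and im: "(\<lambda>j. x j \<tau>) ` {..<\<mu>} = polar_projection H (\<alpha> \<tau>)"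
    if "\<tau> \<in> J" for \<tau>
    using bij [OF that] unfolding bij_betw_def by auto
  have "continuous_on J (\<lambda>\<tau>. p + of_real \<tau> * q)" by (intro continuous_intros)
  then have \<alpha>: "continuous_on J \<alpha>" using line by (simp cong: continuous_on_cong)
  obtain \<rho> where \<rho>: "\<rho> ` {..<N} = {..<\<mu>}"
    and \<rho>_sums: "\<And>\<tau> l. \<tau> \<in> J \<Longrightarrow> (\<Sum>i<N. x (\<rho> i) \<tau> ^ l) = (\<Sum>i<N. \<xi> i (\<alpha> \<tau>) ^ l)"
    by (rule continuous_enumeration [OF \<xi>_sums J \<alpha>, of \<mu> x]) (use x inj im \<xi>_img in auto)
  have \<rho>_less: "\<rho> i < \<mu>" if "i < N" for i using \<rho> that by auto

  \<comment> \<open>continuous on \<open>J\<close>, an arbitrary enumeration elsewhere\<close>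
  define y where "y i \<tau> = (if \<tau> \<in> J then x (\<rho> i) \<tau> else \<xi> i (p + of_real \<tau> * q))" for i \<tau>
  have y_sums: "polyfun of_real (\<lambda>\<tau>. \<Sum>i<N. y i \<tau> ^ l)" for l
  proof -
    have "(\<Sum>i<N. y i \<tau> ^ l) = (\<Sum>i<N. \<xi> i (p + of_real \<tau> * q) ^ l)" for \<tau>
      by (cases "\<tau> \<in> J") (simp_all add: y_def \<rho>_sums line)
    moreover have "polyfun of_real (\<lambda>\<tau>::real. \<Sum>i<N. \<xi> i (p + of_real \<tau> * q) ^ l)"
      by (rule polyfun_compose [OF \<xi>_sums]) (intro polyfun_add polyfun_mult polyfun_const polyfun_param)
    ultimately show ?thesis by simp
  qed
  have y_in: "y i \<tau> \<in> polar_projection H (p + of_real \<tau> * q)" if "i < N" for i \<tau>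
  proof (cases "\<tau> \<in> J")
    case True
    then show ?thesis using im [OF True] line [OF True] \<rho>_less [OF that] unfolding y_def by auto
  next
    case False
    then show ?thesis using \<xi>_img [of "p + of_real \<tau> * q"] that unfolding y_def by auto
  qed

  define a where "a v i \<tau> = (if v < 3 then y i \<tau> else cnj (y i \<tau>))" for v :: nat and i \<tau>
  define U where "U = tuples 6 (\<lambda>_. N)"
  define g where "g \<tau> u = alignment (a 0 (u 0) \<tau>) (a 1 (u 1) \<tau>) (a 2 (u 2) \<tau>)
      (a 3 (u 3) \<tau>) (a 4 (u 4) \<tau>) (a 5 (u 5) \<tau>)" for \<tau> and u :: "nat \<Rightarrow> nat"
  have U: "finite U" "card U = N ^ 6" unfolding U_def by (simp_all add: card_tuples_const)
  have u_less: "u v < N" if "u \<in> U" "v < 6" for u v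
    using tuples_less [of u 6 "\<lambda>_. N" v] that unfolding U_def by auto
  have a_sums: "polyfun of_real (\<lambda>\<tau>. \<Sum>i<N. a v i \<tau> ^ l)" for v l
    using y_sums [of l] polyfun_cnj [OF y_sums [of l]] unfolding a_def by (cases "v < 3") auto
  have "tuple_poly of_real 6 (\<lambda>_. N) a g"
    unfolding g_def alignment_def
    by (intro tuple_poly_diff tuple_poly_mult tuple_poly_coord) auto
  then have "polyfun of_real (\<lambda>\<tau>. coeff (\<Prod>u\<in>U. [:1, - g \<tau> u:]) k)" for k
    unfolding U_def by (rule polyfun_tuple_esymm [rotated]) (rule a_sums)
  then obtain P where P: "\<And>k \<tau>. coeff (\<Prod>u\<in>U. [:1, - g \<tau> u:]) k = poly (P k) (of_real \<tau>)"
    unfolding polyfun_def by metis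

  obtain C where C: "C \<ge> 0" "\<And>t z. z \<in> polar_projection H t \<Longrightarrow> norm z ^ Suc n \<le> C * (1 + norm t)"
    using polar_projection_growth by blast
  define C' where "C' = C * (1 + norm p + norm q)"
  have C': "C' \<ge> 0" unfolding C'_def using C(1) by simp
  have degP: "degree (P k) * Suc n \<le> 2 * k" for k
  proof (rule esymm_degree_le [OF U(1) P])
    fix \<tau> :: real assume \<tau>: "\<tau> \<ge> 0"
    \<comment> \<open>bounds all roots, so that the alignments are bounded by \<open>8 * b\<^sup>2\<close>\<close>
    define b where "b = root (Suc n) (C' * (1 + \<tau>))"
    have b: "b \<ge> 0" "b ^ Suc n = C' * (1 + \<tau>)"
      unfolding b_def using C' \<tau> by (simp, intro real_root_pow_pos2) simp_all
    have y_le: "norm (y i \<tau>) \<le> b" if "i < N" for i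
    proof -
      have "norm (y i \<tau>) ^ Suc n \<le> C * (1 + norm (p + of_real \<tau> * q))"
        by (rule C(2) [OF y_in [OF that]])
      also have "\<dots> \<le> C * ((1 + norm p + norm q) * (1 + \<tau>))"
      proof (intro mult_left_mono C(1))
        have "norm (p + of_real \<tau> * q) \<le> norm p + \<tau> * norm q"
          using norm_triangle_ineq [of p "of_real \<tau> * q"] \<tau> by (simp add: norm_mult)
        moreover have "0 \<le> \<tau> + \<tau> * norm p + norm q" using \<tau> by simp
        ultimately show "1 + norm (p + of_real \<tau> * q) \<le> (1 + norm p + norm q) * (1 + \<tau>)"
          by (simp add: algebra_simps)
      qed
      also have "\<dots> = b ^ Suc n" by (simp only: b(2) C'_def mult.assoc)
      finally show ?thesis by (rule power_le_imp_le_base) (rule b(1))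
    qed
    then have a_le: "norm (a v i \<tau>) \<le> b" if "i < N" for v i
      using that unfolding a_def by auto
    have diff: "norm (a v i \<tau> - a v' i' \<tau>) \<le> 2 * b" if "i < N" "i' < N" for v v' i i'
      using norm_triangle_ineq4 [of "a v i \<tau>" "a v' i' \<tau>"] a_le [OF that(1), of v] a_le [OF that(2), of v']
      by linarith
    have "norm (g \<tau> u) \<le> 8 * b ^ 2" if "u \<in> U" for u
    proof -
      have "norm (g \<tau> u) \<le> (2 * b) * (2 * b) + (2 * b) * (2 * b)"
        unfolding g_def alignment_def
        by (rule order_trans [OF norm_triangle_ineq4], unfold norm_mult)
           (intro add_mono mult_mono diff u_less that; simp add: b(1))
      then show ?thesis by (simp add: power2_eq_square)
    qed
    moreover have "(8 * b ^ 2) ^ Suc n = 8 ^ Suc n * (b ^ Suc n) ^ 2"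
      by (simp only: power_mult_distrib power_mult [symmetric] mult.commute)
    then have "(8 * b ^ 2) ^ Suc n \<le> (8 ^ Suc n * C' ^ 2) * (1 + \<tau>) ^ 2"
      unfolding b(2) by (simp only: power_mult_distrib mult.assoc order_refl)
    ultimately show "\<exists>B\<ge>0. B ^ Suc n \<le> (8 ^ Suc n * C' ^ 2) * (1 + \<tau>) ^ 2 \<and> (\<forall>u\<in>U. norm (g \<tau> u) \<le> B)"
      by (intro exI [of _ "8 * b ^ 2"]) auto
  qed
  have degP': "degree (P k) \<le> 2 * n ^ 6 * Suc n ^ 5" if "k \<le> card U" for k
  proof -
    have "degree (P k) * Suc n \<le> 2 * N ^ 6" using degP [of k] that U(2) by linarith
    also have "\<dots> = 2 * n ^ 6 * Suc n ^ 5 * Suc n"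
    proof -
      have "(6::nat) = Suc 5" by simp
      then show ?thesis unfolding N_def
        by (simp only: power_mult_distrib power_Suc2) (simp only: mult_ac)
    qed
    finally show ?thesis by (simp only: mult_le_cancel2)
  qed
  obtain E where E: "E \<subseteq> J" "finite E" "card E \<le> 2 * n ^ 6 * Suc n ^ 5"
    and fewest: "\<And>\<tau> \<sigma>. \<tau> \<in> J - E \<Longrightarrow> \<sigma> \<in> J \<Longrightarrow> card {u \<in> U. g \<tau> u = 0} \<le> card {u \<in> U. g \<sigma> u = 0}"
    using fewest_zeros_off_few_times [OF U(1) J(2) P degP'] by blast

  have "\<exists>\<sigma>'. \<tau> < \<sigma>' \<and> \<sigma>' < \<sigma> \<and> \<sigma>' < s' \<and> x j \<sigma>' \<in> open_segment (x i \<sigma>') (x k \<sigma>')"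
    if \<tau>: "\<tau> \<in> J - E" and ijk: "i < \<mu>" "j < \<mu>" "k < \<mu>"
      and seg: "x j \<tau> \<in> open_segment (x i \<tau>) (x k \<tau>)" and "\<tau> < \<sigma>" for \<tau> \<sigma> i j k
  proof -
    define T where "T = {\<tau><..<min \<sigma> s'}"
    let ?F = "at \<tau> within T"
    have \<tau>J: "\<tau> \<in> J" and "\<tau> < s'" using \<tau> unfolding J_def by auto
    have T: "T \<subseteq> J" using \<tau>J unfolding T_def J_def by auto
    have "?F \<noteq> bot"
    proof -
      have "\<tau> islimpt T"
        unfolding T_def using \<open>\<tau> < \<sigma>\<close> \<open>\<tau> < s'\<close> by (intro islimpt_greaterThanLessThan1) simp
      then show ?thesis by (simp add: trivial_limit_within)
    qed
    have x_lim: "(x l \<longlongrightarrow> x l \<tau>) ?F" if "l < \<mu>" for l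
      using x [OF that] \<tau>J T unfolding continuous_on_def by (blast intro: tendsto_within_subset)
    have y_lim: "(y l \<longlongrightarrow> y l \<tau>) ?F" if "l < N" for l
    proof -
      have "\<forall>\<^sub>F \<sigma> in ?F. x (\<rho> l) \<sigma> = y l \<sigma>"
        unfolding y_def eventually_at_filter using T by (intro always_eventually) auto
      moreover have "(x (\<rho> l) \<longlongrightarrow> y l \<tau>) ?F"
        using x_lim [OF \<rho>_less [OF that]] \<tau>J by (simp add: y_def)
      ultimately show ?thesis by (rule Lim_transform_eventually [rotated])
    qed
    have a_lim: "(a v l \<longlongrightarrow> a v l \<tau>) ?F" if "l < N" for v l
      using y_lim [OF that] tendsto_cnj [OF y_lim [OF that]] unfolding a_def by (cases "v < 3") simp_all
    have g_lim: "((\<lambda>\<sigma>. g \<sigma> u) \<longlongrightarrow> g \<tau> u) ?F" if "u \<in> U" for u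
    proof -
      have "(a v (u v) \<longlongrightarrow> a v (u v) \<tau>) ?F" if "v < 6" for v
        using a_lim u_less \<open>u \<in> U\<close> that by blast
      then show ?thesis unfolding g_def alignment_def by (intro tendsto_diff tendsto_mult) simp_all
    qed
    have in_T: "\<forall>\<^sub>F \<sigma> in ?F. \<sigma> \<in> T" by (simp add: eventually_at_filter)
    have "\<forall>\<^sub>F \<sigma> in ?F. \<forall>u\<in>{u \<in> U. g \<tau> u \<noteq> 0}. g \<sigma> u \<noteq> 0"
      using U(1) by (intro eventually_ball_finite ballI) (auto intro: tendsto_imp_eventually_ne g_lim)
    with in_T have same: "\<forall>\<^sub>F \<sigma> in ?F. {u \<in> U. g \<sigma> u = 0} = {u \<in> U. g \<tau> u = 0}"
    proof eventually_elim
      case (elim \<sigma>)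
      then have "{u \<in> U. g \<sigma> u = 0} \<subseteq> {u \<in> U. g \<tau> u = 0}" by blast
      moreover have "card {u \<in> U. g \<tau> u = 0} \<le> card {u \<in> U. g \<sigma> u = 0}"
        using fewest [OF \<tau>] elim(1) T by blast
      ultimately show ?case using U(1) by (intro card_seteq) auto
    qed
    obtain i' j' k' where ijk': "i' < N" "j' < N" "k' < N" "\<rho> i' = i" "\<rho> j' = j" "\<rho> k' = k"
    proof -
      have "i \<in> \<rho> ` {..<N}" "j \<in> \<rho> ` {..<N}" "k \<in> \<rho> ` {..<N}" using \<rho> ijk by simp_all
      then show ?thesis using that by blast
    qed
    \<comment> \<open>the sextuple of the triple \<open>(i, j, k)\<close> and its conjugates\<close>
    define u where "u = restrict (\<lambda>v. if v = 0 \<or> v = 3 then i' else if v = 1 \<or> v = 4 then j' else k') {..<6::nat}"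
    have u: "u \<in> U" unfolding U_def tuples_def u_def using ijk' by auto
    have g_u: "g \<sigma> u = alignment (x i \<sigma>) (x j \<sigma>) (x k \<sigma>) (cnj (x i \<sigma>)) (cnj (x j \<sigma>)) (cnj (x k \<sigma>))"
      if "\<sigma> \<in> J" for \<sigma>
      using that ijk' unfolding g_def a_def y_def u_def by simp
    have "g \<tau> u = 0" unfolding g_u [OF \<tau>J] by (rule alignment_open_segment [OF seg])
    have ne: "x i \<tau> \<noteq> x k \<tau>" using seg by auto
    have r_lim: "((\<lambda>\<sigma>. Re ((x j \<sigma> - x i \<sigma>) / (x k \<sigma> - x i \<sigma>))) \<longlongrightarrow>
        Re ((x j \<tau> - x i \<tau>) / (x k \<tau> - x i \<tau>))) ?F"
      using ne by (intro tendsto_intros x_lim ijk) simp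
    have "\<forall>\<^sub>F \<sigma> in ?F. 0 < Re ((x j \<sigma> - x i \<sigma>) / (x k \<sigma> - x i \<sigma>))"
      by (rule order_tendstoD [OF r_lim]) (rule alignment_open_segment [OF seg])
    moreover have "\<forall>\<^sub>F \<sigma> in ?F. Re ((x j \<sigma> - x i \<sigma>) / (x k \<sigma> - x i \<sigma>)) < 1"
      by (rule order_tendstoD [OF r_lim]) (rule alignment_open_segment [OF seg])
    ultimately have "\<forall>\<^sub>F \<sigma> in ?F. \<sigma> \<in> T \<and> x j \<sigma> \<in> open_segment (x i \<sigma>) (x k \<sigma>)"
      using in_T same
    proof eventually_elim
      case (elim \<sigma>)
      have "g \<sigma> u = 0" using elim(4) u \<open>g \<tau> u = 0\<close> by blast
      moreover have "x i \<sigma> \<noteq> x k \<sigma>" using elim(1) by auto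
      ultimately show ?case
        using elim T g_u [of \<sigma>] by (auto intro: open_segment_of_alignment)
    qed
    then obtain \<sigma>' where "\<sigma>' \<in> T" "x j \<sigma>' \<in> open_segment (x i \<sigma>') (x k \<sigma>')"
      using eventually_happens' [OF \<open>?F \<noteq> bot\<close>] by blast
    then show ?thesis unfolding T_def by auto
  qed
  then show ?thesis using E that by blast
qed

end

lemma polygonal_edge_affine:
  assumes "a < b" and "\<forall>u\<in>{0..1}. subpath a b \<alpha> u = linepath (\<alpha> a) (\<alpha> b) u"
  obtains p q :: complex where "\<And>\<tau>. \<tau> \<in> {a..<b} \<Longrightarrow> \<alpha> \<tau> = p + of_real \<tau> * q"
proof -
  define q where "q = (\<alpha> b - \<alpha> a) / of_real (b - a)"
  have "\<alpha> \<tau> = (\<alpha> a - of_real a * q) + of_real \<tau> * q" if "\<tau> \<in> {a..<b}" for \<tau>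
  proof -
    define u where "u = (\<tau> - a) / (b - a)"
    have u: "u \<in> {0..1}" "(b - a) * u + a = \<tau>"
      using that \<open>a < b\<close> unfolding u_def by (auto simp: field_simps)
    have "\<alpha> \<tau> = linepath (\<alpha> a) (\<alpha> b) u"
      using assms(2) u unfolding subpath_def by force
    also have "\<dots> = \<alpha> a + of_real u * (\<alpha> b - \<alpha> a)"
      by (simp add: linepath_def scaleR_conv_of_real algebra_simps)
    also have "of_real u * (\<alpha> b - \<alpha> a) = of_real (\<tau> - a) * q"
      unfolding u_def q_def by simp
    finally show ?thesis by (simp add: algebra_simps)
  qed
  then show ?thesis using that by blast
qed

text \<open>
Outside \<open>E\<close>, a branch inside an edge at time \<open>\<tau>\<close> is also inside it at later times arbitrarily close
to \<open>\<tau>\<close>. Since time runs backwards in the construction of the curve, no branch enters an edge at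
such a \<open>\<tau>\<close>.
\<close>

definition alignments_persist :: "(nat \<Rightarrow> real \<Rightarrow> complex) \<Rightarrow> nat \<Rightarrow> real set \<Rightarrow> bool" where
  "alignments_persist x \<mu> E \<longleftrightarrow>
     (\<forall>\<tau>\<in>{0..<1} - E. \<forall>i<\<mu>. \<forall>j<\<mu>. \<forall>k<\<mu>. x j \<tau> \<in> open_segment (x i \<tau>) (x k \<tau>) \<longrightarrow>
        (\<forall>\<sigma>>\<tau>. \<exists>\<sigma>'. \<tau> < \<sigma>' \<and> \<sigma>' < \<sigma> \<and> \<sigma>' < 1 \<and> x j \<sigma>' \<in> open_segment (x i \<sigma>') (x k \<sigma>')))"

context transversal_simple_top
begin

lemma special_times:
  fixes x :: "nat \<Rightarrow> real \<Rightarrow> complex"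
  assumes poly: "polygonal_with_edges \<alpha> m"
    and x: "\<And>j. j < \<mu> \<Longrightarrow> continuous_on {0..<1} (x j)"
    and bij: "\<And>\<tau>. \<tau> \<in> {0..<1} \<Longrightarrow> bij_betw (\<lambda>j. x j \<tau>) {..<\<mu>} (polar_projection H (\<alpha> \<tau>))"
  obtains E where "finite E" "card E \<le> 2 * n ^ 6 * Suc n ^ 5 * m" "alignments_persist x \<mu> E"
proof -
  obtain s where s: "s 0 = 0" "s m = 1" "\<And>l. l < m \<Longrightarrow> s l < s (Suc l)"
    "\<And>l. l < m \<Longrightarrow> \<forall>u\<in>{0..1}. subpath (s l) (s (Suc l)) \<alpha> u = linepath (\<alpha> (s l)) (\<alpha> (s (Suc l))) u"
    using poly unfolding polygonal_with_edges_def by blast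
  have mono: "s l \<le> s l'" if "l \<le> l'" "l' \<le> m" for l l'
    using that
  proof (induction l' rule: dec_induct)
    case (step k)
    then have "s l \<le> s k" "s k < s (Suc k)" using s(3) [of k] by simp_all
    then show ?case by linarith
  qed simp
  have range: "0 \<le> s l" "s l \<le> 1" if "l \<le> m" for l
    using mono [of 0 l] mono [of l m] that s(1,2) by auto
  let ?good = "\<lambda>l E. finite E \<and> card E \<le> 2 * n ^ 6 * Suc n ^ 5 \<and>
    (\<forall>\<tau> \<sigma> i j k. \<tau> \<in> {s l..<s (Suc l)} - E \<longrightarrow> i < \<mu> \<longrightarrow> j < \<mu> \<longrightarrow> k < \<mu> \<longrightarrow>
       x j \<tau> \<in> open_segment (x i \<tau>) (x k \<tau>) \<longrightarrow> \<tau> < \<sigma> \<longrightarrow>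
       (\<exists>\<sigma>'. \<tau> < \<sigma>' \<and> \<sigma>' < \<sigma> \<and> \<sigma>' < s (Suc l) \<and> x j \<sigma>' \<in> open_segment (x i \<sigma>') (x k \<sigma>')))"
  have "\<exists>E. ?good l E" if l: "l < m" for l
  proof -
    have sub: "{s l..<s (Suc l)} \<subseteq> {0..<1}" using range [of l] range [of "Suc l"] l by auto
    obtain p q where pq: "\<And>\<tau>. \<tau> \<in> {s l..<s (Suc l)} \<Longrightarrow> \<alpha> \<tau> = p + of_real \<tau> * q"
      using polygonal_edge_affine [OF s(3,4)] l by blast
    have x': "continuous_on {s l..<s (Suc l)} (x j)" if "j < \<mu>" for j
      using x [OF that] sub by (rule continuous_on_subset)
    have bij': "bij_betw (\<lambda>j. x j \<tau>) {..<\<mu>} (polar_projection H (\<alpha> \<tau>))" if "\<tau> \<in> {s l..<s (Suc l)}" for \<tau>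
      using that sub by (intro bij) blast
    obtain E where "E \<subseteq> {s l..<s (Suc l)}" "finite E" "card E \<le> 2 * n ^ 6 * Suc n ^ 5"
      "\<And>\<tau> \<sigma> i j k. \<tau> \<in> {s l..<s (Suc l)} - E \<Longrightarrow> i < \<mu> \<Longrightarrow> j < \<mu> \<Longrightarrow> k < \<mu> \<Longrightarrow>
       x j \<tau> \<in> open_segment (x i \<tau>) (x k \<tau>) \<Longrightarrow> \<tau> < \<sigma> \<Longrightarrow>
       \<exists>\<sigma>'. \<tau> < \<sigma>' \<and> \<sigma>' < \<sigma> \<and> \<sigma>' < s (Suc l) \<and> x j \<sigma>' \<in> open_segment (x i \<sigma>') (x k \<sigma>')"
      using special_times_on_edge [OF s(3) [OF l] pq x' bij'] by blast
    then have "?good l E" by blast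
    then show ?thesis by blast
  qed
  then obtain E where E: "\<And>l. l < m \<Longrightarrow> ?good l (E l)" by metis
  have "card (\<Union>l<m. E l) \<le> (\<Sum>l<m. card (E l))" by (rule card_UN_le) simp
  also have "\<dots> \<le> (\<Sum>l<m. 2 * n ^ 6 * Suc n ^ 5)" using E by (intro sum_mono) auto
  finally have few: "card (\<Union>l<m. E l) \<le> 2 * n ^ 6 * Suc n ^ 5 * m" by (simp add: mult.commute)
  have fin: "finite (\<Union>l<m. E l)" using E by auto
  have stable: "\<exists>\<sigma>'. \<tau> < \<sigma>' \<and> \<sigma>' < \<sigma> \<and> \<sigma>' < 1 \<and> x j \<sigma>' \<in> open_segment (x i \<sigma>') (x k \<sigma>')"
    if \<tau>: "\<tau> \<in> {0..<1} - (\<Union>l<m. E l)" and ijk: "i < \<mu>" "j < \<mu>" "k < \<mu>"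
      "x j \<tau> \<in> open_segment (x i \<tau>) (x k \<tau>)" "\<tau> < \<sigma>" for \<tau> \<sigma> i j k
  proof -
    \<comment> \<open>the edge of the path that contains \<open>\<alpha> \<tau>\<close>\<close>
    define l where "l = Max {l. l \<le> m \<and> s l \<le> \<tau>}"
    have fin: "finite {l. l \<le> m \<and> s l \<le> \<tau>}" by simp
    have "l \<in> {l. l \<le> m \<and> s l \<le> \<tau>}"
      unfolding l_def using \<tau> s(1) by (intro Max_in fin) auto
    then have l: "l < m" "s l \<le> \<tau>" using \<tau> s(2) by (auto simp: le_less)
    have "\<tau> < s (Suc l)"
    proof (rule ccontr)
      assume "\<not> \<tau> < s (Suc l)"
      then have "Suc l \<le> l" unfolding l_def using l(1) by (intro Max_ge fin) (auto simp: l_def)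
      then show False by simp
    qed
    then have "\<tau> \<in> {s l..<s (Suc l)} - E l" using \<tau> l by auto
    then obtain \<sigma>' where "\<tau> < \<sigma>'" "\<sigma>' < \<sigma>" "\<sigma>' < s (Suc l)" "x j \<sigma>' \<in> open_segment (x i \<sigma>') (x k \<sigma>')"
      using E [OF l(1)] ijk by blast
    moreover have "s (Suc l) \<le> 1" using range(2) [of "Suc l"] l(1) by simp
    ultimately show ?thesis by (intro exI [of _ \<sigma>']) simp
  qed
  have "alignments_persist x \<mu> (\<Union>l<m. E l)"
    unfolding alignments_persist_def by (intro ballI allI impI stable)
  then show ?thesis by (rule that [OF fin few])
qed

end

section \<open>The number of edges of the canonical representative\<close>

definition is_lift where
  "is_lift H t a b g \<longleftrightarrow> continuous_on {0..1} g \<and>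
     (\<forall>s\<in>{0..1}. g s \<in> level_curve H t \<and> fst (g s) = linepath a b s)"

lemma is_lift_of_lifting_family:
  assumes "lifting_family H \<alpha> p q T F" "\<tau> \<in> T"
  shows "is_lift H (\<alpha> \<tau>) (p \<tau>) (q \<tau>) (F \<tau>)"
proof -
  have "continuous_on {0..1} ((\<lambda>(\<tau>, s). F \<tau> s) \<circ> (\<lambda>s. (\<tau>, s)))"
    using assms unfolding lifting_family_def
    by (intro continuous_on_compose continuous_intros) (auto elim: continuous_on_subset)
  then show ?thesis
    using assms unfolding lifting_family_def is_lift_def by (auto simp: o_def)
qed

lemma is_lift_subpath:
  assumes g: "is_lift H t a c g" and u: "0 < u" "u < 1" and b: "b = linepath a c u"
  shows "is_lift H t a b (subpath 0 u g)" "is_lift H t b c (subpath u 1 g)"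
proof -
  have path: "path g" using g unfolding is_lift_def path_def by simp
  have "u * s \<in> {0..1}" "(1 - u) * s + u \<in> {0..1}" if "s \<in> {0..1}" for s
  proof -
    have s: "0 \<le> s" "s \<le> 1" using that by auto
    have "u * s \<le> u * 1" using u s by (intro mult_left_mono) auto
    then have 1: "u * s \<le> 1" using u by linarith
    have "(1 - u) * s \<le> (1 - u) * 1" using u s by (intro mult_left_mono) auto
    then have 2: "(1 - u) * s + u \<le> 1" unfolding mult_1_right by linarith
    have 3: "0 \<le> u * s" "0 \<le> (1 - u) * s + u" using u s by simp_all
    from 1 2 3 show "u * s \<in> {0..1}" "(1 - u) * s + u \<in> {0..1}" by simp_all
  qed
  moreover have "linepath a c (u * s) = linepath a b s" "linepath a c ((1 - u) * s + u) = linepath b c s" for s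
    unfolding b linepath_def by (simp_all add: scaleR_conv_of_real algebra_simps)
  moreover have "path (subpath 0 u g)" "path (subpath u 1 g)" using path u by (auto intro: path_subpath)
  ultimately show "is_lift H t a b (subpath 0 u g)" "is_lift H t b c (subpath u 1 g)"
    using g unfolding is_lift_def path_def subpath_def by auto
qed

definition points_between :: "(nat \<Rightarrow> complex) \<Rightarrow> nat \<Rightarrow> nat \<Rightarrow> nat \<Rightarrow> nat set" where
  "points_between z \<mu> i k = {j. j < \<mu> \<and> z j \<in> open_segment (z i) (z k)}"

lemma finite_points_between [simp]: "finite (points_between z \<mu> i k)"
  unfolding points_between_def by simp

lemma card_points_between_less:
  assumes "i < \<mu>"
  shows "Suc (card (points_between z \<mu> i k)) \<le> \<mu>"
proof -
  have "points_between z \<mu> i k \<subseteq> {..<\<mu>} - {i}"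
    unfolding points_between_def by (auto simp: open_segment_def)
  then have "card (points_between z \<mu> i k) \<le> card ({..<\<mu>} - {i})" by (intro card_mono) auto
  then show ?thesis using assms by simp
qed

lemma card_points_between_split:
  assumes "j < \<mu>" "z j \<in> open_segment (z i) (z k)"
  shows "Suc (card (points_between z \<mu> i j)) + Suc (card (points_between z \<mu> j k))
    \<le> Suc (card (points_between z \<mu> i k))"
proof -
  let ?A = "points_between z \<mu> i j" and ?B = "points_between z \<mu> j k"
  have un: "open_segment (z i) (z j) \<union> {z j} \<union> open_segment (z j) (z k) = open_segment (z i) (z k)"
    by (rule Un_open_segment [OF assms(2)])
  have "closed_segment (z i) (z j) \<inter> closed_segment (z j) (z k) = {z j}"
    using assms(2) by (intro Int_closed_segment) (simp add: open_segment_def)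
  then have "open_segment (z i) (z j) \<inter> open_segment (z j) (z k) = {}"
    unfolding open_segment_def by auto
  then have disj: "?A \<inter> ?B = {}" unfolding points_between_def by auto
  have "j \<notin> ?A \<union> ?B" unfolding points_between_def by (auto simp: open_segment_def)
  then have "card (insert j (?A \<union> ?B)) = Suc (card ?A + card ?B)"
    by (simp add: card_Un_disjoint disj)
  moreover have "insert j (?A \<union> ?B) \<subseteq> points_between z \<mu> i k"
    using assms un unfolding points_between_def by auto
  then have "card (insert j (?A \<union> ?B)) \<le> card (points_between z \<mu> i k)"
    by (rule card_mono [rotated]) simp
  ultimately show ?thesis by simp
qed

text \<open>
The number of pairs that remain once every edge has been subdivided at all the branch points it
contains. Subdividing does not increase it, which makes it a better measure than the number of pairs.
\<close>

definition pieces :: "(nat \<Rightarrow> complex) \<Rightarrow> nat \<Rightarrow> arc_pair list \<Rightarrow> nat" where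
  "pieces z \<mu> es = (\<Sum>e\<leftarrow>es. Suc (card (points_between z \<mu> (fst e) (fst (snd e)))))"

definition valid_pairs ::
    "complex poly poly \<Rightarrow> complex \<Rightarrow> (nat \<Rightarrow> complex) \<Rightarrow> nat \<Rightarrow> arc_pair list \<Rightarrow> bool" where
  "valid_pairs H t z \<mu> es \<longleftrightarrow> es \<noteq> [] \<and>
     (\<forall>(i, k, g, g')\<in>set es. i < \<mu> \<and> k < \<mu> \<and> i \<noteq> k \<and>
        is_lift H t (z i) (z k) g \<and> is_lift H t (z i) (z k) g')"

lemma length_le_pieces: "length es \<le> pieces z \<mu> es"
  unfolding pieces_def by (induction es) auto

lemma pieces_le:
  assumes "\<And>i k g g'. (i, k, g, g') \<in> set es \<Longrightarrow> Suc (card (points_between z \<mu> i k)) \<le> c"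
  shows "pieces z \<mu> es \<le> c * length es"
  using assms unfolding pieces_def
proof (induction es)
  case (Cons e es)
  obtain i k g g' where e: "e = (i, k, g, g')" by (cases e)
  have "Suc (card (points_between z \<mu> i k)) \<le> c" using Cons.prems e by auto
  moreover have "(\<Sum>e\<leftarrow>es. Suc (card (points_between z \<mu> (fst e) (fst (snd e))))) \<le> c * length es"
    by (rule Cons.IH) (use Cons.prems in auto)
  ultimately show ?case using e by simp
qed simp

text \<open>
Before a move all edges are free of branch points. If the move ends outside \<open>E\<close>, they remain free, and
the number of pieces is the number of pairs; if it ends at a time of \<open>E\<close>, each edge contributes at
most \<open>\<mu>\<close> pieces.
\<close>

lemma continued_curve_pieces:
  fixes H :: "complex poly poly" and x :: "nat \<Rightarrow> real \<Rightarrow> complex"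
  defines "\<mu> \<equiv> generic_card H"
  assumes branches: "critical_branches H \<alpha> x" and E: "finite E"
    and persist: "alignments_persist x \<mu> E"
    and "continued_curve H \<alpha> x A \<tau> es"
  shows "0 \<le> \<tau> \<and> \<tau> < 1 \<and> valid_pairs H (\<alpha> \<tau>) (\<lambda>j. x j \<tau>) \<mu> es \<and>
    pieces (\<lambda>j. x j \<tau>) \<mu> es \<le> \<mu> ^ card (E \<inter> {\<tau>..})"
  using assms(5)
proof (induction rule: continued_curve.induct)
  have img: "(\<lambda>j. x j \<tau>) ` {..<\<mu>} = proj_critical_values H (\<alpha> \<tau>)" and inj: "inj_on (\<lambda>j. x j \<tau>) {..<\<mu>}"
    if "\<tau> \<in> {0..<1}" for \<tau>
    using branches that unfolding critical_branches_def bij_betw_def \<mu>_def by auto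
  have no_points: "points_between (\<lambda>j. x j \<tau>) \<mu> i k = {}"
    if "edges_unobstructed H \<alpha> x T M" "(i, k, F, F') \<in> set M" "{\<tau><..<\<tau>'} \<subseteq> T" "i < \<mu>" "k < \<mu>"
      "0 \<le> \<tau>" "\<tau> < \<tau>'" "\<tau>' \<le> 1" "\<tau> \<notin> E" for \<tau> \<tau>' i k F F' T M
  proof (rule ccontr)
    assume "points_between (\<lambda>j. x j \<tau>) \<mu> i k \<noteq> {}"
    then obtain j where j: "j < \<mu>" "x j \<tau> \<in> open_segment (x i \<tau>) (x k \<tau>)"
      unfolding points_between_def by auto
    have "\<tau> \<in> {0..<1} - E" using that by auto
    then obtain \<sigma> where \<sigma>: "\<tau> < \<sigma>" "\<sigma> < \<tau>'" "x j \<sigma> \<in> open_segment (x i \<sigma>) (x k \<sigma>)"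
      using persist j \<open>i < \<mu>\<close> \<open>k < \<mu>\<close> \<open>\<tau> < \<tau>'\<close> unfolding alignments_persist_def by blast
    have "x j \<sigma> \<in> proj_critical_values H (\<alpha> \<sigma>)" using img [of \<sigma>] j(1) \<sigma> that by auto
    moreover have "open_segment (x i \<sigma>) (x k \<sigma>) \<inter> proj_critical_values H (\<alpha> \<sigma>) = {}"
      using that(1,2,3) \<sigma> unfolding edges_unobstructed_def by fastforce
    ultimately show False using \<sigma>(3) by blast
  qed
  {
    case (start \<tau> M i k F F')
    have i: "i < \<mu>" "k < \<mu>" using start unfolding \<mu>_def by auto
    have "lifting_family H \<alpha> (x i) (x k) {\<tau>..<1} F" "lifting_family H \<alpha> (x i) (x k) {\<tau>..<1} F'"
      using start unfolding closed_curve_family_def by auto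
    then have "is_lift H (\<alpha> \<tau>) (x i \<tau>) (x k \<tau>) (F \<tau>)" "is_lift H (\<alpha> \<tau>) (x i \<tau>) (x k \<tau>) (F' \<tau>)"
      using start by (auto intro: is_lift_of_lifting_family)
    then have "valid_pairs H (\<alpha> \<tau>) (\<lambda>j. x j \<tau>) \<mu> (at_time \<tau> M)"
      using start i unfolding valid_pairs_def at_time_def by auto
    moreover have "pieces (\<lambda>j. x j \<tau>) \<mu> (at_time \<tau> M) \<le> \<mu> ^ card (E \<inter> {\<tau>..})"
    proof (cases "\<tau> \<in> E")
      case True
      then have "card (E \<inter> {\<tau>..}) \<noteq> 0" using E by auto
      then have "\<mu> ^ 1 \<le> \<mu> ^ card (E \<inter> {\<tau>..})" using i by (intro power_increasing) auto
      then show ?thesis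
        using card_points_between_less [OF i(1), of "\<lambda>j. x j \<tau>" k] start
        by (simp add: pieces_def at_time_def)
    next
      case False
      have "points_between (\<lambda>j. x j \<tau>) \<mu> i k = {}"
        by (rule no_points [of "{\<tau><..<1}" M i k F F' \<tau> 1]) (use start i False in auto)
      moreover have "1 \<le> \<mu> ^ card (E \<inter> {\<tau>..})" using i by (intro one_le_power) auto
      ultimately show ?thesis using start by (simp add: pieces_def at_time_def)
    qed
    ultimately show ?case using start by blast
  next
    case (move \<tau>' M \<tau>)
    have \<tau>': "\<tau>' < 1" and valid: "valid_pairs H (\<alpha> \<tau>') (\<lambda>j. x j \<tau>') \<mu> (at_time \<tau>' M)"
      and few: "pieces (\<lambda>j. x j \<tau>') \<mu> (at_time \<tau>' M) \<le> \<mu> ^ card (E \<inter> {\<tau>'..})"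
      using move.IH by auto
    have idx: "i < \<mu>" "k < \<mu>" "i \<noteq> k" if "(i, k, F, F') \<in> set M" for i k F F'
    proof -
      have "(i, k, F \<tau>', F' \<tau>') \<in> set (at_time \<tau>' M)" unfolding at_time_def using that by force
      then show "i < \<mu>" "k < \<mu>" "i \<noteq> k" using valid unfolding valid_pairs_def by auto
    qed
    have lifts: "is_lift H (\<alpha> \<tau>) (x i \<tau>) (x k \<tau>) (F \<tau>)" "is_lift H (\<alpha> \<tau>) (x i \<tau>) (x k \<tau>) (F' \<tau>)"
      if "(i, k, F, F') \<in> set M" for i k F F'
    proof -
      have "lifting_family H \<alpha> (x i) (x k) {\<tau>..\<tau>'} F" "lifting_family H \<alpha> (x i) (x k) {\<tau>..\<tau>'} F'"
        using move that unfolding closed_curve_family_def by auto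
      then show "is_lift H (\<alpha> \<tau>) (x i \<tau>) (x k \<tau>) (F \<tau>)" "is_lift H (\<alpha> \<tau>) (x i \<tau>) (x k \<tau>) (F' \<tau>)"
        using move by (auto intro: is_lift_of_lifting_family)
    qed
    have "M \<noteq> []" using valid unfolding valid_pairs_def at_time_def by auto
    then have "valid_pairs H (\<alpha> \<tau>) (\<lambda>j. x j \<tau>) \<mu> (at_time \<tau> M)"
      using idx lifts unfolding valid_pairs_def at_time_def by fastforce
    moreover have "pieces (\<lambda>j. x j \<tau>) \<mu> (at_time \<tau> M) \<le> \<mu> ^ card (E \<inter> {\<tau>..})"
    proof -
      have len: "length M \<le> \<mu> ^ card (E \<inter> {\<tau>'..})"
        using length_le_pieces [of "at_time \<tau>' M" "\<lambda>j. x j \<tau>'" \<mu>] few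
        unfolding at_time_def by simp
      have pairs: "\<exists>F F'. (i, k, F, F') \<in> set M" if "(i, k, g, g') \<in> set (at_time \<tau> M)" for i k g g'
        using that unfolding at_time_def by auto
      have "\<mu> > 0" using idx \<open>M \<noteq> []\<close> by (metis gr_zeroI list.set_intros(1) neq_Nil_conv not_less_zero prod_cases4)
      show ?thesis
      proof (cases "\<tau> \<in> E")
        case True
        have "pieces (\<lambda>j. x j \<tau>) \<mu> (at_time \<tau> M) \<le> \<mu> * length (at_time \<tau> M)"
          by (rule pieces_le) (use pairs idx card_points_between_less in blast)
        also have "\<dots> \<le> \<mu> * \<mu> ^ card (E \<inter> {\<tau>'..})"
          using len unfolding at_time_def by simp
        also have "\<dots> = \<mu> ^ card (insert \<tau> (E \<inter> {\<tau>'..}))" using E move by simp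
        also have "\<dots> \<le> \<mu> ^ card (E \<inter> {\<tau>..})"
          using E move True \<open>\<mu> > 0\<close> by (intro power_increasing card_mono) auto
        finally show ?thesis .
      next
        case False
        have "pieces (\<lambda>j. x j \<tau>) \<mu> (at_time \<tau> M) \<le> 1 * length (at_time \<tau> M)"
        proof (rule pieces_le)
          fix i k g g' assume "(i, k, g, g') \<in> set (at_time \<tau> M)"
          then obtain F F' where M: "(i, k, F, F') \<in> set M" using pairs by blast
          have "points_between (\<lambda>j. x j \<tau>) \<mu> i k = {}"
            by (rule no_points [of "{\<tau><..\<tau>'}" M i k F F' \<tau> \<tau>'])
               (use move M idx [OF M] \<tau>' False in auto)
          then show "Suc (card (points_between (\<lambda>j. x j \<tau>) \<mu> i k)) \<le> 1" by simp
        qed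
        also have "\<dots> \<le> \<mu> ^ card (E \<inter> {\<tau>'..})" using len unfolding at_time_def by simp
        also have "\<dots> \<le> \<mu> ^ card (E \<inter> {\<tau>..})"
          using E move \<open>\<mu> > 0\<close> by (intro power_increasing card_mono) auto
        finally show ?thesis .
      qed
    qed
    ultimately show ?case using move \<tau>' by auto
  next
    case (split \<tau> es i k g g' es' j u)
    have \<tau>: "\<tau> \<in> {0..<1}" and valid: "valid_pairs H (\<alpha> \<tau>) (\<lambda>j. x j \<tau>) \<mu> (es @ [(i, k, g, g')] @ es')"
      using split.IH by auto
    have ik: "i < \<mu>" "k < \<mu>" "i \<noteq> k" "j < \<mu>"
      and lifts: "is_lift H (\<alpha> \<tau>) (x i \<tau>) (x k \<tau>) g" "is_lift H (\<alpha> \<tau>) (x i \<tau>) (x k \<tau>) g'"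
      using valid split unfolding valid_pairs_def \<mu>_def by auto
    have "x i \<tau> \<noteq> x k \<tau>" using inj [OF \<tau>] ik unfolding inj_on_def by auto
    then have seg: "x j \<tau> \<in> open_segment (x i \<tau>) (x k \<tau>)"
      using split unfolding in_segment linepath_def by auto
    then have "j \<noteq> i" "j \<noteq> k" by (auto simp: open_segment_def)
    then have "valid_pairs H (\<alpha> \<tau>) (\<lambda>j. x j \<tau>) \<mu>
        (es @ [(i, j, subpath 0 u g, subpath 0 u g'), (j, k, subpath u 1 g, subpath u 1 g')] @ es')"
      using valid ik lifts is_lift_subpath [OF _ \<open>0 < u\<close> \<open>u < 1\<close>] split
      unfolding valid_pairs_def by auto
    moreover have "pieces (\<lambda>j. x j \<tau>) \<mu>
        (es @ [(i, j, subpath 0 u g, subpath 0 u g'), (j, k, subpath u 1 g, subpath u 1 g')] @ es') \<le>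
        pieces (\<lambda>j. x j \<tau>) \<mu> (es @ [(i, k, g, g')] @ es')"
      using card_points_between_split [of j \<mu> "\<lambda>j. x j \<tau>", OF ik(4) seg] by (simp add: pieces_def)
    ultimately show ?case using split.IH by auto
  }
qed

section \<open>Variation of a lifting\<close>

text \<open>
By the intermediate value theorem every increment that passes the level \<open>c\<close> contains a crossing in
its interior, and these interiors are disjoint.
\<close>

lemma card_increments_across_level:
  fixes v :: "real \<Rightarrow> real"
  assumes cont: "continuous_on {0..1} v" and ts: "sorted ts" "set ts \<subseteq> {0..1}"
    and fin: "finite {s \<in> {0..1}. v s = c}"
  shows "card {k. Suc k < length ts \<and>
      c \<in> {min (v (ts ! k)) (v (ts ! Suc k))<..<max (v (ts ! k)) (v (ts ! Suc k))}}
    \<le> card {s \<in> {0..1}. v s = c}" (is "card ?K \<le> card ?S")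
proof -
  have "\<forall>k\<in>?K. \<exists>s. ts ! k < s \<and> s < ts ! Suc k \<and> v s = c"
  proof
    fix k assume k: "k \<in> ?K"
    have le: "ts ! k \<le> ts ! Suc k" using k ts(1) by (intro sorted_nth_mono) auto
    have "ts ! k \<in> set ts" "ts ! Suc k \<in> set ts" using k by simp_all
    then have in01: "ts ! k \<in> {0..1}" "ts ! Suc k \<in> {0..1}" using ts(2) by blast+
    have cont': "continuous_on {ts ! k..ts ! Suc k} v"
      using in01 by (intro continuous_on_subset [OF cont]) auto
    have "\<exists>s\<ge>ts ! k. s \<le> ts ! Suc k \<and> v s = c"
    proof (cases "v (ts ! k) \<le> c")
      case True
      then show ?thesis using k by (intro IVT' [OF _ _ le cont']) auto
    next
      case False
      then show ?thesis using k by (intro IVT2' [OF _ _ le cont']) auto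
    qed
    then obtain s where s: "ts ! k \<le> s" "s \<le> ts ! Suc k" "v s = c" by blast
    have "v (ts ! k) \<noteq> c" "v (ts ! Suc k) \<noteq> c" using k by (auto simp: min_def max_def split: if_splits)
    then have "s \<noteq> ts ! k" "s \<noteq> ts ! Suc k" using s(3) by auto
    then have "ts ! k < s" "s < ts ! Suc k" using s(1,2) by linarith+
    then show "\<exists>s. ts ! k < s \<and> s < ts ! Suc k \<and> v s = c" using s(3) by blast
  qed
  from bchoice [OF this] obtain r where r: "\<And>k. k \<in> ?K \<Longrightarrow> ts ! k < r k \<and> r k < ts ! Suc k \<and> v (r k) = c"
    by blast
  have less: "r k < r l" if "k \<in> ?K" "l \<in> ?K" "k < l" for k l
  proof -
    have "ts ! Suc k \<le> ts ! l" using that ts(1) by (intro sorted_nth_mono) auto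
    then show ?thesis using r [OF that(1)] r [OF that(2)] by linarith
  qed
  have "inj_on r ?K"
  proof (rule inj_onI)
    fix k l assume kl: "k \<in> ?K" "l \<in> ?K" "r k = r l"
    show "k = l"
    proof (rule ccontr)
      assume "k \<noteq> l"
      then consider "k < l" | "l < k" by linarith
      then show False using less [OF kl(1,2)] less [OF kl(2,1)] kl(3) by cases simp_all
    qed
  qed
  moreover have "r ` ?K \<subseteq> ?S"
  proof (rule image_subsetI)
    fix k assume k: "k \<in> ?K"
    then have "ts ! k \<in> set ts" "ts ! Suc k \<in> set ts" by simp_all
    then have "ts ! k \<in> {0..1}" "ts ! Suc k \<in> {0..1}" using ts(2) by blast+
    then show "r k \<in> ?S" using r [OF k] by auto
  qed
  ultimately show ?thesis using fin by (intro card_inj_on_le)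
qed

text \<open>
The Banach indicatrix: each increment is the measure of the set of levels it passes, so the variation
is the integral over \<open>c\<close> of the number of increments across \<open>c\<close>.
\<close>

lemma variation_le_of_crossings:
  fixes v :: "real \<Rightarrow> real"
  assumes cont: "continuous_on {0..1} v" and Y: "\<And>s. s \<in> {0..1} \<Longrightarrow> \<bar>v s\<bar> \<le> Y" "Y \<ge> 0"
    and F: "finite F"
    and cross: "\<And>c. c \<notin> F \<Longrightarrow> finite {s \<in> {0..1}. v s = c} \<and> card {s \<in> {0..1}. v s = c} \<le> B"
    and ts: "sorted ts" "set ts \<subseteq> {0..1}"
  shows "(\<Sum>k<length ts - 1. \<bar>v (ts ! Suc k) - v (ts ! k)\<bar>) \<le> 2 * Y * B"
proof -
  define lo where "lo k = min (v (ts ! k)) (v (ts ! Suc k))" for k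
  define hi where "hi k = max (v (ts ! k)) (v (ts ! Suc k))" for k
  have lohi: "lo k \<le> hi k" for k unfolding lo_def hi_def by simp
  have "(\<Sum>k<length ts - 1. \<bar>v (ts ! Suc k) - v (ts ! k)\<bar>) =
      (\<Sum>k<length ts - 1. LINT c|lborel. indicator {lo k<..<hi k} c)"
    by (intro sum.cong refl) (auto simp: lo_def hi_def measure_def min_def max_def)
  also have "\<dots> = (LINT c|lborel. (\<Sum>k<length ts - 1. indicator {lo k<..<hi k} c))"
    by (intro Bochner_Integration.integral_sum [symmetric]) (simp add: lohi)
  also have "\<dots> \<le> (LINT c|lborel. real B * indicator {-Y..Y} c)"
  proof (rule integral_mono_AE)
    show "integrable lborel (\<lambda>c. \<Sum>k<length ts - 1. indicator {lo k<..<hi k} c :: real)"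
      by (intro Bochner_Integration.integrable_sum) (simp add: lohi)
    have "integrable lborel (indicator {-Y..Y} :: real \<Rightarrow> real)"
      by (rule integrable_real_indicator) (simp_all add: Y(2))
    then show "integrable lborel (\<lambda>c. real B * indicator {-Y..Y} c)"
      by (rule integrable_mult_right)
    have "AE c in lborel. c \<notin> F"
      by (rule AE_not_in) (rule finite_imp_null_set_lborel [OF F])
    then show "AE c in lborel. (\<Sum>k<length ts - 1. indicator {lo k<..<hi k} c) \<le> real B * indicator {-Y..Y} c"
    proof eventually_elim
      case (elim c)
      let ?K = "{k. Suc k < length ts \<and> c \<in> {lo k<..<hi k}}"
      have "(\<Sum>k<length ts - 1. indicator {lo k<..<hi k} c :: real) =
          (\<Sum>k\<in>{..<length ts - 1}. if c \<in> {lo k<..<hi k} then 1 else 0)"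
        by (intro sum.cong refl) (simp add: indicator_def)
      also have "\<dots> = real (card {k\<in>{..<length ts - 1}. c \<in> {lo k<..<hi k}})"
        by (subst sum.inter_filter [symmetric]) simp_all
      also have "{k\<in>{..<length ts - 1}. c \<in> {lo k<..<hi k}} = ?K" by auto
      finally have eq: "(\<Sum>k<length ts - 1. indicator {lo k<..<hi k} c :: real) = real (card ?K)" .
      show ?case
      proof (cases "c \<in> {-Y..Y}")
        case True
        have "card ?K \<le> card {s \<in> {0..1}. v s = c}"
          unfolding lo_def hi_def
          by (rule card_increments_across_level [OF cont ts]) (use cross [OF elim] in blast)
        also have "\<dots> \<le> B" using cross [OF elim] by blast
        finally show ?thesis using eq True by simp
      next
        case False
        have "?K = {}"
        proof (rule ccontr)
          assume "?K \<noteq> {}"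
          then obtain k where k: "Suc k < length ts" "lo k < c" "c < hi k" by auto
          then have "ts ! k \<in> set ts" "ts ! Suc k \<in> set ts" by simp_all
    then have "ts ! k \<in> {0..1}" "ts ! Suc k \<in> {0..1}" using ts(2) by blast+
          then have "\<bar>v (ts ! k)\<bar> \<le> Y" "\<bar>v (ts ! Suc k)\<bar> \<le> Y" using Y(1) by blast+
          then show False using k False unfolding lo_def hi_def by (auto simp: min_def max_def split: if_splits)
        qed
        then show ?thesis using eq False by simp
      qed
    qed
  qed
  also have "\<dots> = 2 * Y * B" using Y(2) by simp
  finally show ?thesis .
qed

context transversal_simple_top
begin

text \<open>
The cases \<open>\<omega> = 1\<close> and \<open>\<omega> = - \<i>\<close> give the real and the imaginary part of \<open>y\<close>. At a crossing the value
\<open>\<omega> * y + cnj (\<omega> * y') - 2 * c\<close> vanishes for the pair of roots \<open>y = y'\<close>. The product of these values over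
all pairs of roots is a polynomial in \<open>s\<close> of degree at most \<open>(n + 1)\<^sup>2\<close>, and it is nonzero at \<open>s = 0\<close>
unless \<open>c\<close> belongs to a finite set.
\<close>

lemma level_arc_crossings:
  assumes lift: "is_lift H t a b g"
  obtains F where "finite F"
    "\<And>c. c \<notin> F \<Longrightarrow> finite {s \<in> {0..1}. Re (\<omega> * snd (g s)) = c} \<and>
       card {s \<in> {0..1}. Re (\<omega> * snd (g s)) = c} \<le> Suc n ^ 2"
proof -
  define x where "x s = a + of_real s * (b - a)" for s :: real
  define P where "P s = slice H (x s) - [:t:]" for s
  have deg_P: "degree (P s) = Suc n" for s
    unfolding P_def by (subst diff_conv_add_uminus, subst degree_add_eq_left) (simp_all add: degree_slice)
  have lead_P: "coeff (P s) (Suc n) = lead" for s unfolding P_def by (simp add: coeff_lead)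
  have x_poly: "polyfun of_real x"
    unfolding x_def by (intro polyfun_add polyfun_mult polyfun_const polyfun_param)
  have "polyfun of_real (\<lambda>s. poly (coeff H k) (x s))" for k
    using x_poly by (rule polyfun_compose [rotated]) (auto simp: polyfun_def)
  then have coeffs: "polyfun of_real (\<lambda>s. coeff (P s) k)" for k
    unfolding P_def coeff_diff coeff_slice by (intro polyfun_diff polyfun_const)
  obtain y where y: "\<And>s. P s = smult lead (\<Prod>i<Suc n. [:- y i s, 1:])"
    and y_sums: "\<And>l. polyfun of_real (\<lambda>s. \<Sum>i<Suc n. y i s ^ l)"
    using roots_enumeration [OF deg_P lead_P lead_nonzero coeffs] by blast
  have roots: "eval2 H (x s, z) = t \<longleftrightarrow> (\<exists>i<Suc n. z = y i s)" for s z
  proof -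
    have "eval2 H (x s, z) = t \<longleftrightarrow> poly (P s) z = 0" by (simp add: P_def eval2_slice)
    also have "\<dots> \<longleftrightarrow> (\<exists>i\<in>{..<Suc n}. z - y i s = 0)"
      using lead_nonzero unfolding y by (simp add: poly_prod prod_zero_iff del: lessThan_Suc prod.lessThan_Suc)
    finally show ?thesis by auto
  qed

  define A where "A v i s = (if v = 0 then y i s else cnj (y i s))" for v :: nat and i s
  define U where "U = tuples 2 (\<lambda>_. Suc n)"
  define f where "f s u = \<omega> * A 0 (u 0) s + cnj \<omega> * A 1 (u 1) s" for s and u :: "nat \<Rightarrow> nat"
  have U: "finite U" "card U = Suc n ^ 2" unfolding U_def by (simp_all add: card_tuples_const)
  have u_less: "u 0 < Suc n" "u 1 < Suc n" if "u \<in> U" for u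
    using tuples_less [of u 2 "\<lambda>_. Suc n"] that unfolding U_def by auto
  have A_sums: "polyfun of_real (\<lambda>s. \<Sum>i<Suc n. A v i s ^ l)" for v l
    using y_sums [of l] polyfun_cnj [OF y_sums [of l]] unfolding A_def by (cases "v = 0") simp_all

  \<comment> \<open>the levels for which the eliminant vanishes at \<open>s = 0\<close>\<close>
  define F where "F = (\<lambda>u. Re (f 0 u) / 2) ` U"
  have "finite {s \<in> {0..1}. Re (\<omega> * snd (g s)) = c} \<and> card {s \<in> {0..1}. Re (\<omega> * snd (g s)) = c} \<le> Suc n ^ 2"
    if c: "c \<notin> F" for c
  proof -
    define h where "h s u = f s u - of_real (2 * c)" for s u
    have "tuple_poly of_real 2 (\<lambda>_. Suc n) A h"
      unfolding h_def f_def
      by (intro tuple_poly_diff tuple_poly_add tuple_poly_mult tuple_poly_const tuple_poly_coord) auto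
    then have "polyfun of_real (\<lambda>s. coeff (\<Prod>u\<in>U. [:1, - h s u:]) (Suc n ^ 2))"
      unfolding U_def by (rule polyfun_tuple_esymm [rotated]) (rule A_sums)
    then obtain p where p: "\<And>s. coeff (\<Prod>u\<in>U. [:1, - h s u:]) (Suc n ^ 2) = poly p (of_real s)"
      unfolding polyfun_def by blast
    have deg_p: "degree p \<le> Suc n ^ 2"
    proof -
      define K where "K = 1 + Suc n * (coeff_norm_sum + norm t) / norm lead"
      have K: "K \<ge> 0" unfolding K_def using coeff_norm_sum_nonneg by simp
      define C where "C = 2 * (norm \<omega> * (K * (1 + norm a + norm (b - a)))) + \<bar>2 * c\<bar>"
      have "degree p * 1 \<le> 1 * Suc n ^ 2"
      proof (rule esymm_degree_le [OF U(1) p])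
        fix s :: real assume s: "s \<ge> 0"
        have y_le: "norm (A v i s) \<le> K * (1 + norm a + norm (b - a)) * (1 + s)" if "i < Suc n" for v i
        proof -
          have "norm (A v i s) = norm (y i s)" by (simp add: A_def)
          also have "\<dots> \<le> K * (1 + norm (x s))"
            unfolding K_def by (rule norm_level_root_le) (use roots that in blast)
          also have "\<dots> \<le> K * ((1 + norm a + norm (b - a)) * (1 + s))"
          proof (intro mult_left_mono K)
            have "norm (x s) \<le> norm a + s * norm (b - a)"
              using norm_triangle_ineq [of a "of_real s * (b - a)"] s by (simp add: x_def norm_mult)
            moreover have "0 \<le> s + s * norm a + norm (b - a)" using s by simp
            ultimately show "1 + norm (x s) \<le> (1 + norm a + norm (b - a)) * (1 + s)"
              by (simp add: algebra_simps)
          qed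
          finally show ?thesis by (simp add: mult.assoc)
        qed
        have "norm (h s u) \<le> C * (1 + s)" if u: "u \<in> U" for u
        proof -
          let ?b = "norm \<omega> * (K * (1 + norm a + norm (b - a)) * (1 + s))"
          have "norm (\<omega> * A 0 (u 0) s) \<le> ?b" "norm (cnj \<omega> * A 1 (u 1) s) \<le> ?b"
            unfolding norm_mult complex_mod_cnj by (intro mult_left_mono y_le u_less u; simp)+
          then have "norm (f s u) \<le> ?b + ?b"
            unfolding f_def by (intro norm_triangle_le) linarith
          then have "norm (h s u) \<le> ?b + ?b + \<bar>2 * c\<bar>"
            unfolding h_def by (intro order_trans [OF norm_triangle_ineq4]) (simp add: norm_of_real del: of_real_mult)
          also have "\<dots> \<le> ?b + ?b + \<bar>2 * c\<bar> * (1 + s)"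
            using s by (simp add: mult_le_cancel_left1 distrib_left)
          also have "\<dots> = C * (1 + s)" unfolding C_def by (simp add: algebra_simps)
          finally show ?thesis .
        qed
        moreover have "C * (1 + s) \<ge> 0" using s K unfolding C_def by simp
        ultimately show "\<exists>B\<ge>0. B ^ 1 \<le> C * (1 + s) ^ 1 \<and> (\<forall>u\<in>U. norm (h s u) \<le> B)"
          by (intro exI [of _ "C * (1 + s)"]) auto
      qed
      then show ?thesis by simp
    qed
    have degree_h: "degree (\<Prod>u\<in>U. [:1, - h s u:]) = card {u \<in> U. h s u \<noteq> 0}" for s
      by (rule degree_prod_reciprocal_linear [OF U(1)])
    have "p \<noteq> 0"
    proof
      assume "p = 0"
      have "h 0 u \<noteq> 0" if "u \<in> U" for u
      proof
        assume "h 0 u = 0"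
        then have "c = Re (f 0 u) / 2" unfolding h_def by (simp add: complex_eq_iff)
        then show False using c that unfolding F_def by blast
      qed
      then have "{u \<in> U. h 0 u \<noteq> 0} = U" by auto
      then have "lead_coeff (\<Prod>u\<in>U. [:1, - h 0 u:]) = 0"
        by (simp only: degree_h U(2) p \<open>p = 0\<close> poly_0)
      then show False using U(1) by (auto simp: prod_zero_iff)
    qed
    have sub: "{s \<in> {0..1}. Re (\<omega> * snd (g s)) = c} \<subseteq> {s. poly p (of_real s) = 0}"
    proof
      fix s assume s: "s \<in> {s \<in> {0..1}. Re (\<omega> * snd (g s)) = c}"
      have "g s \<in> level_curve H t" "fst (g s) = linepath a b s"
        using lift s unfolding is_lift_def by auto
      moreover have "linepath a b s = x s"
        unfolding x_def linepath_def by (simp add: scaleR_conv_of_real algebra_simps)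
      ultimately have "eval2 H (x s, snd (g s)) = t"
        unfolding level_curve_def by (metis (mono_tags) mem_Collect_eq prod.collapse)
      then obtain i where i: "i < Suc n" "snd (g s) = y i s" using roots by blast
      define u where "u = restrict (\<lambda>_. i) {..<2::nat}"
      have u: "u \<in> U" unfolding U_def tuples_def u_def using i(1) by auto
      have "f s u = \<omega> * y i s + cnj (\<omega> * y i s)" unfolding f_def A_def u_def by simp
      also have "\<dots> = of_real (2 * Re (\<omega> * y i s))" by (rule complex_add_cnj)
      also have "Re (\<omega> * y i s) = c" using s unfolding i(2) [symmetric] by blast
      finally have "h s u = 0" unfolding h_def by (simp only: diff_self)
      then have "card {u \<in> U. h s u \<noteq> 0} < card U"
        using U(1) u by (intro psubset_card_mono) auto
      then have "coeff (\<Prod>u\<in>U. [:1, - h s u:]) (Suc n ^ 2) = 0"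
        unfolding U(2) [symmetric] by (intro coeff_eq_0) (simp only: degree_h)
      then show "s \<in> {s. poly p (of_real s) = 0}" using p by simp
    qed
    have "card {s \<in> {0..1}. Re (\<omega> * snd (g s)) = c} \<le> card {s::real. poly p (of_real s) = 0}"
      by (rule card_mono [OF card_real_roots_le(1) [OF \<open>p \<noteq> 0\<close>] sub])
    also have "\<dots> \<le> Suc n ^ 2" using card_real_roots_le(2) [OF \<open>p \<noteq> 0\<close>] deg_p by linarith
    finally show ?thesis using finite_subset [OF sub card_real_roots_le(1) [OF \<open>p \<noteq> 0\<close>]] by blast
  qed
  moreover have "finite F" unfolding F_def using U(1) by simp
  ultimately show ?thesis using that by blast
qed

end

section \<open>Lengths of joined arcs\<close>

fun polygon_length :: "(real \<Rightarrow> 'a::metric_space) \<Rightarrow> real list \<Rightarrow> real" where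
  "polygon_length g [] = 0"
| "polygon_length g [s] = 0"
| "polygon_length g (s # t # ts) = dist (g s) (g t) + polygon_length g (t # ts)"

lemma polygon_length_eq_sum:
  "polygon_length g ts = (\<Sum>k<length ts - 1. dist (g (ts ! k)) (g (ts ! Suc k)))"
  by (induction g ts rule: polygon_length.induct)
     (simp_all add: lessThan_Suc_eq_insert_0 sum.reindex inj_on_def)

lemma polygon_length_cong:
  "(\<And>s. s \<in> set ts \<Longrightarrow> g s = h (\<phi> s)) \<Longrightarrow> polygon_length g ts = polygon_length h (map \<phi> ts)"
  by (induction g ts rule: polygon_length.induct) simp_all

lemma polygon_length_append:
  assumes "\<And>s t. s \<in> set ss \<Longrightarrow> t \<in> set ts \<Longrightarrow> dist (g s) (g t) \<le> D" "D \<ge> 0"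
  shows "polygon_length g (ss @ ts) \<le> polygon_length g ss + D + polygon_length g ts"
  using assms
proof (induction g ss rule: polygon_length.induct)
  case (2 g s)
  then show ?case by (cases ts) auto
qed auto

lemma polygon_length_rev: "polygon_length g (rev ts) = polygon_length g ts"
proof -
  have snoc: "polygon_length g (ss @ [s, t]) = polygon_length g (ss @ [s]) + dist (g s) (g t)" for ss s t
    by (induction ss rule: induct_list012) auto
  show ?thesis
    by (induction ts rule: induct_list012) (simp_all add: snoc dist_commute)
qed

definition length_at_most :: "(real \<Rightarrow> 'a::metric_space) \<Rightarrow> real \<Rightarrow> bool" where
  "length_at_most g L \<longleftrightarrow>
     (\<forall>ts. sorted ts \<longrightarrow> set ts \<subseteq> {0..1} \<longrightarrow> polygon_length g ts \<le> L)"

lemma curve_length_le: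
  assumes "length_at_most g L"
  shows "curve_length g \<le> ereal L"
  unfolding curve_length_def
  by (rule SUP_least) (use assms in \<open>auto simp: length_at_most_def polygon_length_eq_sum\<close>)

lemma length_at_most_reversepath:
  assumes "length_at_most g L"
  shows "length_at_most (reversepath g) L"
  unfolding length_at_most_def
proof (intro allI impI)
  fix ts :: "real list" assume ts: "sorted ts" "set ts \<subseteq> {0..1}"
  have "polygon_length (reversepath g) ts = polygon_length g (map (\<lambda>s. 1 - s) ts)"
    by (rule polygon_length_cong) (simp add: reversepath_def)
  also have "\<dots> = polygon_length g (rev (map (\<lambda>s. 1 - s) ts))" by (rule polygon_length_rev [symmetric])
  also have "\<dots> \<le> L"
  proof -
    have "sorted (rev (map (\<lambda>s. 1 - s) ts))"
      using ts(1) unfolding sorted_rev_iff_nth_mono by (auto intro: sorted_nth_mono)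
    moreover have "set (rev (map (\<lambda>s. 1 - s) ts)) \<subseteq> {0..1}" using ts(2) by auto
    ultimately show ?thesis using assms unfolding length_at_most_def by blast
  qed
  finally show "polygon_length (reversepath g) ts \<le> L" .
qed

text \<open>
A jump of size at most \<open>D\<close> between the two paths is part of the bound, so that arcs can be joined
without following their endpoints through the subdivisions.
\<close>

lemma length_at_most_joinpaths:
  assumes g: "length_at_most g L" and h: "length_at_most h M"
    and D: "\<And>s t. s \<in> {0..1} \<Longrightarrow> t \<in> {0..1} \<Longrightarrow> dist (g s) (h t) \<le> D" "D \<ge> 0"
  shows "length_at_most (g +++ h) (L + D + M)"
  unfolding length_at_most_def
proof (intro allI impI)
  fix ts :: "real list" assume ts: "sorted ts" "set ts \<subseteq> {0..1}"
  define ss where "ss = takeWhile (\<lambda>s. s \<le> 1 / 2) ts"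
  define us where "us = dropWhile (\<lambda>s. s \<le> 1 / 2) ts"
  have split: "ts = ss @ us" unfolding ss_def us_def by simp
  have sorted: "sorted ss" "sorted us" using ts(1) unfolding split sorted_append by auto
  have ss: "s \<in> {0..1/2}" if "s \<in> set ss" for s
    using that ts(2) set_takeWhileD [of s "\<lambda>s. s \<le> 1 / 2" ts] unfolding ss_def by auto
  have us: "s \<in> {1/2<..1}" if "s \<in> set us" for s
  proof -
    have "us \<noteq> []" using that by auto
    then have "\<not> hd us \<le> 1 / 2" unfolding us_def by (rule hd_dropWhile)
    moreover have "hd us \<le> s" using sorted(2) that by (cases us) auto
    moreover have "s \<le> 1" using that ts(2) split by auto
    ultimately show ?thesis by auto
  qed
  have "polygon_length (g +++ h) ss = polygon_length g (map (\<lambda>s. 2 * s) ss)"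
    by (rule polygon_length_cong) (use ss in \<open>force simp: joinpaths_def\<close>)
  also have "\<dots> \<le> L"
  proof -
    have "sorted (map (\<lambda>s. 2 * s) ss)" using sorted(1) by (simp add: sorted_map_mono mono_onI)
    moreover have "set (map (\<lambda>s. 2 * s) ss) \<subseteq> {0..1}" using ss by force
    ultimately show ?thesis using g unfolding length_at_most_def by blast
  qed
  finally have 1: "polygon_length (g +++ h) ss \<le> L" .
  have "polygon_length (g +++ h) us = polygon_length h (map (\<lambda>s. 2 * s - 1) us)"
    by (rule polygon_length_cong) (use us in \<open>force simp: joinpaths_def\<close>)
  also have "\<dots> \<le> M"
  proof -
    have "sorted (map (\<lambda>s. 2 * s - 1) us)" using sorted(2) by (simp add: sorted_map_mono mono_onI)
    moreover have "set (map (\<lambda>s. 2 * s - 1) us) \<subseteq> {0..1}" using us by force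
    ultimately show ?thesis using h unfolding length_at_most_def by blast
  qed
  finally have 2: "polygon_length (g +++ h) us \<le> M" .
  have "dist ((g +++ h) s) ((g +++ h) t) \<le> D" if "s \<in> set ss" "t \<in> set us" for s t
    using D(1) [of "2 * s" "2 * t - 1"] ss [OF that(1)] us [OF that(2)] by (simp add: joinpaths_def)
  then have "polygon_length (g +++ h) ts \<le>
      polygon_length (g +++ h) ss + D + polygon_length (g +++ h) us"
    unfolding split by (rule polygon_length_append [OF _ D(2)])
  then show "polygon_length (g +++ h) ts \<le> L + D + M" using 1 2 by linarith
qed

lemma join_arcs_in:
  assumes "gs \<noteq> []" "\<And>g s. g \<in> set gs \<Longrightarrow> s \<in> {0..1} \<Longrightarrow> g s \<in> S" "s \<in> {0..1}"
  shows "join_arcs gs s \<in> S"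
  using assms
proof (induction gs arbitrary: s rule: join_arcs.induct)
  case (3 g h gs)
  show ?case
  proof (cases "s \<le> 1 / 2")
    case True
    then show ?thesis using 3(3) [of g "2 * s"] 3(4) by (simp add: joinpaths_def)
  next
    case False
    have "join_arcs (h # gs) (2 * s - 1) \<in> S"
      using 3(3,4) False by (intro 3(1)) auto
    then show ?thesis using False by (simp add: joinpaths_def)
  qed
qed auto

lemma length_at_most_join_arcs:
  fixes L D :: real
  assumes "gs \<noteq> []" and L: "\<And>g. g \<in> set gs \<Longrightarrow> length_at_most g L"
    and S: "\<And>g s. g \<in> set gs \<Longrightarrow> s \<in> {0..1} \<Longrightarrow> g s \<in> S"
    and D: "\<And>p q. p \<in> S \<Longrightarrow> q \<in> S \<Longrightarrow> dist p q \<le> D" "D \<ge> 0"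
  shows "length_at_most (join_arcs gs) (length gs * (L + D) - D)"
  using assms(1-3)
proof (induction gs rule: join_arcs.induct)
  case (2 g)
  then show ?case by simp
next
  case (3 g h gs)
  have "length_at_most (join_arcs (h # gs)) (length (h # gs) * (L + D) - D)"
    by (rule 3(1)) (use 3 in auto)
  moreover have "join_arcs (h # gs) s \<in> S" if "s \<in> {0..1}" for s
    by (rule join_arcs_in) (use 3 that in auto)
  ultimately have "length_at_most (g +++ join_arcs (h # gs)) (L + D + (length (h # gs) * (L + D) - D))"
    using 3 by (intro length_at_most_joinpaths D) auto
  then show ?case by (simp add: algebra_simps)
qed simp

lemma length_at_most_loop_of:
  fixes L D :: real
  assumes "es \<noteq> []"
    and L: "\<And>i k g g'. (i, k, g, g') \<in> set es \<Longrightarrow> length_at_most g L \<and> length_at_most g' L"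
    and S: "\<And>i k g g' s. (i, k, g, g') \<in> set es \<Longrightarrow> s \<in> {0..1} \<Longrightarrow> g s \<in> S \<and> g' s \<in> S"
    and D: "\<And>p q. p \<in> S \<Longrightarrow> q \<in> S \<Longrightarrow> dist p q \<le> D" "D \<ge> 0"
  shows "length_at_most (loop_of es) (2 * (length es * (L + D)))"
proof -
  let ?gs = "map (\<lambda>(i, k, g, g'). g) es" and ?hs = "map (\<lambda>(i, k, g, g'). g') es"
  have ne: "?gs \<noteq> []" "?hs \<noteq> []" using assms(1) by auto
  have g_S: "g s \<in> S" if "g \<in> set ?gs" "s \<in> {0..1}" for g s using that S by fastforce
  have h_S: "g s \<in> S" if "g \<in> set ?hs" "s \<in> {0..1}" for g s using that S by fastforce
  have "length_at_most (join_arcs ?gs) (length ?gs * (L + D) - D)"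
  proof (rule length_at_most_join_arcs [where S = S])
    show "length_at_most g L" if "g \<in> set ?gs" for g using that L by fastforce
  qed (rule ne g_S D; assumption)+
  moreover have "length_at_most (join_arcs ?hs) (length ?hs * (L + D) - D)"
  proof (rule length_at_most_join_arcs [where S = S])
    show "length_at_most g L" if "g \<in> set ?hs" for g using that L by fastforce
  qed (rule ne h_S D; assumption)+
  moreover have "dist (join_arcs ?gs s) (reversepath (join_arcs ?hs) t) \<le> D"
    if "s \<in> {0..1}" "t \<in> {0..1}" for s t
  proof (rule D(1))
    show "join_arcs ?gs s \<in> S" by (rule join_arcs_in [where S = S, OF ne(1) _ that(1)]) (rule g_S)
    have "1 - t \<in> {0..1}" using that(2) by auto
    then show "reversepath (join_arcs ?hs) t \<in> S"
      unfolding reversepath_def by (rule join_arcs_in [where S = S, OF ne(2), rotated]) (rule h_S)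
  qed
  ultimately have "length_at_most (loop_of es)
      ((length ?gs * (L + D) - D) + D + (length ?hs * (L + D) - D))"
    unfolding loop_of_def by (intro length_at_most_joinpaths length_at_most_reversepath D(2))
  then have "length_at_most (loop_of es) (2 * (length es * (L + D)) - D)"
    by (simp add: algebra_simps)
  then show ?thesis using D(2) unfolding length_at_most_def by fastforce
qed

section \<open>Containment in the bidisc\<close>

text \<open>
Over \<open>X \<le> norm x\<close> the level curve has \<open>n + 1\<close> distinct points, so the polynomial \<open>H (x, _) - t\<close> of
degree \<open>n + 1\<close> has no multiple root there.
\<close>

lemma (in transversal_simple_top) polar_projection_inside:
  assumes top: "topology_contained H t X Y" and x: "x \<in> polar_projection H t"
  shows "norm x < X"
proof (rule ccontr)
  assume "\<not> norm x < X"
  then have nx: "X \<le> norm x" by simp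
  obtain f :: "nat \<Rightarrow> complex \<Rightarrow> complex" where
    disj: "disjoint_family_on (\<lambda>i. {(x, f i x) | x. X \<le> norm x}) {..<total_degree H}"
    and eq: "level_curve H t - bidisc X Y = (\<Union>i<total_degree H. {(x, f i x) | x. X \<le> norm x})"
    using top unfolding topology_contained_def by blast
  let ?p = "slice H x - [:t:]"
  have deg_p: "degree ?p = Suc n"
    by (subst diff_conv_add_uminus, subst degree_add_eq_left) (simp_all add: degree_slice)
  have "inj_on (\<lambda>i. f i x) {..<Suc n}"
  proof (rule inj_onI, rule ccontr)
    fix i j assume ij: "i \<in> {..<Suc n}" "j \<in> {..<Suc n}" "f i x = f j x" "i \<noteq> j"
    have "(x, f i x) \<in> {(x, f i x) | x. X \<le> norm x} \<inter> {(x, f j x) | x. X \<le> norm x}"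
      using ij(3) nx by auto
    moreover have "{(x, f i x) | x. X \<le> norm x} \<inter> {(x, f j x) | x. X \<le> norm x} = {}"
      by (rule disjoint_family_onD [OF disj]) (use ij deg in auto)
    ultimately show False by (simp only: empty_iff)
  qed
  then have card: "card ((\<lambda>i. f i x) ` {..<Suc n}) = Suc n" by (simp add: card_image)
  have "(x, f i x) \<in> level_curve H t" if "i < Suc n" for i
  proof -
    have "(x, f i x) \<in> (\<Union>i<total_degree H. {(x, f i x) | x. X \<le> norm x})"
      using that nx deg by (intro UN_I [of i]) auto
    then show ?thesis unfolding eq [symmetric] by (rule DiffD1)
  qed
  then have root: "poly ?p (f i x) = 0" if "i < Suc n" for i
    using that unfolding level_curve_def by (simp add: eval2_slice)
  obtain y where y: "eval2 H (x, y) = t" "eval2 (deriv_y H) (x, y) = 0"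
    using x unfolding polar_projection_def by blast
  have p_y: "poly ?p y = 0" using y(1) by (simp add: eval2_slice)
  have "poly (pderiv ?p) y = 0"
    using y(2) by (simp add: eval2_slice slice_deriv_y pderiv_diff pderiv_pCons)
  obtain q where q: "?p = [:- y, 1:] * q" using p_y by (metis dvdE poly_eq_0_iff_dvd)
  have "poly (pderiv ?p) y = poly q y"
    unfolding q pderiv_mult by (simp add: pderiv_pCons del: mult_pCons_left)
  then have q_y: "poly q y = 0" using \<open>poly (pderiv ?p) y = 0\<close> by simp
  have "q \<noteq> 0" using deg_p q by auto
  then have "degree ?p = Suc (degree q)"
    unfolding q by (simp add: degree_mult_eq del: mult_pCons_left)
  then have deg_q: "degree q = n" using deg_p by simp
  have "poly q z = 0" if "poly ?p z = 0" for z
  proof (cases "z = y")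
    case False
    then show ?thesis using that unfolding q by simp
  qed (simp add: q_y)
  then have "(\<lambda>i. f i x) ` {..<Suc n} \<subseteq> {z. poly q z = 0}" using root by blast
  then have "Suc n \<le> card {z. poly q z = 0}"
    using card_mono [OF poly_roots_finite [OF \<open>q \<noteq> 0\<close>]] card by metis
  also have "\<dots> \<le> n" using card_poly_roots_bound [OF \<open>q \<noteq> 0\<close>] deg_q by simp
  finally show False by simp
qed

lemma level_curve_in_bidisc:
  assumes top: "topology_contained H t X Y" and p: "p \<in> level_curve H t" "norm (fst p) < X"
  shows "p \<in> bidisc X Y"
proof (rule ccontr)
  assume "p \<notin> bidisc X Y"
  then have "p \<in> level_curve H t - bidisc X Y" using p by blast
  then obtain f :: "nat \<Rightarrow> complex \<Rightarrow> complex" and i where "p \<in> {(x, f i x) | x. X \<le> norm x}"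
    using top unfolding topology_contained_def by blast
  then show False using p(2) by auto
qed

lemma dist_bidisc_le:
  assumes "p \<in> bidisc X Y" "q \<in> bidisc X Y"
  shows "dist p q \<le> 2 * X + 2 * Y"
proof -
  have "dist p q \<le> dist (fst p) (fst q) + dist (snd p) (snd q)"
    by (cases p; cases q) (simp add: dist_Pair_Pair sqrt_sum_squares_le_sum)
  moreover have "dist (fst p) (fst q) \<le> 2 * X" "dist (snd p) (snd q) \<le> 2 * Y"
    using assms norm_triangle_ineq4 [of "fst p" "fst q"] norm_triangle_ineq4 [of "snd p" "snd q"]
    unfolding bidisc_def by (auto simp: dist_norm)
  ultimately show ?thesis by linarith
qed

text \<open>
The length is at most the sum of the length of the segment and the variations of the real and
imaginary parts of \<open>y\<close>.
\<close>

lemma (in transversal_simple_top) lift_length_at_most: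
  assumes lift: "is_lift H t a b g" and ab: "norm a < X" "norm b < X"
    and inside: "\<And>s. s \<in> {0..1} \<Longrightarrow> g s \<in> bidisc X Y"
  shows "length_at_most g (2 * X + 4 * Y * Suc n ^ 2)"
  unfolding length_at_most_def
proof (intro allI impI)
  fix ts :: "real list" assume ts: "sorted ts" "set ts \<subseteq> {0..1}"
  let ?m = "length ts - 1"
  have in01: "ts ! k \<in> {0..1}" if "k < length ts" for k using that ts(2) nth_mem by blast
  have var: "(\<Sum>k<?m. \<bar>Re (\<omega> * snd (g (ts ! Suc k))) - Re (\<omega> * snd (g (ts ! k)))\<bar>) \<le> 2 * Y * Suc n ^ 2"
    if \<omega>: "norm \<omega> = 1" for \<omega>
  proof -
    obtain F where F: "finite F"
      "\<And>c. c \<notin> F \<Longrightarrow> finite {s \<in> {0..1}. Re (\<omega> * snd (g s)) = c} \<and>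
         card {s \<in> {0..1}. Re (\<omega> * snd (g s)) = c} \<le> Suc n ^ 2"
      using level_arc_crossings [OF lift] by blast
    have cont: "continuous_on {0..1} (\<lambda>s. Re (\<omega> * snd (g s)))"
      using lift unfolding is_lift_def by (auto intro!: continuous_intros)
    have Y: "\<bar>Re (\<omega> * snd (g s))\<bar> \<le> Y" if "s \<in> {0..1}" for s
    proof -
      have "\<bar>Re (\<omega> * snd (g s))\<bar> \<le> norm (\<omega> * snd (g s))" by (rule abs_Re_le_cmod)
      also have "\<dots> = norm (snd (g s))" using \<omega> by (simp add: norm_mult)
      also have "\<dots> \<le> Y" using inside [OF that] unfolding bidisc_def by auto
      finally show ?thesis .
    qed
    have "Y \<ge> 0" using Y [of 0] by simp
    then show ?thesis
      using variation_le_of_crossings [OF cont Y _ F ts] by simp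
  qed
  have "polygon_length g ts \<le> (\<Sum>k<?m. (ts ! Suc k - ts ! k) * norm (b - a)
      + \<bar>Re (1 * snd (g (ts ! Suc k))) - Re (1 * snd (g (ts ! k)))\<bar>
      + \<bar>Re (- \<i> * snd (g (ts ! Suc k))) - Re (- \<i> * snd (g (ts ! k)))\<bar>)"
    unfolding polygon_length_eq_sum
  proof (rule sum_mono)
    fix k assume "k \<in> {..<?m}"
    then have k: "Suc k < length ts" by auto
    let ?s = "ts ! k" and ?t = "ts ! Suc k"
    have le: "?s \<le> ?t" using k ts(1) by (intro sorted_nth_mono) auto
    have "fst (g ?s) = linepath a b ?s" "fst (g ?t) = linepath a b ?t"
      using lift in01 k unfolding is_lift_def by auto
    then have "fst (g ?s) - fst (g ?t) = of_real (?s - ?t) * (b - a)"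
      by (simp add: linepath_def scaleR_conv_of_real algebra_simps)
    then have "dist (fst (g ?s)) (fst (g ?t)) = (?t - ?s) * norm (b - a)"
      using le by (simp add: dist_norm norm_mult del: of_real_diff)
    moreover have "dist (snd (g ?s)) (snd (g ?t)) \<le>
        \<bar>Re (snd (g ?t)) - Re (snd (g ?s))\<bar> + \<bar>Im (snd (g ?t)) - Im (snd (g ?s))\<bar>"
      using cmod_le [of "snd (g ?t) - snd (g ?s)"] by (simp add: dist_norm norm_minus_commute)
    moreover have "dist (g ?s) (g ?t) \<le> dist (fst (g ?s)) (fst (g ?t)) + dist (snd (g ?s)) (snd (g ?t))"
      by (cases "g ?s"; cases "g ?t") (simp add: dist_Pair_Pair sqrt_sum_squares_le_sum)
    ultimately show "dist (g ?s) (g ?t) \<le> (?t - ?s) * norm (b - a)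
        + \<bar>Re (1 * snd (g ?t)) - Re (1 * snd (g ?s))\<bar> + \<bar>Re (- \<i> * snd (g ?t)) - Re (- \<i> * snd (g ?s))\<bar>"
      by simp
  qed
  also have "\<dots> \<le> norm (b - a) + 2 * Y * Suc n ^ 2 + 2 * Y * Suc n ^ 2"
  proof -
    have "(\<Sum>k<?m. (ts ! Suc k - ts ! k)) \<le> 1"
    proof (cases ts)
      case (Cons s ss)
      have "(\<Sum>k<?m. (ts ! Suc k - ts ! k)) = ts ! ?m - ts ! 0" by (rule sum_lessThan_telescope)
      then show ?thesis using in01 [of ?m] in01 [of 0] Cons by simp
    qed simp
    then have "(\<Sum>k<?m. (ts ! Suc k - ts ! k) * norm (b - a)) \<le> 1 * norm (b - a)"
      unfolding sum_distrib_right [symmetric] by (rule mult_right_mono) simp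
    then show ?thesis unfolding sum.distrib using var [of 1] var [of "- \<i>"] by simp
  qed
  also have "\<dots> \<le> 2 * X + 4 * Y * Suc n ^ 2"
    using norm_triangle_ineq4 [of b a] ab by simp
  finally show "polygon_length g ts \<le> 2 * X + 4 * Y * Suc n ^ 2" .
qed

section \<open>The explicit bound\<close>

lemma Suc_le_two_power: "Suc n \<le> 2 ^ n"
  by (induction n) auto

text \<open>
Squaring keeps the exponent an integer: the bound for \<open>n * Suc n\<close> itself is \<open>2 powr (3 * n / 2)\<close>, which
is what the constant \<open>24\<close> leaves room for.
\<close>

lemma branch_count_le_power:
  assumes "n \<ge> 2"
  shows "(n * Suc n) ^ 2 \<le> 2 ^ (3 * n)"
  using assms
proof (induction n rule: dec_induct)
  case base
  then show ?case by simp
next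
  case (step n)
  define q where "q = n * n"
  have q: "2 * n \<le> q" unfolding q_def using step(1) by (rule mult_le_mono1)
  have 1: "Suc n * Suc (Suc n) = q + 3 * n + 2"
    unfolding q_def mult_Suc mult_Suc_right by linarith
  have 2: "2 * (n * Suc n) = 2 * q + 2 * n"
    unfolding q_def by (simp only: mult_Suc_right distrib_left add.commute)
  have "Suc n * Suc (Suc n) \<le> 2 * (n * Suc n)" unfolding 1 2 using q step(1) by linarith
  then have "(Suc n * Suc (Suc n)) ^ 2 \<le> (2 * (n * Suc n)) ^ 2" by (intro power_mono) auto
  also have "\<dots> = 4 * (n * Suc n) ^ 2" by (subst power_mult_distrib) simp
  also have "\<dots> \<le> 8 * (n * Suc n) ^ 2" by (rule mult_le_mono1) simp
  also have "\<dots> \<le> 8 * 2 ^ (3 * n)" using step by simp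
  also have "\<dots> = 2 ^ (3 * Suc n)" by (simp add: power_add)
  finally show ?case .
qed

text \<open>
From \<open>2 (n + 1) \<le> 3 n\<close> the number of pairs is at most \<open>2 ^ (729 / 32 * n ^ 12 * m)\<close>. Since
\<open>729 / 32 < 23\<close>, a factor \<open>2 ^ (n ^ 12 * m)\<close> remains for the length of the arcs.
\<close>

lemma explicit_bound:
  fixes n m :: nat
  assumes n: "n \<ge> 2" and m: "m \<ge> 1"
  shows "(12 + 8 * Suc n ^ 2) * (n * Suc n) ^ (2 * n ^ 6 * Suc n ^ 5 * m) < 2 ^ (24 * n ^ 12 * m)"
proof -
  let ?K = "n ^ 6 * Suc n ^ 5 * m"
  have exp: "3 * n * ?K \<le> 23 * n ^ 12 * m"
  proof -
    have "2 * Suc n \<le> 3 * n" using n by simp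
    then have "(2 * Suc n) ^ 5 \<le> (3 * n) ^ 5" by (intro power_mono) auto
    moreover have "(2 * Suc n) ^ 5 = 32 * Suc n ^ 5" "(3 * n) ^ 5 = 243 * n ^ 5"
      unfolding power_mult_distrib by simp_all
    ultimately have "32 * Suc n ^ 5 \<le> 243 * n ^ 5" by (simp only:)
    then have "(3 * n * n ^ 6 * m) * (32 * Suc n ^ 5) \<le> (3 * n * n ^ 6 * m) * (243 * n ^ 5)"
      by (rule mult_le_mono2)
    moreover have "(3 * n * n ^ 6 * m) * (32 * Suc n ^ 5) = 32 * (3 * n * ?K)" by (simp only: mult_ac)
    moreover have "(3 * n * n ^ 6 * m) * (243 * n ^ 5) = 729 * (n ^ 12 * m)"
    proof -
      have "n * n ^ 6 * n ^ 5 = n ^ 12" by (simp flip: power_Suc power_add)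
      then show ?thesis by (simp add: mult_ac)
    qed
    ultimately have "32 * (3 * n * ?K) \<le> 729 * (n ^ 12 * m)" by (simp only:)
    then have "32 * (3 * n * ?K) \<le> 32 * (23 * (n ^ 12 * m))" by linarith
    then show ?thesis by (simp only: mult_le_cancel1 mult.assoc)
  qed
  have "2 * n ^ 6 * Suc n ^ 5 * m = 2 * ?K" by (simp only: mult.assoc)
  then have "(n * Suc n) ^ (2 * n ^ 6 * Suc n ^ 5 * m) = ((n * Suc n) ^ 2) ^ ?K"
    by (simp only: power_mult)
  also have "\<dots> \<le> (2 ^ (3 * n)) ^ ?K" by (intro power_mono branch_count_le_power n) simp
  also have "\<dots> = 2 ^ (3 * n * ?K)" by (simp only: power_mult)
  also have "\<dots> \<le> 2 ^ (23 * n ^ 12 * m)" by (intro power_increasing exp) simp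
  finally have 1: "(n * Suc n) ^ (2 * n ^ 6 * Suc n ^ 5 * m) \<le> 2 ^ (23 * n ^ 12 * m)" .
  have "Suc n ^ 2 \<le> (2 ^ n) ^ 2" by (intro power_mono Suc_le_two_power) simp
  then have "12 + 8 * Suc n ^ 2 \<le> 20 * (2 ^ n) ^ 2"
    using one_le_power [of "Suc n" 2] by linarith
  also have "\<dots> < 2 ^ 5 * (2 ^ n) ^ 2" by simp
  also have "\<dots> = 2 ^ (5 + n * 2)" by (simp only: power_add power_mult)
  also have "\<dots> \<le> 2 ^ (n ^ 12 * m)"
  proof (rule power_increasing)
    have "(2::nat) ^ 11 \<le> n ^ 11" using n by (intro power_mono) auto
    then have "n * 2048 \<le> n * n ^ 11" by (intro mult_le_mono2) simp
    moreover have "n * n ^ 11 = n ^ 12" by (simp flip: power_Suc)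
    moreover have "n ^ 12 * 1 \<le> n ^ 12 * m" using m by (intro mult_le_mono2)
    ultimately show "5 + n * 2 \<le> n ^ 12 * m" using n by linarith
  qed simp
  finally have 2: "12 + 8 * Suc n ^ 2 < 2 ^ (n ^ 12 * m)" .
  have "(12 + 8 * Suc n ^ 2) * (n * Suc n) ^ (2 * n ^ 6 * Suc n ^ 5 * m) \<le>
      (12 + 8 * Suc n ^ 2) * 2 ^ (23 * n ^ 12 * m)"
    by (intro mult_le_mono2 1)
  also have "\<dots> < 2 ^ (n ^ 12 * m) * 2 ^ (23 * n ^ 12 * m)"
    by (intro mult_strict_right_mono 2) simp
  also have "\<dots> = 2 ^ (24 * n ^ 12 * m)"
    by (simp flip: power_add)
  finally show ?thesis .
qed

text \<open>
At a noncritical point the tangent line is vertical exactly when \<open>dH/dy\<close> vanishes.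
\<close>

lemma proj_critical_values_noncritical:
  assumes "t \<notin> critical_values H"
  shows "proj_critical_values H t = polar_projection H t"
proof -
  have "(\<forall>u v. eval2 (deriv_x H) p * u + eval2 (deriv_y H) p * v = 0 \<longrightarrow> u = 0) \<longleftrightarrow>
      eval2 (deriv_y H) p = 0" if p: "eval2 H p = t" for p
  proof
    assume vert: "\<forall>u v. eval2 (deriv_x H) p * u + eval2 (deriv_y H) p * v = 0 \<longrightarrow> u = 0"
    show "eval2 (deriv_y H) p = 0"
    proof (rule ccontr)
      assume "eval2 (deriv_y H) p \<noteq> 0"
      then have "eval2 (deriv_x H) p * 1 + eval2 (deriv_y H) p * (- eval2 (deriv_x H) p / eval2 (deriv_y H) p) = 0"
        by simp
      then show False using vert by (metis zero_neq_one)
    qed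
  next
    assume y0: "eval2 (deriv_y H) p = 0"
    have "eval2 (deriv_x H) p \<noteq> 0"
    proof
      assume "eval2 (deriv_x H) p = 0"
      then have "p \<in> critical_points H" using y0 unfolding critical_points_def by simp
      then show False using assms p unfolding critical_values_def by blast
    qed
    then show "\<forall>u v. eval2 (deriv_x H) p * u + eval2 (deriv_y H) p * v = 0 \<longrightarrow> u = 0"
      using y0 by simp
  qed
  then have "proj_critical_values H t = fst ` {p. eval2 H p = t \<and> eval2 (deriv_y H) p = 0}"
    unfolding proj_critical_values_def level_curve_def by (intro arg_cong [of _ _ "image fst"]) auto
  also have "\<dots> = polar_projection H t" unfolding polar_projection_def by force
  finally show ?thesis .
qed

theorem lemma1p42:
  fixes n :: nat and H :: "complex poly poly" and a t :: complex
    and \<alpha> :: "real \<Rightarrow> complex" and \<delta> :: "real \<Rightarrow> complex \<times> complex" and X Y :: real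
  assumes "n \<ge> 2"
    and "total_degree H = n + 1"
    and "ultra_morse H"
    and "y_axis_transversal H"
    and "a \<in> critical_values H"
    and "t \<notin> critical_values H"
    and "critically_regular H \<alpha>"
    and "pathstart \<alpha> = t"
    and "pathfinish \<alpha> = a"
    and "canonical_representative H \<alpha> \<delta>"
    and "X > 0"
    and "Y > 0"
    and "topology_contained H t X Y"
  shows "curve_length \<delta> < ereal (2 ^ (24 * n ^ 12 * num_edges \<alpha>) * max X Y)"
proof -
  interpret transversal_simple_top H n
    using assms(1-4) by unfold_locales (auto simp: ultra_morse_def y_axis_transversal_def)
  define m where "m = num_edges \<alpha>"
  define \<mu> where "\<mu> = generic_card H"
  have edges: "polygonal_with_edges \<alpha> m"
    using assms(7) unfolding critically_regular_def m_def num_edges_def by (blast intro: LeastI_ex)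
  then have "m \<ge> 1" unfolding polygonal_with_edges_def by (cases m) auto
  obtain A x es where branches: "critical_branches H \<alpha> x"
    and cont: "continued_curve H \<alpha> x A 0 es" and \<delta>: "\<delta> = loop_of es"
    using assms(10) unfolding canonical_representative_def by blast
  have noncrit: "\<alpha> \<tau> \<notin> critical_values H" if "\<tau> \<in> {0..<1}" for \<tau>
    using assms(7) that unfolding critically_regular_def regular_path_def by blast
  have x_cont: "continuous_on {0..<1} (x j)" if "j < \<mu>" for j
    using branches that unfolding critical_branches_def \<mu>_def by blast
  have x_bij: "bij_betw (\<lambda>j. x j \<tau>) {..<\<mu>} (polar_projection H (\<alpha> \<tau>))" if "\<tau> \<in> {0..<1}" for \<tau>
  proof -
    have "bij_betw (\<lambda>j. x j \<tau>) {..<\<mu>} (proj_critical_values H (\<alpha> \<tau>))"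
      using branches that unfolding critical_branches_def \<mu>_def by blast
    then show ?thesis by (simp only: proj_critical_values_noncritical [OF noncrit [OF that]])
  qed
  have \<alpha>0: "\<alpha> 0 = t" using assms(8) by (simp add: pathstart_def)
  have x_bij0: "bij_betw (\<lambda>j. x j 0) {..<\<mu>} (polar_projection H t)"
    using x_bij [of 0] \<alpha>0 by simp

  obtain E where E: "finite E" "card E \<le> 2 * n ^ 6 * Suc n ^ 5 * m"
    and persist: "alignments_persist x \<mu> E"
    using special_times [OF edges x_cont x_bij] by blast
  have inv: "valid_pairs H t (\<lambda>j. x j 0) \<mu> es" "pieces (\<lambda>j. x j 0) \<mu> es \<le> \<mu> ^ card (E \<inter> {0..})"
    using continued_curve_pieces [OF branches E(1) persist [unfolded \<mu>_def] cont] \<alpha>0 unfolding \<mu>_def by simp_all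
  have "es \<noteq> []" using inv(1) unfolding valid_pairs_def by (rule conjunct1)
  then obtain e where e: "e \<in> set es" using hd_in_set by blast
  obtain i k g g' where "e = (i, k, g, g')" by (cases e)
  then have "i < \<mu>"
    using bspec [OF conjunct2 [OF inv(1) [unfolded valid_pairs_def]] e] by simp
  then have "\<mu> \<ge> 1" by simp
  have "\<mu> \<le> n * Suc n"
  proof -
    obtain \<xi> where "(\<lambda>i. \<xi> i t) ` {..<n * Suc n} = polar_projection H t"
      using polar_projection_roots by metis
    then have "card (polar_projection H t) \<le> n * Suc n"
      using card_image_le [of "{..<n * Suc n}" "\<lambda>i. \<xi> i t"] by simp
    then show ?thesis using bij_betw_same_card [OF x_bij0] by simp
  qed
  have "length es \<le> \<mu> ^ card (E \<inter> {0..})"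
    using length_le_pieces inv(2) by (rule order_trans)
  also have "\<dots> \<le> \<mu> ^ (2 * n ^ 6 * Suc n ^ 5 * m)"
    using card_mono [OF E(1), of "E \<inter> {0..}"] E(2) \<open>\<mu> \<ge> 1\<close> by (intro power_increasing) auto
  also have "\<dots> \<le> (n * Suc n) ^ (2 * n ^ 6 * Suc n ^ 5 * m)"
    using \<open>\<mu> \<le> n * Suc n\<close> by (rule power_mono) simp
  finally have few: "length es \<le> (n * Suc n) ^ (2 * n ^ 6 * Suc n ^ 5 * m)" .

  define R where "R = max X Y"
  \<comment> \<open>\<open>L\<close> bounds the length of one lifting, and \<open>D\<close> the diameter of the bidisc\<close>
  define L where "L = 2 * X + 4 * Y * Suc n ^ 2"
  define D where "D = 2 * X + 2 * Y"
  have ends: "norm (x i 0) < X" if "i < \<mu>" for i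
    using polar_projection_inside [OF assms(13)] x_bij0 that unfolding bij_betw_def by blast
  have inside: "g s \<in> bidisc X Y" if "is_lift H t (x i 0) (x k 0) g" "i < \<mu>" "k < \<mu>" "s \<in> {0..1}" for i k g s
  proof (rule level_curve_in_bidisc [OF assms(13)])
    show "g s \<in> level_curve H t" using that unfolding is_lift_def by blast
    have "linepath (x i 0) (x k 0) s \<in> closed_segment (x i 0) (x k 0)"
      using that(4) linepath_image_01 by blast
    also have "\<dots> \<subseteq> ball 0 X" using ends that by (intro closed_segment_subset convex_ball) auto
    finally show "norm (fst (g s)) < X" using that unfolding is_lift_def by simp
  qed
  have "length_at_most (loop_of es) (2 * (length es * (L + D)))"
  proof (rule length_at_most_loop_of [where S = "bidisc X Y"])
    fix i k g g' assume "(i, k, g, g') \<in> set es"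
    then have p: "i < \<mu>" "k < \<mu>" "is_lift H t (x i 0) (x k 0) g" "is_lift H t (x i 0) (x k 0) g'"
      using inv(1) unfolding valid_pairs_def by auto
    show "length_at_most g L \<and> length_at_most g' L"
      unfolding L_def using p ends inside by (intro conjI lift_length_at_most) blast+
    show "g s \<in> bidisc X Y \<and> g' s \<in> bidisc X Y" if "s \<in> {0..1}" for s
      using inside p that by blast
  next
    show "dist p q \<le> D" if "p \<in> bidisc X Y" "q \<in> bidisc X Y" for p q
      unfolding D_def using that by (rule dist_bidisc_le)
    show "D \<ge> 0" unfolding D_def using assms(11,12) by simp
  qed (rule \<open>es \<noteq> []\<close>)
  then have "curve_length \<delta> \<le> ereal (2 * (length es * (L + D)))"
    unfolding \<delta> by (rule curve_length_le)
  also have "2 * (length es * (L + D)) \<le> real ((12 + 8 * Suc n ^ 2) * length es) * R"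
  proof -
    have "L + D \<le> (6 + 4 * Suc n ^ 2) * R"
    proof -
      have "4 * X \<le> 4 * R" "(2 + 4 * Suc n ^ 2) * Y \<le> (2 + 4 * Suc n ^ 2) * R"
        unfolding R_def by (simp, intro mult_left_mono) auto
      then show ?thesis unfolding L_def D_def by (simp add: algebra_simps)
    qed
    then have "2 * (length es * (L + D)) \<le> 2 * (length es * ((6 + 4 * Suc n ^ 2) * R))"
      by (intro mult_left_mono) auto
    then show ?thesis by (simp add: algebra_simps)
  qed
  also have "real ((12 + 8 * Suc n ^ 2) * length es) * R < real (2 ^ (24 * n ^ 12 * m)) * R"
  proof (rule mult_strict_right_mono)
    have "(12 + 8 * Suc n ^ 2) * length es \<le>
        (12 + 8 * Suc n ^ 2) * (n * Suc n) ^ (2 * n ^ 6 * Suc n ^ 5 * m)"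
      using few by (rule mult_le_mono2)
    also have "\<dots> < 2 ^ (24 * n ^ 12 * m)" by (rule explicit_bound [OF assms(1) \<open>m \<ge> 1\<close>])
    finally show "real ((12 + 8 * Suc n ^ 2) * length es) < real (2 ^ (24 * n ^ 12 * m))"
      by (simp only: of_nat_less_iff)
    show "R > 0" unfolding R_def using assms(11) by simp
  qed
  finally show ?thesis unfolding R_def m_def by simp
qed

end
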